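(* Let $E$ be an admissible compact set, $\mu\in\mathcal R(E)$, $m\ge 1$ an integer, and $F\in\mathcal H(E)$. Suppose that $F$ has poles of total multiplicity exactly $m$ in $D_{\rho_m(F)}$, at the (not necessarily distinct) points $\lambda_1,\dots,\lambda_m$. Then the Padé-orthogonal approximant $[n/m]_F^{\mu}$ is uniquely determined for all sufficiently large $n$, and the sequence $[n/m]_F^\mu$ converges to $F$ as $n\to\infty$ uniformly on each compact subset of $D_{\rho_m(F)}\setminus\{\lambda_1,\dots,\lambda_m\}$. Moreover, for every compact subset $K$ of $D_{\rho_m(F)}\setminus\{\lambda_1,\dots,\lambda_m\}$, $$\limsup_{n\to\infty}\|F-[n/m]_F^{\mu}\|_K^{1/n}\le \frac{\max\{|\Phi(z)|: z\in K\}}{\rho_m(F)},$$ where $\|\cdot\|_K$ is the sup-norm on $K$ and, if $K\subset E$, $\max\{|\Phi(z)|:z\in K\}$ is replaced by $1$. Additionally, $$\limsup_{n\to\infty}\|Q_{n,m}^{\mu}-Q_m\|^{1/n}\le \frac{\max\{|\Phi(\lambda_j)|: j=1,\dots,m\}}{\rho_m(F)}<1,$$ where $Q_m(z)=\prod_{k=1}^m (z-\lambda_k)$ and $\|\cdot\|$ denotes (for example) the coefficient norm in the space of polynomials of degree at most $m$.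
   Context: Admissible compact set: an infinite compact set $E\subset\mathbb C$ such that $\overline{\mathbb C}\setminus E$ is simply connected and such that, with $\Phi$ the unique conformal map of $\overline{\mathbb C}\setminus E$ onto $\overline{\mathbb C}\setminus\{w:|w|\le 1\}$ satisfying $\Phi(\infty)=\infty$, $\Phi'(\infty)>0$, the inverse $\Psi=\Phi^{-1}$ extends continuously to $\overline{\mathbb C}\setminus\{w:|w|<1\}$. $\mathcal M(E)$ is the set of finite positive Borel measures $\mu$ with infinite support contained in $E$; $\langle g,h\rangle_\mu=\int g\,\overline h\,d\mu$; $p_n(z)=\kappa_n z^n+\cdots$, $\kappa_n>0$, $n=0,1,\dots$, are the orthonormal polynomials with respect to $\mu$. $\mathcal R(E)$ is the set of $\mu\in\mathcal M(E)$ such that $\lim_{n\to\infty}p_n(z)/p_{n+1}(z)=1/\Phi(z)$ uniformly on compact subsets of $\overline{\mathbb C}\setminus E$. $\mathcal H(E)$ is the space of functions holomorphic in some neighborhood of $E$. For $\rho>1$, $\Gamma_\rho=\{z:|\Phi(z)|=\rho\}$, and $D_\rho$ (a canonical domain) is the bounded connected component of the complement of $\Gamma_\rho$. $\rho_m(F)$ is the index $\rho$ of the largest canonical domain $D_\rho$ to which $F$ can be extended as a meromorphic function with at most $m$ poles (counting multiplicities); if $F$ so extends to all of $\mathbb C$, then $\rho_m(F)=\infty$, $D_\infty=\mathbb C$ and $1/\infty=0$. $F$ also denotes its meromorphic extension. If $K\not\subset E$, then $\max\{|\Phi(z)|:z\in K\}$ is taken over the points of $K$ outside $E$. Padé-orthogonal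 approximant: for nonnegative integers $n,m$, an $(n,m)$ Padé-orthogonal approximant of $F$ with respect to $\mu$ is a rational function $[n/m]_F^\mu=P_{n,m}^\mu/Q_{n,m}^\mu$, where $P_{n,m}^\mu,Q_{n,m}^\mu$ are polynomials with $\deg P_{n,m}^\mu\le n$, $\deg Q_{n,m}^\mu\le m$, $Q_{n,m}^\mu\not\equiv0$, $\langle Q_{n,m}^\mu F-P_{n,m}^\mu,p_j\rangle_\mu=0$ for $j=0,1,\dots,n+m$, and $Q_{n,m}^\mu$ is normalized to be monic. (It always exists but need not be unique.) *)

theory Defs
  imports "HOL-Complex_Analysis.Complex_Analysis" "HOL-Computational_Algebra.Fraction_Field"
begin

section \<open>Admissible compact sets\<close>

definition simply_connected_space :: "'a topology \<Rightarrow> bool" where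
  "simply_connected_space X \<longleftrightarrow>
     path_connected_space X \<and>
     (\<forall>f. continuous_map (top_of_set (sphere (0::complex) 1)) X f \<longrightarrow>
        (\<exists>c. homotopic_with (\<lambda>_. True) (top_of_set (sphere (0::complex) 1)) X f (\<lambda>_. c)))"

abbreviation riemann_sphere :: "complex option topology" where
  "riemann_sphere \<equiv> Alexandroff_compactification euclidean"

text \<open>
  The conformal map of the complement of \<open>E\<close> in the Riemann sphere onto the exterior of the closed
  unit disc, restricted to the finite points; \<open>\<Phi>\<close> is unconstrained on \<open>E\<close>. The two limits express
  \<open>\<Phi>(\<infinity>) = \<infinity>\<close> and \<open>\<Phi>'(\<infinity>) = c > 0\<close>; holomorphy at infinity then follows from Riemann's theorem
  on removable singularities, applied to \<open>1 / \<Phi>(1/w)\<close> at \<open>w = 0\<close>.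
\<close>
definition exterior_map :: "complex set \<Rightarrow> (complex \<Rightarrow> complex) \<Rightarrow> bool" where
  "exterior_map E \<Phi> \<longleftrightarrow>
     \<Phi> holomorphic_on (- E) \<and>
     bij_betw \<Phi> (- E) (- cball 0 1) \<and>
     filterlim \<Phi> at_infinity at_infinity \<and>
     (\<exists>c::real. c > 0 \<and> ((\<lambda>z. \<Phi> z / z) \<longlongrightarrow> complex_of_real c) at_infinity)"

text \<open>
  The map \<open>\<Phi>\<close> exists by the Riemann mapping theorem and is unique off \<open>E\<close>, so the universal
  quantifier speaks of this one map. Its inverse is continuous at infinity in any case, so
  the continuous extension only has to be required at finite points.
\<close>
definition admissible :: "complex set \<Rightarrow> bool" where
  "admissible E \<longleftrightarrow>
     compact E \<and> infinite E \<and>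
     simply_connected_space (subtopology riemann_sphere (- Some ` E)) \<and>
     (\<forall>\<Phi>. exterior_map E \<Phi> \<longrightarrow>
        (\<exists>\<Psi>. continuous_on {w. norm w \<ge> 1} \<Psi> \<and>
              (\<forall>w. norm w > 1 \<longrightarrow> \<Psi> w = inv_into (- E) \<Phi> w)))"

section \<open>Measures and orthonormal polynomials\<close>

definition measure_support :: "complex measure \<Rightarrow> complex set" where
  "measure_support \<mu> = {z. \<forall>U. open U \<and> z \<in> U \<longrightarrow> emeasure \<mu> U > 0}"

definition class_M :: "complex set \<Rightarrow> complex measure set" where
  "class_M E = {\<mu>. finite_measure \<mu> \<and> sets \<mu> = sets borel \<and>
                   infinite (measure_support \<mu>) \<and> measure_support \<mu> \<subseteq> E}"

text \<open>
  The complement of the support is a null set. Integrating over the support only makes the integral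
  independent of the values (and of the measurability) of \<open>g\<close> and \<open>h\<close> elsewhere, which matters
  for a function that is known to be holomorphic only near \<open>E\<close>.
\<close>
definition inner_mu :: "complex measure \<Rightarrow> (complex \<Rightarrow> complex) \<Rightarrow> (complex \<Rightarrow> complex) \<Rightarrow> complex" where
  "inner_mu \<mu> g h = set_lebesgue_integral \<mu> (measure_support \<mu>) (\<lambda>z. g z * cnj (h z))"

definition orthonormal_polys :: "complex measure \<Rightarrow> (nat \<Rightarrow> complex poly) \<Rightarrow> bool" where
  "orthonormal_polys \<mu> p \<longleftrightarrow>
     (\<forall>n. degree (p n) = n \<and> (\<exists>\<kappa>::real. \<kappa> > 0 \<and> lead_coeff (p n) = complex_of_real \<kappa>)) \<and>
     (\<forall>i j. inner_mu \<mu> (poly (p i)) (poly (p j)) = (if i = j then 1 else 0))"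

text \<open>
  The compact subsets of the complement of \<open>E\<close> in the Riemann sphere are, up to the point at
  infinity (where all functions involved vanish), the closed subsets of \<open>- E\<close>, bounded or not.
\<close>
definition class_R :: "complex set \<Rightarrow> complex measure set" where
  "class_R E = {\<mu> \<in> class_M E. \<forall>\<Phi> p. exterior_map E \<Phi> \<and> orthonormal_polys \<mu> p \<longrightarrow>
     (\<forall>K. closed K \<and> K \<subseteq> - E \<longrightarrow>
        uniform_limit K (\<lambda>n z. poly (p n) z / poly (p (Suc n)) z) (\<lambda>z. 1 / \<Phi> z) sequentially)}"

section \<open>Canonical domains and meromorphic extension\<close>

definition level_curve :: "complex set \<Rightarrow> (complex \<Rightarrow> complex) \<Rightarrow> real \<Rightarrow> complex set" where
  "level_curve E \<Phi> \<rho> = {z. z \<notin> E \<and> norm (\<Phi> z) = \<rho>}"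

definition canonical_domain :: "complex set \<Rightarrow> (complex \<Rightarrow> complex) \<Rightarrow> ereal \<Rightarrow> complex set" where
  "canonical_domain E \<Phi> \<rho> =
     (if \<rho> = \<infinity> then UNIV else inside (level_curve E \<Phi> (real_of_ereal \<rho>)))"

definition pole_order :: "(complex \<Rightarrow> complex) \<Rightarrow> complex \<Rightarrow> nat" where
  "pole_order G z = (if is_pole G z then nat (- zorder G z) else 0)"

definition meromorphic_extension ::
    "complex set \<Rightarrow> (complex \<Rightarrow> complex) \<Rightarrow> complex set \<Rightarrow> (complex \<Rightarrow> complex) \<Rightarrow> bool" where
  "meromorphic_extension E F D G \<longleftrightarrow>
     G nicely_meromorphic_on D \<and> (\<forall>z\<in>E. \<forall>\<^sub>F w in nhds z. G w = F w)"

definition at_most_poles :: "nat \<Rightarrow> (complex \<Rightarrow> complex) \<Rightarrow> complex set \<Rightarrow> bool" where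
  "at_most_poles m G D \<longleftrightarrow>
     finite {z \<in> D. is_pole G z} \<and> (\<Sum>z | z \<in> D \<and> is_pole G z. pole_order G z) \<le> m"

definition rho_index ::
    "complex set \<Rightarrow> (complex \<Rightarrow> complex) \<Rightarrow> nat \<Rightarrow> (complex \<Rightarrow> complex) \<Rightarrow> ereal" where
  "rho_index E \<Phi> m F =
     Sup {\<rho>. \<rho> > 1 \<and> (\<exists>G. meromorphic_extension E F (canonical_domain E \<Phi> \<rho>) G \<and>
                          at_most_poles m G (canonical_domain E \<Phi> \<rho>))}"

section \<open>Pade-orthogonal approximants\<close>

definition pade_orthogonal ::
    "complex measure \<Rightarrow> (nat \<Rightarrow> complex poly) \<Rightarrow> (complex \<Rightarrow> complex) \<Rightarrow> nat \<Rightarrow> nat \<Rightarrow>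
     complex poly \<Rightarrow> complex poly \<Rightarrow> bool" where
  "pade_orthogonal \<mu> p F n m P Q \<longleftrightarrow>
     degree P \<le> n \<and> degree Q \<le> m \<and> Q \<noteq> 0 \<and> lead_coeff Q = 1 \<and>
     (\<forall>j\<le>n + m. inner_mu \<mu> (\<lambda>z. poly Q z * F z - poly P z) (poly (p j)) = 0)"

definition pade_approximant ::
    "complex measure \<Rightarrow> (nat \<Rightarrow> complex poly) \<Rightarrow> (complex \<Rightarrow> complex) \<Rightarrow> nat \<Rightarrow> nat \<Rightarrow>
     complex poly fract \<Rightarrow> bool" where
  "pade_approximant \<mu> p F n m R \<longleftrightarrow> (\<exists>P Q. pade_orthogonal \<mu> p F n m P Q \<and> R = Fract P Q)"

section \<open>Norms\<close>

text \<open>The added \<open>0\<close> is relevant for the empty set only.\<close>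
definition sup_norm_on :: "complex set \<Rightarrow> (complex \<Rightarrow> complex) \<Rightarrow> real" where
  "sup_norm_on K f = Sup (insert 0 ((\<lambda>z. norm (f z)) ` K))"

definition coeff_norm :: "nat \<Rightarrow> complex poly \<Rightarrow> real" where
  "coeff_norm m q = Max ((\<lambda>i. norm (coeff q i)) ` {..m})"

text \<open>
  For compact \<open>K\<close> not contained in \<open>E\<close> the supremum is attained, since \<open>|\<Phi>| > 1\<close> off \<open>E\<close>
  and \<open>|\<Phi>|\<close> tends to \<open>1\<close> at \<open>E\<close>.
\<close>
definition max_Phi :: "complex set \<Rightarrow> (complex \<Rightarrow> complex) \<Rightarrow> complex set \<Rightarrow> real" where
  "max_Phi E \<Phi> K = (if K \<subseteq> E then 1 else (SUP z\<in>K - E. norm (\<Phi> z)))"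

end

(* The problem is moved to the exterior of the unit disc by Psi, the inverse of the conformal map Phi.
   Let s_n be the Cauchy transform of conj(p_n) dmu. The products p_n s_n are locally bounded off E, and
   the biorthogonality relations of the p_k and s_n determine the Laurent coefficients of every limit
   function of (p_n s_n)(Psi) Psi'; hence this sequence tends to 1/w, and s_(n+i)/s_n tends to
   Phi^(-i).

   Write F = A/Q_m with Q_m the polynomial of the poles. Moving the contour in <Q F, p_j> across the poles, the
   m orthogonality relations say that m residue functionals of Q are exponentially small. Since the
   functions 1/w, ..., 1/w^m span the holomorphic functions modulo the m points Phi(lambda_k), all
   residue functionals are small at the same rate, and Q is close to a multiple of Q_m. The same
   estimate bounds the Fourier coefficients of Q F - P on E; the expansion of Q_m (Q F - P) in the
   orthonormal polynomials carries the bound from E to the level sets of Phi. *)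

theory Submission
  imports Defs
begin

section \<open>Integrals over circles about the origin\<close>

text \<open>Only ratio asymptotics are available, so every rate is proved with an arbitrarily small
  loss, and auxiliary radii separate the essential ones. After the common factor
  \<open>sig n\<close> is split off, the relations with p_(n+1), ..., p_(n+m) become residue
  functionals at \<open>sig (n + i) / sig n\<close>, which is close to w^(-i); that is why exactly
  these m conditions determine Q modulo the poles. The factor \<open>sig n\<close> stays inside the
  functional as long as possible, because it is about r1^(-n) on the outer circle and dividing by it
  is expensive. The Fourier coefficients of Q F are estimated before the division and keep the rate
  1/R; Q itself is recovered after it and gets r1/R. With r1 near the largest |Phi(lambda_k)| and R
  near rho_m(F) this explains the two different bounds. The expansion does not reach past the poles
  for Q F - P, so it is used twice: on E for Q F - P, then on a larger canonical domain for Q_m (Q F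
  - P). There the first n+m+1 coefficients are bounded through the values on E, the later ones
  through a contour of radius R.\<close>

definition cint :: "real \<Rightarrow> (complex \<Rightarrow> complex) \<Rightarrow> complex" where
  "cint r f = contour_integral (circlepath 0 r) f / (2 * of_real pi * \<i>)"

lemma cint_cong: "0 < r \<Longrightarrow> (\<And>w. norm w = r \<Longrightarrow> f w = g w) \<Longrightarrow> cint r f = cint r g"
  unfolding cint_def by (intro arg_cong2[where f="(/)"] contour_integral_cong) auto

lemma circle_integrable:
  "0 < r \<Longrightarrow> continuous_on (sphere 0 r) f \<Longrightarrow> f contour_integrable_on (circlepath 0 r)"
  by (rule contour_integrable_continuous_circlepath) simp

lemma cint_add:
  assumes "0 < r" "continuous_on (sphere 0 r) f" "continuous_on (sphere 0 r) g"
  shows "cint r (\<lambda>w. f w + g w) = cint r f + cint r g"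
  unfolding cint_def using assms
  by (simp add: contour_integral_add circle_integrable add_divide_distrib)

lemma cint_diff:
  assumes "0 < r" "continuous_on (sphere 0 r) f" "continuous_on (sphere 0 r) g"
  shows "cint r (\<lambda>w. f w - g w) = cint r f - cint r g"
  unfolding cint_def using assms
  by (simp add: contour_integral_diff circle_integrable diff_divide_distrib)

lemma cint_cmult:
  assumes "0 < r" "continuous_on (sphere 0 r) f"
  shows "cint r (\<lambda>w. c * f w) = c * cint r f"
  unfolding cint_def using assms
  by (simp add: contour_integral_lmul circle_integrable)

lemma cint_sum:
  assumes "0 < r" "\<And>i. i \<in> I \<Longrightarrow> continuous_on (sphere 0 r) (f i)" "finite I"
  shows "cint r (\<lambda>w. \<Sum>i\<in>I. f i w) = (\<Sum>i\<in>I. cint r (f i))"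
  unfolding cint_def using assms
  by (simp add: contour_integral_sum circle_integrable sum_divide_distrib)

lemma norm_cint_le:
  assumes "0 < r" "continuous_on (sphere 0 r) f" "\<And>w. norm w = r \<Longrightarrow> norm (f w) \<le> B"
  shows "norm (cint r f) \<le> r * B"
proof -
  have "norm (f (of_real r)) \<le> B" using assms by auto
  then have B: "0 \<le> B" by (rule order_trans[OF norm_ge_zero])
  have "norm (contour_integral (circlepath 0 r) f) \<le> B * (2 * pi * r)"
    by (rule has_contour_integral_bound_circlepath[OF has_contour_integral_integral])
       (use assms B in \<open>auto simp: circle_integrable\<close>)
  then show ?thesis
    unfolding cint_def by (simp add: norm_divide norm_mult field_simps)
qed

lemma cint_eq:
  assumes "f holomorphic_on S" "open S" "0 < r" "r \<le> R" "\<And>w. r \<le> norm w \<Longrightarrow> norm w \<le> R \<Longrightarrow> w \<in> S"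
  shows "cint r f = cint R f"
proof -
  have "homotopic_loops S (circlepath 0 r) (circlepath 0 R)"
  proof (rule homotopic_loops_linear)
    fix t :: real
    let ?e = "exp (2 * of_real pi * \<i> * of_real t)"
    have e: "norm ?e = 1" by (simp add: norm_exp_eq_Re)
    show "closed_segment (circlepath 0 r t) (circlepath 0 R t) \<subseteq> S"
    proof
      fix x assume "x \<in> closed_segment (circlepath 0 r t) (circlepath 0 R t)"
      then obtain u where u: "0 \<le> u" "u \<le> 1"
        "x = (1 - u) *\<^sub>R circlepath 0 r t + u *\<^sub>R circlepath 0 R t"
        by (auto simp: in_segment)
      have "x = of_real ((1 - u) * r + u * R) * ?e"
        unfolding u(3) by (simp add: circlepath scaleR_conv_of_real algebra_simps)
      then have n: "norm x = \<bar>(1 - u) * r + u * R\<bar>" by (simp only: norm_mult e norm_of_real mult_1_right)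
      have "(1 - u) * r + u * R = r + u * (R - r)" by (simp add: algebra_simps)
      moreover have "0 \<le> u * (R - r)" "u * (R - r) \<le> 1 * (R - r)"
        using u assms(4) by (intro mult_nonneg_nonneg mult_right_mono; simp)+
      ultimately show "x \<in> S" using n assms(3) by (intro assms(5)) auto
    qed
  qed auto
  then have "contour_integral (circlepath 0 r) f = contour_integral (circlepath 0 R) f"
    by (rule Cauchy_theorem_homotopic_loops[OF _ assms(2,1)]) auto
  then show ?thesis by (simp add: cint_def)
qed

lemma cint_inverse: "0 < r \<Longrightarrow> cint r (\<lambda>w. 1 / w) = 1"
  using Cauchy_integral_circlepath_simple[of "\<lambda>_. 1" 0 r 0]
  by (simp add: cint_def contour_integral_unique)

text \<open>The integral is independent of the radius. On a circle of radius R so large that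
  \<open>w * f w\<close> is within e of l, f differs from l/w by at most e/R, and the length of the
  circle cancels the R.\<close>

lemma cint_limit_at_infinity:
  assumes hol: "f holomorphic_on {w. s < norm w}" and r: "0 < r" "s < r"
    and lim: "((\<lambda>w. w * f w) \<longlongrightarrow> l) at_infinity"
  shows "cint r f = l"
proof -
  have op: "open {w::complex. s < norm w}" by (intro open_Collect_less continuous_intros)
  have cont: "continuous_on (sphere 0 R) f" if "R \<ge> r" for R
    using hol by (rule continuous_on_subset[OF holomorphic_on_imp_continuous_on]) (use r that in auto)
  have "norm (cint r f - l) \<le> e" if "e > 0" for e
  proof -
    obtain b where b: "\<And>w. b \<le> norm w \<Longrightarrow> dist (w * f w) l < e"
      using lim \<open>e > 0\<close> by (auto simp: tendsto_iff eventually_at_infinity)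
    define R where "R = max r b"
    have R: "R \<ge> r" "R > 0" "R \<ge> b" using r by (auto simp: R_def)
    have "cint r f - l = cint R f - cint R (\<lambda>w. l * (1 / w))"
      using cint_eq[OF hol op r(1) R(1)] r R cint_inverse[of R]
      by (subst cint_cmult) (auto intro!: continuous_intros)
    also have "\<dots> = cint R (\<lambda>w. f w - l * (1 / w))"
      using R by (intro cint_diff[symmetric] cont) (auto intro!: continuous_intros)
    also have "norm \<dots> \<le> R * (e / R)"
    proof (rule norm_cint_le[OF R(2)])
      show "continuous_on (sphere 0 R) (\<lambda>w. f w - l * (1 / w))"
        using R by (intro continuous_intros cont) auto
      fix w :: complex assume w: "norm w = R"
      then have "f w - l * (1 / w) = (w * f w - l) / w" using R by (auto simp: field_simps)
      then show "norm (f w - l * (1 / w)) \<le> e / R"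
        using b[of w] w R by (simp add: norm_divide dist_norm divide_right_mono less_imp_le)
    qed
    finally show ?thesis using R by simp
  qed
  then have "norm (cint r f - l) \<le> 0" by (metis dense_ge linorder_not_le)
  then show ?thesis by simp
qed

text \<open>Remainder of the truncated geometric series of a Cauchy kernel; a and b exchange roles
  according to which of the two points is nearer to the origin.\<close>

lemma geometric_kernel:
  fixes a b :: complex
  assumes "b \<noteq> 0" "a \<noteq> b"
  shows "1 / (b - a) - (\<Sum>k<K. a ^ k / b ^ Suc k) = (a / b) ^ K / (b - a)"
proof -
  have "(\<Sum>k<K. a ^ k / b ^ Suc k) = (\<Sum>k<K. (a / b) ^ k) / b"
    by (simp add: sum_divide_distrib power_divide field_simps)
  also have "(\<Sum>k<K. (a / b) ^ k) = (1 - (a / b) ^ K) / (1 - a / b)"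
    using assms by (subst sum_gp_strict) auto
  also have "(1 - (a / b) ^ K) / (1 - a / b) / b = (1 - (a / b) ^ K) / (b - a)"
    using assms by (simp add: field_simps del: power_divide)
  finally show ?thesis by (simp add: diff_divide_distrib)
qed

text \<open>The truncated geometric expansions of 1/(w - w0) are Laurent polynomials, so f is
  orthogonal to them, and the remainder decays like q^K uniformly on the circle.\<close>

lemma cint_moments_kernel_zero:
  assumes r: "0 < r" and f: "continuous_on (sphere 0 r) f" and w: "norm w0 \<noteq> r" "w0 \<noteq> 0"
    and mom: "\<And>i::int. cint r (\<lambda>w. w powi i * f w) = 0"
  shows "cint r (\<lambda>w. f w / (w - w0)) = 0"
proof -
  obtain M where M: "\<And>w. norm w = r \<Longrightarrow> norm (f w) \<le> M"
    using compact_imp_bounded[OF compact_continuous_image[OF f]]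
    by (fastforce simp: bounded_iff)
  have nw: "w \<noteq> w0" "w \<noteq> 0" if "norm w = r" for w using that w r by auto
  have cf: "continuous_on (sphere 0 r) (\<lambda>w. f w / (w - w0))"
    by (intro continuous_intros f) (use nw in auto)
  define d where "d = \<bar>r - norm w0\<bar>"
  have d: "d > 0" using w by (simp add: d_def)
  have dl: "d \<le> norm (w - w0)" if "norm w = r" for w
    using norm_triangle_ineq3[of w w0] that by (simp add: d_def)
  have M0: "0 \<le> M" using M[of "of_real r"] r by (simp add: order_trans[OF norm_ge_zero])
  \<comment> \<open>The ratio of the smaller to the larger of |w0| and r, which covers w0 inside and
    outside the circle at once.\<close>
  define q where "q = min (norm w0) r / max (norm w0) r"
  have q: "0 \<le> q" "q < 1" using r w by (auto simp: q_def field_simps min_def max_def)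
  have "norm (cint r (\<lambda>w. f w / (w - w0))) \<le> r * (M * q ^ K / d)" for K
  proof -
    define S where "S w = (if norm w0 < r then (\<Sum>k<K. w0 ^ k * w powi (- int (Suc k)))
                      else - (\<Sum>k<K. inverse (w0 ^ Suc k) * w powi (int k)))" for w
    have S0: "cint r (\<lambda>w. f w * S w) = 0"
    proof (cases "norm w0 < r")
      case True
      have "cint r (\<lambda>w. f w * S w) = cint r (\<lambda>w. \<Sum>k<K. w0 ^ k * (w powi (- int (Suc k)) * f w))"
        by (simp add: S_def True sum_distrib_left ac_simps del: power_int_minus)
      also have "\<dots> = (\<Sum>k<K. w0 ^ k * cint r (\<lambda>w. (w powi (- int (Suc k)) * f w)))"
        using r nw by (subst cint_sum; (subst cint_cmult)?) (auto intro!: continuous_intros f)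
      finally show ?thesis by (simp only: mom) simp
    next
      case False
      have "cint r (\<lambda>w. f w * S w) = cint r (\<lambda>w. \<Sum>k<K. - inverse (w0 ^ Suc k) * (w powi (int k) * f w))"
        by (simp add: S_def False sum_distrib_left sum_negf ac_simps del: power_int_of_nat)
      also have "\<dots> = (\<Sum>k<K. - inverse (w0 ^ Suc k) * cint r (\<lambda>w. (w powi (int k) * f w)))"
        using r nw by (subst cint_sum; (subst cint_cmult)?) (auto intro!: continuous_intros f)
      finally show ?thesis by (simp only: mom) simp
    qed
    have cS: "continuous_on (sphere 0 r) S"
    proof (cases "norm w0 < r")
      case True
      have "continuous_on (sphere 0 r) (\<lambda>w. \<Sum>k<K. w0 ^ k * w powi (- int (Suc k)))"
        using r by (intro continuous_intros) auto
      then show ?thesis using True by (simp add: S_def[abs_def])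
    next
      case False
      have "continuous_on (sphere 0 r) (\<lambda>w. - (\<Sum>k<K. inverse (w0 ^ Suc k) * w powi (int k)))"
        using r w by (intro continuous_intros) auto
      then show ?thesis using False by (simp add: S_def[abs_def])
    qed
    have bd: "norm (1 / (w - w0) - S w) \<le> q ^ K / d" if nr: "norm w = r" for w
    proof (cases "norm w0 < r")
      case True
      have "S w = (\<Sum>k<K. w0 ^ k / w ^ Suc k)"
        unfolding S_def using True
        by (simp only: power_int_minus power_int_of_nat divide_inverse if_True)
      then have "1 / (w - w0) - S w = (w0 / w) ^ K / (w - w0)"
        using geometric_kernel[of w w0 K] nw[OF nr] by auto
      also have "norm \<dots> = q ^ K / norm (w - w0)"
        using True nr by (simp add: norm_divide norm_power q_def min_def max_def)
      also have "\<dots> \<le> q ^ K / d" using d dl[OF nr] q by (intro divide_left_mono) (auto intro!: mult_pos_pos)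
      finally show ?thesis .
    next
      case False
      have neg: "1 / (w0 - w) = - (1 / (w - w0))" by (metis minus_diff_eq minus_divide_right)
      have "- S w = (\<Sum>k<K. w ^ k / w0 ^ Suc k)"
        unfolding S_def using False by (simp add: divide_inverse mult.commute)
      then have "1 / (w0 - w) - (- S w) = (w / w0) ^ K / (w0 - w)"
        using geometric_kernel[of w0 w K] nw(1)[OF nr] w(2) by (simp only: simp_thms)
      moreover have "- (1 / (w - w0) - S w) = - (1 / (w - w0)) - (- S w)" by (rule minus_diff_minus[symmetric])
      ultimately have "- (1 / (w - w0) - S w) = (w / w0) ^ K / (w0 - w)" by (simp only: neg)
      then have "norm (1 / (w - w0) - S w) = norm ((w / w0) ^ K / (w0 - w))" by (metis norm_minus_cancel)
      also have "norm \<dots> = q ^ K / norm (w - w0)"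
        using False nr r by (simp add: norm_divide norm_power q_def min_def max_def norm_minus_commute
            zero_le_divide_iff less_imp_le[OF r])
      also have "\<dots> \<le> q ^ K / d" using d dl[OF nr] q by (intro divide_left_mono) (auto intro!: mult_pos_pos)
      finally show ?thesis by simp
    qed
    have "cint r (\<lambda>w. f w / (w - w0)) = cint r (\<lambda>w. f w / (w - w0) - f w * S w)"
      using r f cf cS by (subst cint_diff) (auto intro!: continuous_intros simp: S0)
    also have "norm \<dots> \<le> r * (M * q ^ K / d)"
    proof (rule norm_cint_le[OF r])
      show "continuous_on (sphere 0 r) (\<lambda>w. f w / (w - w0) - f w * S w)"
        by (intro continuous_intros cf f cS)
      fix w :: complex assume nr: "norm w = r"
      have "f w / (w - w0) - f w * S w = f w * (1 / (w - w0) - S w)" by (simp add: algebra_simps)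
      also have "norm \<dots> \<le> M * (q ^ K / d)"
        unfolding norm_mult using M[OF nr] bd[OF nr] M0 by (intro mult_mono) auto
      finally show "norm (f w / (w - w0) - f w * S w) \<le> M * q ^ K / d" by simp
    qed
    finally show ?thesis .
  qed
  moreover have "(\<lambda>K. r * (M * q ^ K / d)) \<longlonglongrightarrow> r * (M * 0 / d)"
    using q by (intro tendsto_intros LIMSEQ_power_zero) (use d in auto)
  ultimately have "norm (cint r (\<lambda>w. f w / (w - w0))) \<le> r * (M * 0 / d)"
    by (intro LIMSEQ_le_const) auto
  then show ?thesis by simp
qed

lemma cint_Cauchy:
  assumes "0 < r" "norm w0 \<noteq> r"
  shows "cint r (\<lambda>w. 1 / (w - w0)) = (if norm w0 < r then 1 else 0)"
proof (cases "norm w0 < r")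
  case True
  then show ?thesis using Cauchy_integral_circlepath_simple[of "\<lambda>_. 1" 0 r w0]
    by (simp add: cint_def contour_integral_unique)
next
  case False
  have "((\<lambda>w. 1 / (w - w0)) has_contour_integral 0) (circlepath 0 r)"
  proof (rule Cauchy_theorem_convex_simple)
    show "(\<lambda>w. 1 / (w - w0)) holomorphic_on cball 0 r"
      using False assms by (intro holomorphic_intros) auto
  qed (use assms in auto)
  then show ?thesis using False by (simp add: cint_def contour_integral_unique)
qed

text \<open>The difference quotient k of f at w0 is holomorphic, so it has the same integral on
  circles on either side of w0. The Cauchy integral of f at w0 vanishes on both circles, and the
  subtracted multiple f(w0) of 1/(w - w0) contributes only on the outer one.\<close>

lemma laurent_unique:
  assumes hol: "f holomorphic_on {w. s < norm w}" and s: "0 \<le> s"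
    and mom: "\<And>r. \<And>i::int. s < r \<Longrightarrow> cint r (\<lambda>w. w powi i * f w) = 0"
    and w0: "s < norm w0"
  shows "f w0 = 0"
proof -
  define U where "U = {w::complex. s < norm w}"
  have op: "open U" unfolding U_def by (intro open_Collect_less continuous_intros)
  define k where "k w = (if w = w0 then deriv f w0 else (f w - f w0) / (w - w0))" for w
  have k: "k holomorphic_on U"
    unfolding k_def using hol op w0 by (intro pole_lemma) (auto simp: U_def interior_open)
  define r where "r = (s + norm w0) / 2"
  define R where "R = norm w0 + 1"
  have r: "s < r" "r < norm w0" "0 < r" and R: "norm w0 < R" "0 < R" "s < R"
    using s w0 by (auto simp: r_def R_def)
  have cf: "continuous_on (sphere 0 t) f" if "s < t" for t
    using hol by (rule continuous_on_subset[OF holomorphic_on_imp_continuous_on]) (use that in auto)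
  have *: "cint t k = cint t (\<lambda>w. f w / (w - w0)) - f w0 * cint t (\<lambda>w. 1 / (w - w0))"
    if "s < t" "t \<noteq> norm w0" "0 < t" for t
  proof -
    have "cint t k = cint t (\<lambda>w. f w / (w - w0) - f w0 * (1 / (w - w0)))"
      using that by (intro cint_cong) (auto simp: k_def diff_divide_distrib)
    also have "\<dots> = cint t (\<lambda>w. f w / (w - w0)) - f w0 * cint t (\<lambda>w. 1 / (w - w0))"
      using that by (subst cint_diff; (subst cint_cmult)?) (auto intro!: continuous_intros cf)
    finally show ?thesis .
  qed
  have z: "cint t (\<lambda>w. f w / (w - w0)) = 0" if "s < t" "t \<noteq> norm w0" "0 < t" for t
    using that mom w0 s by (intro cint_moments_kernel_zero cf) auto
  have "cint r k = cint R k"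
    by (rule cint_eq[OF k op]) (use r R s in \<open>auto simp: U_def\<close>)
  moreover have "cint r k = 0" using *[of r] z[of r] r by (simp add: cint_Cauchy)
  moreover have "cint R k = - f w0" using *[of R] z[of R] R by (simp add: cint_Cauchy)
  ultimately show ?thesis by simp
qed

section \<open>The exterior conformal map\<close>

lemma connected_exterior: "connected {w::complex. s < norm w}"
proof -
  have "connected (- cball (0::complex) s)"
    by (rule connected_complement_bounded_convex) auto
  also have "- cball (0::complex) s = {w. s < norm w}" by auto
  finally show ?thesis .
qed

lemma open_exterior: "open {w::complex. s < norm w}"
  by (intro open_Collect_less continuous_intros)

lemma eventually_norm_ge:
  fixes f :: "'a \<Rightarrow> complex"
  assumes "filterlim f at_infinity F"
  shows "eventually (\<lambda>x. B \<le> norm (f x)) F"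
  using filterlim_at_infinity_imp_norm_at_top[OF assms] by (simp add: filterlim_at_top)

locale exterior =
  fixes E :: "complex set" and Phi :: "complex \<Rightarrow> complex"
  assumes compact_E: "compact E" and nonempty_E: "E \<noteq> {}" and ext: "exterior_map E Phi"
begin

definition Psi :: "complex \<Rightarrow> complex" where "Psi = inv_into (- E) Phi"

text \<open>The open and the closed canonical domain of index \<open>r\<close>.\<close>

definition Dop :: "real \<Rightarrow> complex set" where "Dop r = E \<union> {z. z \<notin> E \<and> norm (Phi z) < r}"

definition Dcl :: "real \<Rightarrow> complex set" where "Dcl r = E \<union> {z. z \<notin> E \<and> norm (Phi z) \<le> r}"

lemma closed_E: "closed E" and open_Compl_E: "open (- E)"
  using compact_E compact_imp_closed by auto

lemma Phi_hol: "Phi holomorphic_on (- E)"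
  using ext by (simp add: exterior_map_def)

lemma Phi_inj: "inj_on Phi (- E)" and Phi_image: "Phi ` (- E) = {w. 1 < norm w}"
  using ext by (auto simp: exterior_map_def bij_betw_def)

lemma Psi_notin: "1 < norm w \<Longrightarrow> Psi w \<notin> E"
  unfolding Psi_def using inv_into_into[of w Phi "- E"] Phi_image by auto

lemma Phi_Psi: "1 < norm w \<Longrightarrow> Phi (Psi w) = w"
  unfolding Psi_def using Phi_image by (intro f_inv_into_f) auto

lemma Psi_Phi: "z \<notin> E \<Longrightarrow> Psi (Phi z) = z"
  unfolding Psi_def using Phi_inj by (intro inv_into_f_f) auto

lemma norm_Phi: "z \<notin> E \<Longrightarrow> 1 < norm (Phi z)"
  using Phi_image by auto

lemma Psi_hol: "Psi holomorphic_on {w. 1 < norm w}"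
proof -
  obtain g where g: "g holomorphic_on (Phi ` (- E))" "\<And>z. z \<in> - E \<Longrightarrow> g (Phi z) = z"
    using holomorphic_has_inverse[OF Phi_hol open_Compl_E Phi_inj] by metis
  have "Psi w = g w" if "1 < norm w" for w
    using g(2)[of "Psi w"] Phi_Psi[OF that] Psi_notin[OF that] by simp
  with g(1) show ?thesis unfolding Phi_image
    by (metis (mono_tags, lifting) holomorphic_transform mem_Collect_eq)
qed

lemma Psi_inj: "inj_on Psi {w. 1 < norm w}"
  by (rule inj_on_inverseI[of _ Phi]) (simp add: Phi_Psi)

lemma Psi_deriv_nz: "1 < norm w \<Longrightarrow> deriv Psi w \<noteq> 0"
  by (rule holomorphic_injective_imp_regular[OF Psi_hol open_exterior Psi_inj]) simp

lemma Psi_deriv_hol: "deriv Psi holomorphic_on {w. 1 < norm w}"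
  by (rule holomorphic_deriv[OF Psi_hol open_exterior])

lemma Psi_comp_hol:
  assumes "H holomorphic_on S" "A \<subseteq> {w. 1 < norm w}" "Psi ` A \<subseteq> S"
  shows "(\<lambda>w. H (Psi w)) holomorphic_on A"
  using holomorphic_on_compose_gen[OF holomorphic_on_subset[OF Psi_hol assms(2)] assms(1,3)]
  by (simp add: o_def)

lemma Psi_cont: "continuous_on {w. 1 < norm w} Psi"
  by (rule holomorphic_on_imp_continuous_on[OF Psi_hol])

text \<open>The limit of Phi at infinity does not by itself exclude that Phi is large near E. The
  set of large w is connected and misses the image of a circle around E; it is covered by the
  disjoint open images of the outer and the inner region, meets the first, and so avoids the
  second.\<close>

lemma Psi_at_infinity: "filterlim Psi at_infinity at_infinity"
proof -
  have "\<exists>M. \<forall>w. M \<le> norm w \<longrightarrow> R \<le> norm (Psi w)" for R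
  proof -
    obtain R0 where R0: "E \<subseteq> ball 0 R0"
      using compact_E compact_imp_bounded bounded_subset_ballD by metis
    define R' where "R' = max R (max R0 1)"
    have ER: "E \<subseteq> ball 0 R'" using R0 by (auto simp: R'_def)
    have co: "compact (Phi ` sphere 0 R')"
      using ER by (intro compact_continuous_image
          continuous_on_subset[OF holomorphic_on_imp_continuous_on[OF Phi_hol]]) auto
    obtain M where M: "Phi ` sphere 0 R' \<subseteq> ball 0 M"
      using compact_imp_bounded[OF co] bounded_subset_ballD by metis
    define M' where "M' = max M 1"
    define T1 where "T1 = Phi ` (- cball 0 R')"
    define T2 where "T2 = Phi ` (ball 0 R' - E)"
    have sub: "- cball 0 R' \<subseteq> - E" "ball 0 R' - E \<subseteq> - E" using ER by auto
    have o1: "open T1" unfolding T1_def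
      by (rule open_mapping_thm3[OF holomorphic_on_subset[OF Phi_hol sub(1)] _
            inj_on_subset[OF Phi_inj sub(1)]]) auto
    have o2: "open T2" unfolding T2_def
      by (rule open_mapping_thm3[OF holomorphic_on_subset[OF Phi_hol sub(2)] _
            inj_on_subset[OF Phi_inj sub(2)]]) (auto intro: closed_E)
    have disj: "T1 \<inter> T2 \<inter> {w. M' < norm w} = {}"
    proof -
      have False if "x \<in> - cball 0 R'" "y \<in> ball 0 R' - E" "Phi x = Phi y" for x y
        using inj_onD[OF Phi_inj that(3)] that(1,2) ER by fastforce
      moreover have "\<exists>x y. x \<in> - cball 0 R' \<and> y \<in> ball 0 R' - E \<and> Phi x = Phi y"
        if "w \<in> T1" "w \<in> T2" for w
        using that unfolding T1_def T2_def image_iff by metis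
      ultimately have "w \<notin> T2" if "w \<in> T1" for w using that by meson
      then show ?thesis by blast
    qed
    have cover: "{w. M' < norm w} \<subseteq> T1 \<union> T2"
    proof
      fix w :: complex assume "w \<in> {w. M' < norm w}"
      then have w: "1 < norm w" "M < norm w" by (auto simp: M'_def)
      have "norm (Psi w) \<noteq> R'"
      proof
        assume "norm (Psi w) = R'"
        then have "Phi (Psi w) \<in> Phi ` sphere 0 R'" by (intro imageI) simp
        then have "Phi (Psi w) \<in> ball 0 M" using M by blast
        then show False using w Phi_Psi[OF w(1)] by simp
      qed
      then have "Psi w \<in> - cball 0 R' \<or> Psi w \<in> ball 0 R' - E" using Psi_notin[OF w(1)] by auto
      then show "w \<in> T1 \<union> T2" unfolding T1_def T2_def using Phi_Psi[OF w(1)]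
        by (metis UnI1 UnI2 imageI)
    qed
    have "T1 \<inter> {w. M' < norm w} \<noteq> {}"
    proof -
      have "filterlim Phi at_infinity at_infinity" using ext by (simp add: exterior_map_def)
      then have "eventually (\<lambda>z. M' + 1 \<le> norm (Phi z)) at_infinity"
        by (rule eventually_norm_ge)
      then obtain b where b: "\<And>z. b \<le> norm z \<Longrightarrow> M' + 1 \<le> norm (Phi z)"
        by (auto simp: eventually_at_infinity)
      define z :: complex where "z = of_real (max b (R' + 1))"
      have "b \<le> norm z" "z \<in> - cball 0 R'" by (auto simp: z_def)
      then show ?thesis using b[of z] by (force simp: T1_def)
    qed
    then have emp: "T2 \<inter> {w. M' < norm w} = {}"
      using connectedD[OF connected_exterior o1 o2 disj cover] by blast
    have "R \<le> norm (Psi w)" if "M' + 1 \<le> norm w" for w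
    proof (rule ccontr)
      assume n: "\<not> ?thesis"
      have w: "1 < norm w" "M' < norm w" using that by (auto simp: M'_def)
      have "Psi w \<in> ball 0 R' - E" using n Psi_notin[OF w(1)] by (auto simp: R'_def)
      then have "w \<in> T2" unfolding T2_def using Phi_Psi[OF w(1)] by (metis imageI)
      with emp w show False by auto
    qed
    then show ?thesis by blast
  qed
  then show ?thesis
    by (subst filterlim_at_infinity[of 0]) (auto simp: eventually_at_infinity)
qed

lemma Psi_asymp:
  obtains d where "d \<noteq> 0" "((\<lambda>w. Psi w / w) \<longlongrightarrow> d) at_infinity" "(deriv Psi \<longlongrightarrow> d) at_infinity"
proof -
  obtain c :: real where c: "c > 0" "((\<lambda>z. Phi z / z) \<longlongrightarrow> of_real c) at_infinity"
    using ext by (auto simp: exterior_map_def)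
  have ev1: "eventually (\<lambda>w::complex. 1 < norm w) at_infinity"
    unfolding eventually_at_infinity by (intro exI[of _ 2]) auto
  have "((\<lambda>w. Phi (Psi w) / Psi w) \<longlongrightarrow> of_real c) at_infinity"
    by (rule filterlim_compose[OF c(2) Psi_at_infinity])
  then have "((\<lambda>w. inverse (Phi (Psi w) / Psi w)) \<longlongrightarrow> inverse (of_real c)) at_infinity"
    using c by (intro tendsto_inverse) auto
  then have lim: "((\<lambda>w. Psi w / w) \<longlongrightarrow> inverse (of_real c)) at_infinity"
    by (rule Lim_transform_eventually) (use ev1 in eventually_elim, simp add: Phi_Psi)
  define d :: complex where "d = inverse (of_real c)"
  have "(deriv Psi \<longlongrightarrow> d) at_infinity"
  proof (rule tendstoI)
    fix e :: real assume e: "e > 0"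
    have "eventually (\<lambda>w. dist (Psi w / w) d < e / 4) at_infinity"
      using lim e unfolding d_def by (intro tendstoD) auto
    then obtain b where b: "\<And>w. b \<le> norm w \<Longrightarrow> dist (Psi w / w) d < e / 4"
      by (auto simp: eventually_at_infinity)
    have "dist (deriv Psi w) d < e" if w: "2 * max b 2 \<le> norm w" for w
    proof -
      \<comment> \<open>On the disc of this radius about w the modulus stays between \<rho> and
        3\<rho>, so the Cauchy estimate for \<open>Psi x - d * x\<close> gives 3e/4 for its
        derivative.\<close>
      define \<rho> where "\<rho> = norm w / 2"
      have \<rho>: "\<rho> \<ge> b" "\<rho> \<ge> 2" using w by (auto simp: \<rho>_def)
      have far: "\<rho> \<le> norm x" if "x \<in> cball w \<rho>" for x
        using that norm_triangle_ineq3[of w x] by (auto simp: \<rho>_def dist_norm)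
      then have sub: "cball w \<rho> \<subseteq> {w. 1 < norm w}" using \<rho> by fastforce
      let ?f = "\<lambda>x. Psi x - d * x"
      have hol: "?f holomorphic_on cball w \<rho>"
        by (intro holomorphic_intros holomorphic_on_subset[OF Psi_hol] sub)
      have "norm ((deriv ^^ 1) ?f w) \<le> fact 1 * (e / 4 * (3 * \<rho>)) / \<rho> ^ 1"
      proof (rule Cauchy_inequality)
        show "?f holomorphic_on ball w \<rho>" using hol by (rule holomorphic_on_subset) auto
        show "continuous_on (cball w \<rho>) ?f" using hol by (rule holomorphic_on_imp_continuous_on)
        show "0 < \<rho>" using \<rho> by simp
        fix x assume x: "norm (w - x) = \<rho>"
        then have x': "\<rho> \<le> norm x" using far[of x] by (simp add: dist_norm)
        then have x0: "x \<noteq> 0" using \<rho> by auto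
        have "norm x \<le> 3 * \<rho>" using norm_triangle_ineq4[of w "w - x"] x by (simp add: \<rho>_def)
        have "?f x = (Psi x / x - d) * x" using x0 by (simp add: field_simps)
        also have "norm \<dots> \<le> e / 4 * (3 * \<rho>)"
          unfolding norm_mult using b[of x] x' \<rho> \<open>norm x \<le> 3 * \<rho>\<close> e
          by (intro mult_mono) (auto simp: dist_norm)
        finally show "norm (?f x) \<le> e / 4 * (3 * \<rho>)" .
      qed
      also have "\<dots> < e" using e \<rho> by simp
      also have "(deriv ^^ 1) ?f w = deriv Psi w - d"
      proof -
        have "Psi field_differentiable at w"
          using Psi_hol open_exterior[of 1] far[of w] \<rho> by (intro holomorphic_on_imp_differentiable_at[of _ "{w. 1 < norm w}"]) auto
        then have "(?f has_field_derivative deriv Psi w - d) (at w)"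
          by (auto intro!: derivative_eq_intros simp: field_differentiable_derivI)
        then show ?thesis by (simp add: DERIV_imp_deriv)
      qed
      finally show ?thesis by (simp add: dist_norm)
    qed
    then show "eventually (\<lambda>w. dist (deriv Psi w) d < e) at_infinity"
      unfolding eventually_at_infinity by blast
  qed
  with that[of d] lim c show ?thesis by (simp add: d_def)
qed

text \<open>\<open>Psi\<close> tends to infinity, so near a given point only a compact part of the
  exterior contributes to the image.\<close>

lemma closed_image_exterior:
  assumes "1 < r" shows "closed (Psi ` {w. r \<le> norm w})"
proof -
  have "x \<in> Psi ` {w. r \<le> norm w}" if x: "x \<in> closure (Psi ` {w. r \<le> norm w})" for x
  proof -
    have "eventually (\<lambda>w. norm x + 1 \<le> norm (Psi w)) at_infinity"
      by (rule eventually_norm_ge[OF Psi_at_infinity])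
    then obtain M where M: "\<And>w. M \<le> norm w \<Longrightarrow> norm x + 1 \<le> norm (Psi w)"
      by (auto simp: eventually_at_infinity)
    define C where "C = Psi ` (cball 0 M \<inter> {w. r \<le> norm w})"
    have "compact (cball 0 M \<inter> {w::complex. r \<le> norm w})"
      by (intro compact_Int_closed closed_Collect_le continuous_intros) auto
    then have C: "compact C"
      unfolding C_def using assms by (intro compact_continuous_image continuous_on_subset[OF Psi_cont]) auto
    have "ball x 1 \<inter> Psi ` {w. r \<le> norm w} \<subseteq> C"
    proof
      fix y assume "y \<in> ball x 1 \<inter> Psi ` {w. r \<le> norm w}"
      then obtain w where w: "y = Psi w" "r \<le> norm w" "dist x y < 1" by auto
      have "norm y < norm x + 1" using w(3) norm_triangle_ineq2[of y x] by (simp add: dist_norm norm_minus_commute)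
      then have "norm w \<le> M" using M[of w] w(1) by fastforce
      then show "y \<in> C" using w by (auto simp: C_def)
    qed
    moreover have "x \<in> closure (ball x 1 \<inter> Psi ` {w. r \<le> norm w})"
      using open_Int_closure_subset[of "ball x 1" "Psi ` {w. r \<le> norm w}"] x by auto
    ultimately have "x \<in> closure C" using closure_mono by blast
    also have "closure C = C" using C by (simp add: compact_imp_closed)
    finally show ?thesis by (auto simp: C_def)
  qed
  then show ?thesis by (metis closure_subset closure_closed subsetI subset_antisym closed_closure)
qed

section \<open>Canonical domains and level curves\<close>

lemma Dop_eq: "1 < r \<Longrightarrow> Dop r = - (Psi ` {w. r \<le> norm w})"
proof -
  assume r: "1 < r"
  have "z \<in> Psi ` {w. r \<le> norm w} \<longleftrightarrow> z \<notin> E \<and> r \<le> norm (Phi z)" for z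
    using r Psi_Phi[of z] Psi_notin Phi_Psi by (force simp: image_iff)
  then show ?thesis unfolding Dop_def by (intro set_eqI) (simp add: not_le del: image_iff; blast)
qed

lemma Dcl_eq: "1 < r \<Longrightarrow> Dcl r = - (Psi ` {w. r < norm w})"
proof -
  assume r: "1 < r"
  have "z \<in> Psi ` {w. r < norm w} \<longleftrightarrow> z \<notin> E \<and> r < norm (Phi z)" for z
    using r Psi_Phi[of z] Psi_notin Phi_Psi by (force simp: image_iff)
  then show ?thesis unfolding Dcl_def by (intro set_eqI) (simp add: not_less del: image_iff; blast)
qed

lemma open_Dop: "1 < r \<Longrightarrow> open (Dop r)"
  using closed_image_exterior[of r] by (simp add: Dop_eq open_closed)

lemma Dcl_bounded: "bounded (Dcl r)"
proof -
  have "filterlim Phi at_infinity at_infinity" using ext by (simp add: exterior_map_def)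
  then have "eventually (\<lambda>z. r + 1 \<le> norm (Phi z)) at_infinity"
    by (rule eventually_norm_ge)
  then obtain b where b: "\<And>z. b \<le> norm z \<Longrightarrow> r + 1 \<le> norm (Phi z)"
    by (auto simp: eventually_at_infinity)
  have "Dcl r \<subseteq> E \<union> ball 0 b" unfolding Dcl_def using b by (force simp: not_le[symmetric])
  then show ?thesis
    by (meson bounded_Un bounded_ball bounded_subset compact_E compact_imp_bounded)
qed

lemma compact_Dcl: "1 < r \<Longrightarrow> compact (Dcl r)"
proof -
  assume r: "1 < r"
  have sub: "{w::complex. r < norm w} \<subseteq> {w. 1 < norm w}" using r by auto
  have "open (Psi ` {w. r < norm w})"
    by (rule open_mapping_thm3[OF holomorphic_on_subset[OF Psi_hol sub] open_exterior
          inj_on_subset[OF Psi_inj sub]])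
  then have "closed (Dcl r)" by (simp add: Dcl_eq r closed_Compl)
  then show ?thesis using Dcl_bounded compact_eq_bounded_closed by blast
qed

lemma Dcl_Dop: "r < r' \<Longrightarrow> Dcl r \<subseteq> Dop r'" "Dop r \<subseteq> Dcl r" "E \<subseteq> Dop r" "r \<le> r' \<Longrightarrow> Dcl r \<subseteq> Dcl r'"
   "r \<le> r' \<Longrightarrow> Dop r \<subseteq> Dop r'"
  by (auto simp: Dcl_def Dop_def)

lemma Psi_in_Dcl: "1 < norm w \<Longrightarrow> Psi w \<in> Dcl r \<longleftrightarrow> norm w \<le> r"
  and Psi_in_Dop: "1 < norm w \<Longrightarrow> Psi w \<in> Dop r \<longleftrightarrow> norm w < r"
  by (auto simp: Dcl_def Dop_def Psi_notin Phi_Psi)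

lemma level_curve_eq: "1 < r \<Longrightarrow> level_curve E Phi r = Psi ` sphere 0 r"
proof -
  assume r: "1 < r"
  have "z \<in> Psi ` sphere 0 r \<longleftrightarrow> z \<notin> E \<and> r = norm (Phi z)" for z
    using r Psi_Phi[of z] Psi_notin Phi_Psi by (force simp: image_iff)
  then show ?thesis unfolding level_curve_def by (intro set_eqI) (simp del: image_iff; blast)
qed

lemma unbounded_image_exterior:
  assumes "1 < r" shows "\<not> bounded (Psi ` {w. r < norm w})"
proof
  assume "bounded (Psi ` {w. r < norm w})"
  then have "bounded (Psi ` {w. r < norm w} \<union> Dcl r)" using Dcl_bounded by simp
  moreover have "Psi ` {w. r < norm w} \<union> Dcl r = UNIV" using assms by (auto simp: Dcl_eq)
  ultimately show False by (simp add: not_bounded_UNIV)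
qed

lemma outside_level_curve:
  assumes "1 < r" shows "Psi ` {w. r < norm w} \<subseteq> outside (level_curve E Phi r)"
proof
  fix x assume x: "x \<in> Psi ` {w. r < norm w}"
  have "connected (Psi ` {w. r < norm w})"
    using assms by (intro connected_continuous_image continuous_on_subset[OF Psi_cont] connected_exterior) auto
  moreover have "Psi ` {w. r < norm w} \<subseteq> - level_curve E Phi r"
    using assms Phi_Psi Psi_notin by (simp add: level_curve_def image_subset_iff)
  ultimately have "Psi ` {w. r < norm w} \<subseteq> connected_component_set (- level_curve E Phi r) x"
    by (rule connected_component_maximal[OF x])
  then show "x \<in> outside (level_curve E Phi r)"
    unfolding outside using unbounded_image_exterior[OF assms] bounded_subset by blast
qed

text \<open>This identifies \<open>canonical_domain\<close>, defined by the topological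
  \<open>inside\<close>, with a sublevel set of |Phi|. The image of the exterior is connected and
  unbounded, hence outside the curve; conversely \<open>Dop r\<close> and the complement of
  \<open>Dcl r\<close> are open and cover the complement of the curve, so a component meeting
  \<open>Dop r\<close> stays bounded.\<close>

lemma inside_level_curve:
  assumes "1 < r" shows "inside (level_curve E Phi r) = Dop r"
proof
  show "inside (level_curve E Phi r) \<subseteq> Dop r"
  proof
    fix x assume x: "x \<in> inside (level_curve E Phi r)"
    have "x \<noteq> Psi w" if "r \<le> norm w" for w
    proof (cases "norm w = r")
      case True
      then have "Psi w \<in> level_curve E Phi r" using assms by (auto simp: level_curve_eq)
      then show ?thesis using x inside_no_overlap by blast
    next
      case False
      then have "Psi w \<in> Psi ` {w. r < norm w}" using that by (intro imageI) simp
      then have "Psi w \<in> outside (level_curve E Phi r)" using outside_level_curve[OF assms] by blast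
      then show ?thesis using x inside_Int_outside by blast
    qed
    then show "x \<in> Dop r" unfolding Dop_eq[OF assms] by blast
  qed
next
  show "Dop r \<subseteq> inside (level_curve E Phi r)"
  proof
    fix x assume x: "x \<in> Dop r"
    have disj: "Dop r \<inter> level_curve E Phi r = {}" by (auto simp: Dop_def level_curve_def)
    let ?C = "connected_component_set (- level_curve E Phi r) x"
    have xC: "x \<in> ?C" using x disj by (auto simp: connected_component_refl_eq)
    have o2: "open (- Dcl r)" using compact_Dcl[OF assms] compact_imp_closed by auto
    have "Dop r \<inter> ?C = {} \<or> (- Dcl r) \<inter> ?C = {}"
    proof (rule connectedD[OF connected_connected_component open_Dop[OF assms] o2])
      show "Dop r \<inter> - Dcl r \<inter> ?C = {}" using Dcl_Dop(2) by auto
      have "?C \<subseteq> - level_curve E Phi r" by (rule connected_component_subset)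
      then show "?C \<subseteq> Dop r \<union> - Dcl r" by (auto simp: Dop_def Dcl_def level_curve_def)
    qed
    then have "?C \<subseteq> Dcl r" using x xC by blast
    then have "bounded ?C" using Dcl_bounded bounded_subset by blast
    then show "x \<in> inside (level_curve E Phi r)" using x disj by (auto simp: inside_def)
  qed
qed

section \<open>Cauchy's formula on canonical domains\<close>

lemma Psi_kernel_limit: "((\<lambda>w. w * (deriv Psi w / (Psi w - \<zeta>))) \<longlongrightarrow> 1) at_infinity"
proof -
  obtain d where d: "d \<noteq> 0" "((\<lambda>w. Psi w / w) \<longlongrightarrow> d) at_infinity" "(deriv Psi \<longlongrightarrow> d) at_infinity"
    using Psi_asymp by metis
  have "((\<lambda>w. deriv Psi w / (Psi w / w - \<zeta> * inverse w)) \<longlongrightarrow> d / (d - \<zeta> * 0)) at_infinity"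
    using d by (intro tendsto_intros tendsto_inverse_0) auto
  then have "((\<lambda>w. deriv Psi w / (Psi w / w - \<zeta> * inverse w)) \<longlongrightarrow> 1) at_infinity" using d by simp
  moreover have "eventually (\<lambda>w::complex. 1 < norm w) at_infinity"
    unfolding eventually_at_infinity by (intro exI[of _ 2]) auto
  then have "eventually (\<lambda>w. deriv Psi w / (Psi w / w - \<zeta> * inverse w) = w * (deriv Psi w / (Psi w - \<zeta>))) at_infinity"
  proof eventually_elim
    case (elim w)
    then have "w \<noteq> 0" by auto
    then have "Psi w / w - \<zeta> * inverse w = (Psi w - \<zeta>) / w" by (simp add: field_simps)
    then show ?case by simp
  qed
  ultimately show ?thesis by (rule Lim_transform_eventually)
qed

text \<open>This is the winding number of the level curve about \<zeta>, read off at infinity: the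
  integrand is holomorphic beyond the preimage of \<zeta>, and w times it tends to 1.\<close>

lemma cint_kernel_inside:
  assumes r: "1 < r" and \<zeta>: "\<zeta> \<in> Dop r"
  shows "cint r (\<lambda>w. deriv Psi w / (Psi w - \<zeta>)) = 1"
proof (rule cint_limit_at_infinity[OF _ _ _ Psi_kernel_limit])
  \<comment> \<open>For \<zeta> in E the integrand has no pole at all in the exterior of the unit
    disc.\<close>
  define s where "s = (if \<zeta> \<in> E then 1 else norm (Phi \<zeta>))"
  have s: "1 \<le> s" using norm_Phi[of \<zeta>] by (auto simp: s_def)
  show "s < r" using \<zeta> r by (auto simp: s_def Dop_def)
  show "0 < r" using r by simp
  have "Psi w \<noteq> \<zeta>" if "s < norm w" for w
    using that s Psi_notin[of w] Phi_Psi[of w] by (auto simp: s_def split: if_splits)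
  then show "(\<lambda>w. deriv Psi w / (Psi w - \<zeta>)) holomorphic_on {w. s < norm w}"
    using s by (intro holomorphic_intros holomorphic_on_subset[OF Psi_hol]
        holomorphic_on_subset[OF Psi_deriv_hol]) auto
qed

text \<open>Cauchy's global formula for the curve \<open>Psi \<circ> circlepath 0 r\<close>: its
  winding number about \<zeta> is 1 by \<open>cint_kernel_inside\<close>, and points off the domain
  of H lie outside the curve.\<close>

theorem Cauchy_exterior:
  assumes hol: "H holomorphic_on S" and S: "open S" "Dcl r \<subseteq> S" and r: "1 < r" and \<zeta>: "\<zeta> \<in> Dop r"
  shows "cint r (\<lambda>w. H (Psi w) * deriv Psi w / (Psi w - \<zeta>)) = H \<zeta>"
proof -
  let ?g = "Psi \<circ> circlepath 0 r"
  have sph: "sphere 0 r \<subseteq> {w::complex. 1 < norm w}" using r by auto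
  have ana: "Psi analytic_on {w. 1 < norm w}"
    using Psi_hol open_exterior by (simp add: analytic_on_open)
  have vp: "valid_path ?g"
    by (rule valid_path_compose_analytic[OF _ ana]) (use r in auto)
  have pi: "path_image ?g = level_curve E Phi r"
    using r by (simp add: path_image_compose level_curve_eq)
  have pin: "path_image (circlepath 0 r) \<subseteq> {w. 1 < norm w}" using r by auto
  have comp: "contour_integral ?g f = contour_integral (circlepath 0 r) (\<lambda>w. deriv Psi w * f (Psi w))" for f
    by (rule contour_integral_comp_analyticW[OF ana _ pin]) simp
  have notin: "\<zeta> \<notin> path_image ?g" using \<zeta> unfolding pi by (auto simp: level_curve_def Dop_def)
  have "winding_number ?g \<zeta> = cint r (\<lambda>w. deriv Psi w / (Psi w - \<zeta>))"
    by (subst winding_number_valid_path[OF vp notin]) (simp add: comp cint_def)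
  then have wn: "winding_number ?g \<zeta> = 1" by (simp add: cint_kernel_inside[OF r \<zeta>])
  have loop: "pathfinish ?g = pathstart ?g" by (simp add: pathfinish_compose pathstart_compose)
  have "((\<lambda>w. H w / (w - \<zeta>)) has_contour_integral 2 * pi * \<i> * winding_number ?g \<zeta> * H \<zeta>) ?g"
  proof (rule Cauchy_integral_formula_global[OF S(1) hol _ vp _ loop])
    show "\<zeta> \<in> S" using S \<zeta> Dcl_Dop by blast
    have "level_curve E Phi r \<subseteq> Dcl r" by (auto simp: level_curve_def Dcl_def)
    then show "path_image ?g \<subseteq> S - {\<zeta>}" using notin S pi by auto
    fix w assume "w \<notin> S"
    then have "w \<notin> Dcl r" using S by blast
    then have "w \<in> outside (path_image ?g)"
      using outside_level_curve[OF r] Dcl_eq[OF r] pi by auto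
    then show "winding_number ?g w = 0"
      by (intro winding_number_zero_in_outside valid_path_imp_path vp loop)
  qed
  then have "contour_integral ?g (\<lambda>w. H w / (w - \<zeta>)) = 2 * pi * \<i> * H \<zeta>"
    by (simp add: wn contour_integral_unique)
  then show ?thesis by (simp add: comp cint_def mult.commute)
qed

text \<open>Cauchy's formula for H(z) (z - \<zeta>) at a point \<zeta> of E, where this function
  vanishes.\<close>

lemma Cauchy_exterior_zero:
  assumes "H holomorphic_on S" and "open S" "Dcl r \<subseteq> S" and "1 < r"
  shows "cint r (\<lambda>w. H (Psi w) * deriv Psi w) = 0"
proof -
  obtain \<zeta> where \<zeta>: "\<zeta> \<in> E" using nonempty_E by auto
  have "cint r (\<lambda>w. (\<lambda>z. H z * (z - \<zeta>)) (Psi w) * deriv Psi w / (Psi w - \<zeta>)) = H \<zeta> * (\<zeta> - \<zeta>)"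
    using \<zeta> assms Dcl_Dop(3)
    by (intro Cauchy_exterior[where S=S]) (auto intro!: holomorphic_intros)
  moreover have "cint r (\<lambda>w. (\<lambda>z. H z * (z - \<zeta>)) (Psi w) * deriv Psi w / (Psi w - \<zeta>))
     = cint r (\<lambda>w. H (Psi w) * deriv Psi w)"
  proof (rule cint_cong)
    fix w :: complex assume "norm w = r"
    then have "Psi w \<noteq> \<zeta>" using \<zeta> assms Psi_notin by auto
    then show "H (Psi w) * (Psi w - \<zeta>) * deriv Psi w / (Psi w - \<zeta>) = H (Psi w) * deriv Psi w" by simp
  qed (use assms in auto)
  ultimately show ?thesis by simp
qed

end

section \<open>Orthonormal polynomials and functions of the second kind\<close>

lemma cint_eq_integral:
  "cint r f = integral {0..1} (\<lambda>t. f (circlepath 0 r t) * circlepath 0 r t)"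
proof -
  have "contour_integral (circlepath 0 r) f =
      integral {0..1} (\<lambda>t. (2 * of_real pi * \<i>) * (f (circlepath 0 r t) * circlepath 0 r t))"
    unfolding contour_integral_integral
    by (intro integral_cong) (simp only: vector_derivative_circlepath, simp add: circlepath algebra_simps)
  then show ?thesis by (simp add: cint_def)
qed

lemma poly_hol: "poly q holomorphic_on A" for q :: "complex poly"
  unfolding holomorphic_on_def field_differentiable_def
  using poly_DERIV has_field_derivative_at_within by blast

locale orthonormal = exterior +
  fixes \<mu> :: "complex measure" and p :: "nat \<Rightarrow> complex poly"
  assumes mu: "\<mu> \<in> class_M E" and orth: "orthonormal_polys \<mu> p"
begin

definition S :: "complex set" where "S = measure_support \<mu>"

definition ip :: "(complex \<Rightarrow> complex) \<Rightarrow> nat \<Rightarrow> complex" where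
  "ip f j = inner_mu \<mu> f (poly (p j))"

text \<open>The functions of the second kind.\<close>

definition s :: "nat \<Rightarrow> complex \<Rightarrow> complex" where
  "s j z = ip (\<lambda>\<zeta>. 1 / (z - \<zeta>)) j"

text \<open>An upper bound for the L1 norms of all \<open>p j\<close>: |p| is at most 1 + |p|^2, and
  the integral of |p|^2 is 1.\<close>

definition mass :: real where "mass = measure \<mu> (space \<mu>) + 1"

lemma finite_mu: "finite_measure \<mu>" and sets_mu[measurable_cong]: "sets \<mu> = sets borel"
  and S_sub: "S \<subseteq> E"
  using mu by (auto simp: class_M_def S_def)

lemma space_mu: "space \<mu> = UNIV"
  using sets_eq_imp_space_eq[OF sets_mu] by simp

lemma mass_pos: "1 \<le> mass" by (simp add: mass_def)

lemma closed_S: "closed S"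
proof -
  have "open (- S)"
  proof (subst open_subopen, intro ballI)
    fix z assume "z \<in> - S"
    then obtain U where "open U" "z \<in> U" "\<not> emeasure \<mu> U > 0" by (auto simp: S_def measure_support_def)
    then show "\<exists>T. open T \<and> z \<in> T \<and> T \<subseteq> - S" by (intro exI[of _ U]) (auto simp: S_def measure_support_def)
  qed
  then show ?thesis by (simp add: closed_open)
qed

lemma S_sets: "S \<in> sets \<mu>" using closed_S by (simp add: sets_mu)

lemma compact_S: "compact S"
  using compact_E S_sub closed_S by (metis compact_Int_closed inf.absorb_iff2)

lemma deg_p: "degree (p n) = n" and lead_p: "lead_coeff (p n) \<noteq> 0"
  using orth unfolding orthonormal_polys_def by (auto, metis less_irrefl of_real_eq_0_iff)

text \<open>The cutoff at the support lets continuity on E supply both measurability and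
  boundedness.\<close>

lemma set_int:
  fixes f :: "complex \<Rightarrow> 'b::{banach, second_countable_topology}"
  assumes "continuous_on E f" shows "set_integrable \<mu> S f"
proof -
  have c: "continuous_on S f" using assms S_sub continuous_on_subset by blast
  obtain B where B: "\<And>z. z \<in> S \<Longrightarrow> norm (f z) \<le> B"
    using compact_imp_bounded[OF compact_continuous_image[OF c compact_S]] by (fastforce simp: bounded_iff)
  have "(\<lambda>x. indicator S x *\<^sub>R f x) \<in> borel_measurable borel"
    using c closed_S by (intro borel_measurable_continuous_on_indicator) auto
  then have m: "(\<lambda>x. indicator S x *\<^sub>R f x) \<in> borel_measurable \<mu>"
    using measurable_cong_sets[OF sets_mu refl] by blast
  show ?thesis unfolding set_integrable_def
  proof (rule finite_measure.integrable_const_bound[OF finite_mu _ m])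
    show "AE x in \<mu>. norm (indicator S x *\<^sub>R f x) \<le> max B 0"
      using B by (intro AE_I2) (auto simp: indicator_def le_max_iff_disj)
  qed
qed

lemma cont_p: "continuous_on A (\<lambda>z. poly q z)" "continuous_on A (\<lambda>z. cnj (poly q z))"
  by (intro continuous_intros)+

lemma ip_alt: "ip f j = (LINT z:S|\<mu>. f z * cnj (poly (p j) z))"
  by (simp add: ip_def inner_mu_def S_def)

lemma set_int_ip: "continuous_on E f \<Longrightarrow> set_integrable \<mu> S (\<lambda>z. f z * cnj (poly (p j) z))"
  by (intro set_int continuous_intros)

lemma ip_cong: "(\<And>z. z \<in> E \<Longrightarrow> f z = g z) \<Longrightarrow> ip f j = ip g j"
  unfolding ip_alt using S_sub S_sets by (intro set_lebesgue_integral_cong) auto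

lemma ip_add: "continuous_on E f \<Longrightarrow> continuous_on E g \<Longrightarrow> ip (\<lambda>z. f z + g z) j = ip f j + ip g j"
  unfolding ip_alt by (simp add: distrib_right set_integral_add set_int_ip)

lemma ip_diff: "continuous_on E f \<Longrightarrow> continuous_on E g \<Longrightarrow> ip (\<lambda>z. f z - g z) j = ip f j - ip g j"
  unfolding ip_alt by (simp add: left_diff_distrib set_integral_diff set_int_ip)

lemma ip_cmult: "ip (\<lambda>z. c * f z) j = c * ip f j"
  unfolding ip_alt by (simp add: mult.assoc)

lemma ip_zero: "ip (\<lambda>z. 0) j = 0"
  unfolding ip_alt by simp

lemma ip_sum:
  assumes "finite I" "\<And>i. i \<in> I \<Longrightarrow> continuous_on E (f i)"
  shows "ip (\<lambda>z. \<Sum>i\<in>I. f i z) j = (\<Sum>i\<in>I. ip (f i) j)"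
  using assms
proof (induction I rule: finite_induct)
  case (insert x F)
  then have "ip (\<lambda>z. f x z + (\<Sum>i\<in>F. f i z)) j = ip (f x) j + ip (\<lambda>z. \<Sum>i\<in>F. f i z) j"
    by (intro ip_add continuous_intros) auto
  with insert show ?case by simp
qed (simp add: ip_zero)

lemma ip_p: "ip (poly (p i)) j = (if i = j then 1 else 0)"
  using orth by (simp add: ip_def orthonormal_polys_def)

lemma norm_p_int: "(LINT z:S|\<mu>. (norm (poly (p j) z))\<^sup>2) = 1"
proof -
  have "complex_of_real (LINT z:S|\<mu>. (norm (poly (p j) z))\<^sup>2) = (LINT z:S|\<mu>. complex_of_real ((norm (poly (p j) z))\<^sup>2))"
    by (simp only: set_integral_complex_of_real)
  also have "\<dots> = ip (poly (p j)) j"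
    unfolding ip_alt by (simp only: complex_norm_square)
  finally show ?thesis by (simp add: ip_p)
qed

lemma norm_set_int_le:
  fixes f :: "complex \<Rightarrow> complex"
  assumes "continuous_on E f" "continuous_on E g" "\<And>z. z \<in> E \<Longrightarrow> norm (f z) \<le> g z"
  shows "norm (LINT z:S|\<mu>. f z) \<le> (LINT z:S|\<mu>. g z)"
proof -
  have "norm (LINT z:S|\<mu>. f z) \<le> (LINT z:S|\<mu>. norm (f z))"
    by (intro set_integral_norm_bound set_int assms)
  also have "\<dots> \<le> (LINT z:S|\<mu>. g z)"
    using assms S_sub by (intro set_integral_mono set_int continuous_intros) auto
  finally show ?thesis .
qed

lemma norm_ip_le:
  assumes f: "continuous_on E f" and B: "\<And>z. z \<in> E \<Longrightarrow> norm (f z) \<le> B"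
  shows "norm (ip f j) \<le> B * mass"
proof -
  obtain z0 where "z0 \<in> E" using nonempty_E by auto
  then have B0: "0 \<le> B" using B norm_ge_zero order_trans by blast
  let ?n = "\<lambda>z. (norm (poly (p j) z))\<^sup>2"
  have "norm (ip f j) \<le> (LINT z:S|\<mu>. B * (1 + ?n z))"
    unfolding ip_alt
  proof (rule norm_set_int_le)
    fix z assume z: "z \<in> E"
    have "norm (poly (p j) z) * 2 \<le> 1 + ?n z" using zero_le_power2[of "norm (poly (p j) z) - 1"]
      by (simp add: power2_diff)
    then have "norm (poly (p j) z) \<le> 1 + ?n z" using norm_ge_zero[of "poly (p j) z"] by linarith
    then show "norm (f z * cnj (poly (p j) z)) \<le> B * (1 + ?n z)"
      unfolding norm_mult complex_mod_cnj using B[OF z] B0 by (intro mult_mono) auto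
  qed (use f in \<open>auto intro!: continuous_intros\<close>)
  also have "\<dots> = B * ((LINT z:S|\<mu>. 1) + (LINT z:S|\<mu>. ?n z))"
    by (simp add: set_integral_add set_int continuous_on_norm continuous_on_power cont_p)
  also have "(LINT z:S|\<mu>. 1) = measure \<mu> S"
    using S_sets by (simp add: set_lebesgue_integral_def space_mu)
  also have "B * (measure \<mu> S + (LINT z:S|\<mu>. ?n z)) \<le> B * mass"
    unfolding mass_def norm_p_int using B0 finite_mu
    by (intro mult_left_mono add_right_mono finite_measure.bounded_measure) auto
  finally show ?thesis .
qed

section \<open>Expansion of polynomials in the orthonormal basis\<close>

lemma poly_span:
  assumes "degree q \<le> N"
  shows "\<exists>c. q = (\<Sum>j\<le>N. smult (c j) (p j))"
  using assms
proof (induction N arbitrary: q)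
  case 0
  then obtain a where a: "q = [:a:]" by (auto elim: degree_eq_zeroE)
  obtain b where b: "p 0 = [:b:]" using deg_p[of 0] by (auto elim: degree_eq_zeroE)
  with lead_p[of 0] have "b \<noteq> 0" by simp
  then show ?case by (intro exI[of _ "\<lambda>_. a / b"]) (simp add: a b)
next
  case (Suc N)
  define d where "d = coeff q (Suc N) / lead_coeff (p (Suc N))"
  define q' where "q' = q - smult d (p (Suc N))"
  have "coeff q' (Suc N) = 0" using lead_p[of "Suc N"] by (simp add: q'_def d_def deg_p)
  moreover have "degree q' \<le> Suc N" unfolding q'_def
    using Suc.prems deg_p by (intro degree_diff_le) (auto simp: degree_smult_eq)
  ultimately have "degree q' \<le> N"
    by (metis leading_coeff_0_iff degree_0 le_SucE zero_le)
  then obtain c where c: "q' = (\<Sum>j\<le>N. smult (c j) (p j))" using Suc.IH by blast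
  have "q = (\<Sum>j\<le>Suc N. smult ((c(Suc N := d)) j) (p j))"
    using c by (simp add: q'_def algebra_simps)
  then show ?case by blast
qed

lemma ip_span:
  "ip (poly (\<Sum>j\<le>N. smult (c j) (p j))) i = (if i \<le> N then c i else 0)"
proof -
  have "ip (poly (\<Sum>j\<le>N. smult (c j) (p j))) i = ip (\<lambda>z. \<Sum>j\<le>N. c j * poly (p j) z) i"
    by (intro ip_cong) (simp add: poly_sum)
  also have "\<dots> = (\<Sum>j\<le>N. c j * (if j = i then 1 else 0))"
    by (subst ip_sum) (auto intro!: continuous_intros simp: ip_cmult ip_p)
  finally show ?thesis by (simp add: if_distrib cong: if_cong)
qed

lemma ip_poly_high: "degree q < i \<Longrightarrow> ip (poly q) i = 0"
  using poly_span[of q "degree q"] ip_span by (metis leD order_refl)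

lemma poly_expand:
  assumes "degree q \<le> N" shows "q = (\<Sum>j\<le>N. smult (ip (poly q) j) (p j))"
proof -
  obtain c where c: "q = (\<Sum>j\<le>N. smult (c j) (p j))" using poly_span[OF assms] by blast
  have "(\<Sum>j\<le>N. smult (ip (poly q) j) (p j)) = (\<Sum>j\<le>N. smult (c j) (p j))"
    by (subst (1) c, subst ip_span) simp
  with c show ?thesis by simp
qed

lemma poly_expand_eval:
  "degree q \<le> N \<Longrightarrow> poly q z = (\<Sum>j\<le>N. ip (poly q) j * poly (p j) z)"
  using arg_cong[OF poly_expand, of q N "\<lambda>q. poly q z"] by (simp add: poly_sum)

section \<open>Functions of the second kind off E\<close>

lemma cont_kernel: "z \<notin> E \<Longrightarrow> continuous_on E f \<Longrightarrow> continuous_on E (\<lambda>\<zeta>. f \<zeta> / (z - \<zeta>))"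
  by (intro continuous_intros) auto

text \<open>The difference quotient (p_k(z) - p_k(\<zeta>)) / (z - \<zeta>) is a polynomial in
  \<zeta> of degree below n, hence orthogonal to p_n; therefore p_k(z) may be replaced by
  p_k(\<zeta>) under the integral.\<close>

lemma p_times_s:
  assumes "k \<le> n" "z \<notin> E"
  shows "poly (p k) z * s n z = ip (\<lambda>\<zeta>. poly (p k) \<zeta> / (z - \<zeta>)) n"
proof -
  let ?q = "synthetic_div (p k) z"
  have id: "poly (p k) z - poly (p k) \<zeta> = (z - \<zeta>) * poly ?q \<zeta>" for \<zeta>
    using arg_cong[OF synthetic_div_correct'[of z "p k"], of "\<lambda>q. poly q \<zeta>"]
    by (simp add: algebra_simps)
  have q0: "ip (poly ?q) n = 0"
  \<comment> \<open>For k = 0 the quotient is the zero polynomial, of degree 0 by convention, and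
    the degree comparison would fail for n = 0.\<close>
  proof (cases "k = 0")
    case True
    then have "?q = 0" using deg_p[of 0] by (auto simp: synthetic_div_eq_0_iff)
    moreover have "poly 0 = (\<lambda>z::complex. 0)" by auto
    ultimately show ?thesis by (simp add: ip_zero)
  next
    case False
    then show ?thesis using assms by (intro ip_poly_high) (simp add: degree_synthetic_div deg_p)
  qed
  have "poly (p k) z * s n z = ip (\<lambda>\<zeta>. poly (p k) z * (1 / (z - \<zeta>))) n"
    unfolding s_def by (rule ip_cmult[symmetric])
  also have "\<dots> = ip (\<lambda>\<zeta>. poly (p k) \<zeta> / (z - \<zeta>) + poly ?q \<zeta>) n"
  proof (rule ip_cong)
    fix \<zeta> assume "\<zeta> \<in> E"
    then have "z - \<zeta> \<noteq> 0" using assms by auto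
    then show "poly (p k) z * (1 / (z - \<zeta>)) = poly (p k) \<zeta> / (z - \<zeta>) + poly ?q \<zeta>"
      using id[of \<zeta>] by (simp add: field_simps)
  qed
  also have "\<dots> = ip (\<lambda>\<zeta>. poly (p k) \<zeta> / (z - \<zeta>)) n"
    using assms by (subst ip_add) (auto intro!: cont_kernel continuous_intros simp: q0)
  finally show ?thesis .
qed

text \<open>With k = n in \<open>p_times_s\<close> the integrand becomes |p_n|^2 / (z - \<zeta>),
  and |p_n|^2 has integral 1. The bound is uniform in n, as a normal family requires.\<close>

lemma p_times_s_bound:
  assumes d: "d > 0" "\<And>\<zeta>. \<zeta> \<in> E \<Longrightarrow> d \<le> norm (z - \<zeta>)"
  shows "norm (poly (p n) z * s n z) \<le> 1 / d"
proof -
  have z: "z \<notin> E" using d(2)[of z] d(1) by auto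
  have ne: "z - \<zeta> \<noteq> 0" if "\<zeta> \<in> E" for \<zeta> using z that by auto
  have "norm (poly (p n) z * s n z) \<le> (LINT \<zeta>:S|\<mu>. (norm (poly (p n) \<zeta>))\<^sup>2 / d)"
    unfolding p_times_s[OF order_refl z] ip_alt
  proof (rule norm_set_int_le)
    fix \<zeta> assume "\<zeta> \<in> E"
    then show "norm (poly (p n) \<zeta> / (z - \<zeta>) * cnj (poly (p n) \<zeta>)) \<le> (norm (poly (p n) \<zeta>))\<^sup>2 / d"
      using d ne[of \<zeta>] by (simp add: norm_mult norm_divide power2_eq_square frac_le)
  qed (use ne d in \<open>auto intro!: continuous_intros\<close>)
  also have "\<dots> = 1 / d" by (simp add: norm_p_int)
  finally show ?thesis .
qed

text \<open>Differentiation under the integral: the difference quotient minus the formal derivative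
  is y - z times an integral that stays bounded, because y keeps the distance d/2 from E.\<close>

lemma s_hol: "s j holomorphic_on (- E)"
  unfolding holomorphic_on_open[OF open_Compl_E]
proof (intro ballI exI)
  fix z assume z: "z \<in> - E"
  obtain d where d: "d > 0" "\<And>\<zeta>. \<zeta> \<in> E \<Longrightarrow> d \<le> norm (z - \<zeta>)"
    using separate_point_closed[OF closed_E, of z] z by (auto simp: dist_norm)
  define D where "D = ip (\<lambda>\<zeta>. - 1 / (z - \<zeta>)\<^sup>2) j"
  have ne: "z - \<zeta> \<noteq> 0" if "\<zeta> \<in> E" for \<zeta> using z that by auto
  have b: "norm ((s j y - s j z) / (y - z) - D) \<le> norm (y - z) * (2 / d ^ 3 * mass)"
    if y: "y \<noteq> z" "dist y z < d / 2" for y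
  proof -
    have yd: "d / 2 \<le> norm (y - \<zeta>)" if "\<zeta> \<in> E" for \<zeta>
    proof -
      have "norm (z - \<zeta>) \<le> norm (z - y) + norm (y - \<zeta>)"
        by (metis dist_norm dist_triangle)
      then show ?thesis using d(2)[OF that] y(2) by (simp add: dist_norm norm_minus_commute)
    qed
    have yne: "y - \<zeta> \<noteq> 0" if "\<zeta> \<in> E" for \<zeta> using yd[OF that] d(1) by auto
    have yE: "y \<notin> E" using yne[of y] by auto
    have "(s j y - s j z) / (y - z) - D = ip (\<lambda>\<zeta>. (y - z) * (1 / ((z - \<zeta>)\<^sup>2 * (y - \<zeta>)))) j"
    proof -
      have "(s j y - s j z) / (y - z) = inverse (y - z) * ip (\<lambda>\<zeta>. 1 / (y - \<zeta>) - 1 / (z - \<zeta>)) j"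
        unfolding s_def using yne ne
        by (subst ip_diff) (auto intro!: continuous_intros simp: field_simps)
      then have "(s j y - s j z) / (y - z) - D =
        ip (\<lambda>\<zeta>. inverse (y - z) * (1 / (y - \<zeta>) - 1 / (z - \<zeta>)) - (- 1 / (z - \<zeta>)\<^sup>2)) j"
        unfolding D_def using yne ne
        by (subst ip_diff) (auto intro!: continuous_intros simp: ip_cmult)
      also have "\<dots> = ip (\<lambda>\<zeta>. (y - z) * (1 / ((z - \<zeta>)\<^sup>2 * (y - \<zeta>)))) j"
      proof (rule ip_cong)
        fix \<zeta> assume \<zeta>: "\<zeta> \<in> E"
        have "1 / (y - \<zeta>) - 1 / (z - \<zeta>) = - ((y - z) / ((y - \<zeta>) * (z - \<zeta>)))"
        proof -
          have "1 / a - 1 / b = - ((a - b) / (a * b))" if "a \<noteq> 0" "b \<noteq> 0" for a b :: complex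
            using that by (simp add: field_simps)
          from this[OF yne[OF \<zeta>] ne[OF \<zeta>]] show ?thesis by simp
        qed
        then have "inverse (y - z) * (1 / (y - \<zeta>) - 1 / (z - \<zeta>)) = - 1 / ((y - \<zeta>) * (z - \<zeta>))"
          using y by (simp only: mult_minus_right times_divide_eq_right) simp
        moreover have "- 1 / ((y - \<zeta>) * (z - \<zeta>)) - (- 1 / (z - \<zeta>)\<^sup>2)
            = ((y - \<zeta>) - (z - \<zeta>)) / ((z - \<zeta>)\<^sup>2 * (y - \<zeta>))"
        proof -
          have "- 1 / (a * b) - (- 1 / b\<^sup>2) = (a - b) / (b\<^sup>2 * a)" if "a \<noteq> 0" "b \<noteq> 0" for a b :: complex
            using that by (simp add: field_simps power2_eq_square)
          then show ?thesis using ne[OF \<zeta>] yne[OF \<zeta>] by blast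
        qed
        ultimately show "inverse (y - z) * (1 / (y - \<zeta>) - 1 / (z - \<zeta>)) - (- 1 / (z - \<zeta>)\<^sup>2)
          = (y - z) * (1 / ((z - \<zeta>)\<^sup>2 * (y - \<zeta>)))" by simp
      qed
      finally show ?thesis .
    qed
    then have "(s j y - s j z) / (y - z) - D = (y - z) * ip (\<lambda>\<zeta>. 1 / ((z - \<zeta>)\<^sup>2 * (y - \<zeta>))) j"
      by (simp only: ip_cmult)
    moreover have "norm (ip (\<lambda>\<zeta>. 1 / ((z - \<zeta>)\<^sup>2 * (y - \<zeta>))) j) \<le> 2 / d ^ 3 * mass"
    proof (rule norm_ip_le)
      fix \<zeta> assume \<zeta>: "\<zeta> \<in> E"
      have "d\<^sup>2 * (d / 2) \<le> (norm (z - \<zeta>))\<^sup>2 * norm (y - \<zeta>)"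
        using d(1) d(2)[OF \<zeta>] yd[OF \<zeta>] by (intro mult_mono power_mono) auto
      then have "1 / ((norm (z - \<zeta>))\<^sup>2 * norm (y - \<zeta>)) \<le> 1 / (d\<^sup>2 * (d / 2))"
        using d(1) ne[OF \<zeta>] yne[OF \<zeta>] by (intro divide_left_mono mult_pos_pos) auto
      then show "norm (1 / ((z - \<zeta>)\<^sup>2 * (y - \<zeta>))) \<le> 2 / d ^ 3"
        by (simp add: norm_divide norm_mult norm_power power2_eq_square power3_eq_cube)
    qed (use ne yne in \<open>auto intro!: continuous_intros\<close>)
    ultimately show ?thesis by (simp only: norm_mult mult_left_mono norm_ge_zero)
  qed
  show "(s j has_field_derivative D) (at z)"
    unfolding has_field_derivative_iff
  proof (subst LIM_zero_iff[symmetric], rule Lim_null_comparison)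
    have ev: "eventually (\<lambda>y. y \<noteq> z \<and> dist y z < d / 2) (at z)"
      using d(1) unfolding eventually_at by (intro exI[of _ "d/2"]) auto
    show "eventually (\<lambda>y. norm ((s j y - s j z) / (y - z) - D) \<le> norm (y - z) * (2 / d ^ 3 * mass)) (at z)"
      using ev by eventually_elim (use b in auto)
    have "((\<lambda>y. norm (y - z) * (2 / d ^ 3 * mass)) \<longlongrightarrow> norm (z - z) * (2 / d ^ 3 * mass)) (at z)"
      by (intro tendsto_intros)
    then show "((\<lambda>y. norm (y - z) * (2 / d ^ 3 * mass)) \<longlongrightarrow> 0) (at z)" by simp
  qed
qed

section \<open>Fourier coefficients as contour integrals\<close>

definition sig :: "nat \<Rightarrow> complex \<Rightarrow> complex" where "sig j w = s j (Psi w)"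

lemma sig_hol: "sig j holomorphic_on {w. 1 < norm w}"
  unfolding sig_def using s_hol Psi_notin by (intro Psi_comp_hol[of _ "- E"]) auto

lemma sig_cont: "1 < r \<Longrightarrow> continuous_on (sphere 0 r) (sig j)"
  by (rule continuous_on_subset[OF holomorphic_on_imp_continuous_on[OF sig_hol]]) auto

text \<open>Fubini for the circle parameter and \<mu>: integrating the Cauchy kernel against the
  conjugate of \<open>p j\<close> produces the function of the second kind at Psi(w).\<close>

lemma ip_cint:
  assumes r: "1 < r" and h: "continuous_on (sphere 0 r) h"
  shows "ip (\<lambda>\<zeta>. cint r (\<lambda>w. h w / (Psi w - \<zeta>))) j = cint r (\<lambda>w. h w * sig j w)"
proof -
  let ?c = "circlepath 0 r"
  define K where "K = (\<lambda>(t, \<zeta>). h (?c t) * ?c t / (Psi (?c t) - \<zeta>) * cnj (poly (p j) \<zeta>))"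
  have nc: "norm (?c t) = r" for t using r by (simp add: circlepath norm_mult norm_exp_eq_Re)
  have cc: "continuous_on A ?c" for A unfolding circlepath[abs_def] by (intro continuous_intros)
  have ne: "Psi (?c t) - \<zeta> \<noteq> 0" if "\<zeta> \<in> E" for t \<zeta>
    using Psi_notin[of "?c t"] nc r that by auto
  have chc: "continuous_on A (\<lambda>t. h (?c t))" for A
    by (rule continuous_on_compose2[OF h cc]) (use nc in auto)
  have cPc: "continuous_on A (\<lambda>t. Psi (?c t))" for A
    by (rule continuous_on_compose2[OF Psi_cont cc]) (use nc r in auto)
  have cfst: "continuous_on A (\<lambda>x. g (fst x))" if "\<And>B. continuous_on B g" for A :: "(real \<times> complex) set" and g :: "real \<Rightarrow> complex"
    by (rule continuous_on_compose2[OF that[of UNIV] continuous_on_fst]) (auto intro: continuous_intros)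
  have contK: "continuous_on ({0..1} \<times> S) K"
    unfolding K_def case_prod_beta using ne S_sub
    by (intro continuous_intros cfst[OF chc] cfst[OF cc] cfst[OF cPc]) auto
  have compK: "compact ({0..1::real} \<times> S)" using compact_S by (intro compact_Times) auto
  obtain B where B: "\<And>x. x \<in> {0..1} \<times> S \<Longrightarrow> norm (K x) \<le> B"
    using compact_imp_bounded[OF compact_continuous_image[OF contK compK]] by (fastforce simp: bounded_iff)
  interpret finite_measure \<mu> by (rule finite_mu)
  interpret P: pair_sigma_finite lborel \<mu> by standard
  \<comment> \<open>The cutoff to the compact set on which K is continuous yields joint
    measurability and a bound. The factor \<open>lborel\<close> is infinite, so integrability is
    shown on a strip of finite measure.\<close>
  define K' where "K' x = indicator ({0..1} \<times> S) x *\<^sub>R K x" for x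
  have "K' \<in> borel_measurable borel"
    unfolding K'_def using contK compK by (intro borel_measurable_continuous_on_indicator)
      (auto intro: borel_closed compact_imp_closed)
  moreover have "sets (lborel \<Otimes>\<^sub>M \<mu>) = sets (borel :: (real \<times> complex) measure)"
    using sets_pair_measure_cong[OF sets_lborel sets_mu] borel_prod by metis
  ultimately have mK: "K' \<in> borel_measurable (lborel \<Otimes>\<^sub>M \<mu>)"
    using measurable_cong_sets by blast
  have intK: "integrable (lborel \<Otimes>\<^sub>M \<mu>) K'"
  proof -
    let ?A = "{0..1::real} \<times> space \<mu>"
    have A: "?A \<in> sets (lborel \<Otimes>\<^sub>M \<mu>)" by (intro pair_measureI) auto
    have "integrable (lborel \<Otimes>\<^sub>M \<mu>) (\<lambda>x. indicator ?A x *\<^sub>R K' x)"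
    proof (rule integrableI_bounded_set_indicator[OF A mK])
      have "emeasure (lborel \<Otimes>\<^sub>M \<mu>) ?A = emeasure lborel {0..1::real} * emeasure \<mu> (space \<mu>)"
        by (intro emeasure_pair_measure_Times) auto
      also have "\<dots> < \<infinity>" by (simp add: emeasure_eq_measure)
      finally show "emeasure (lborel \<Otimes>\<^sub>M \<mu>) ?A < \<infinity>" .
      show "AE x in lborel \<Otimes>\<^sub>M \<mu>. x \<in> ?A \<longrightarrow> norm (K' x) \<le> max B 0"
        using B by (intro AE_I2) (auto simp: K'_def indicator_def le_max_iff_disj)
    qed
    moreover have "(\<lambda>x. indicator ?A x *\<^sub>R K' x) = K'"
      by (auto simp: K'_def fun_eq_iff indicator_def space_mu)
    ultimately show ?thesis by simp
  qed
  have Fub: "(LINT y|\<mu>. LINT x|lborel. K' (x, y)) = (LINT x|lborel. LINT y|\<mu>. K' (x, y))"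
    using P.Fubini_integral[of "\<lambda>x y. K' (x, y)"] intK by simp
  have L: "(LINT x|lborel. K' (x, y)) = indicator S y *\<^sub>R (cint r (\<lambda>w. h w / (Psi w - y)) * cnj (poly (p j) y))"
    (is "_ = ?R") for y
  proof (cases "y \<in> S")
    case True
    then have yE: "y \<in> E" using S_sub by auto
    have c: "continuous_on {0..1} (\<lambda>t. K (t, y))"
      unfolding K_def using ne[OF yE] by (auto intro!: continuous_intros chc cPc cc)
    have "(LINT x|lborel. K' (x, y)) = (LINT t:{0..1}|lborel. K (t, y))"
      unfolding set_lebesgue_integral_def K'_def using True by (intro Bochner_Integration.integral_cong) (auto simp: indicator_def)
    also have "\<dots> = integral {0..1} (\<lambda>t. K (t, y))"
      by (rule set_borel_integral_eq_integral) (rule borel_integrable_atLeastAtMost'[OF c])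
    also have "\<dots> = integral {0..1} (\<lambda>t. (h (?c t) / (Psi (?c t) - y) * ?c t) * cnj (poly (p j) y))"
      by (intro integral_cong) (simp add: K_def)
    also have "\<dots> = cint r (\<lambda>w. h w / (Psi w - y)) * cnj (poly (p j) y)"
      unfolding cint_eq_integral by (rule integral_mult_left)
    finally show ?thesis using True by simp
  qed (simp add: K'_def)
  have R: "(LINT y|\<mu>. K' (t, y)) = indicator {0..1} t *\<^sub>R (h (?c t) * sig j (?c t) * ?c t)" for t
  proof (cases "t \<in> {0..1}")
    case True
    have "(LINT y|\<mu>. K' (t, y)) = (LINT y:S|\<mu>. (h (?c t) * ?c t) * (1 / (Psi (?c t) - y) * cnj (poly (p j) y)))"
      unfolding set_lebesgue_integral_def K'_def using True
      by (intro Bochner_Integration.integral_cong) (auto simp: indicator_def K_def)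
    also have "\<dots> = (h (?c t) * ?c t) * sig j (?c t)"
      by (simp only: set_integral_mult_right sig_def s_def ip_alt)
    finally show ?thesis using True by simp
  next
    case False
    then have "K' (t, y) = 0" for y by (auto simp: K'_def indicator_def)
    then show ?thesis using False by simp
  qed
  have "ip (\<lambda>\<zeta>. cint r (\<lambda>w. h w / (Psi w - \<zeta>))) j = (LINT y|\<mu>. LINT x|lborel. K' (x, y))"
    unfolding ip_alt set_lebesgue_integral_def L ..
  also have "\<dots> = (LINT t:{0..1}|lborel. h (?c t) * sig j (?c t) * ?c t)"
    unfolding Fub R set_lebesgue_integral_def ..
  also have "\<dots> = integral {0..1} (\<lambda>t. h (?c t) * sig j (?c t) * ?c t)"
  proof (rule set_borel_integral_eq_integral)
    have "continuous_on {0..1} (\<lambda>t. sig j (?c t))"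
      by (rule continuous_on_compose2[OF sig_cont[OF r] cc]) (use nc in auto)
    then show "set_integrable lborel {0..1} (\<lambda>t. h (?c t) * sig j (?c t) * ?c t)"
      by (intro borel_integrable_atLeastAtMost' continuous_intros chc cc)
  qed
  also have "\<dots> = cint r (\<lambda>w. h w * sig j w)" by (simp add: cint_eq_integral)
  finally show ?thesis .
qed

text \<open>Cauchy's formula followed by Fubini. Later \<open>sig j\<close> is seen to decay about
  like r^(-j) on this circle, so the radius up to which H is holomorphic governs the decay of its
  Fourier coefficients.\<close>

lemma ip_eq_cint:
  assumes hol: "H holomorphic_on T" and T: "open T" "Dcl r \<subseteq> T" and r: "1 < r"
  shows "ip H j = cint r (\<lambda>w. H (Psi w) * deriv Psi w * sig j w)"
proof -
  have "ip H j = ip (\<lambda>\<zeta>. cint r (\<lambda>w. H (Psi w) * deriv Psi w / (Psi w - \<zeta>))) j"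
    using Cauchy_exterior[OF hol T r] Dcl_Dop(3)[of r] by (intro ip_cong) (simp add: subset_iff)
  also have "\<dots> = cint r (\<lambda>w. H (Psi w) * deriv Psi w * sig j w)"
  proof (rule ip_cint[OF r])
    have "Psi ` sphere 0 r \<subseteq> T" using T r Psi_in_Dcl[of _ r] by auto
    then show "continuous_on (sphere 0 r) (\<lambda>w. H (Psi w) * deriv Psi w)"
      using r by (intro continuous_intros holomorphic_on_imp_continuous_on[OF Psi_comp_hol[OF hol]]
          continuous_on_subset[OF holomorphic_on_imp_continuous_on[OF Psi_deriv_hol]]) auto
  qed
  finally show ?thesis .
qed

lemma biorthogonal:
  "1 < r \<Longrightarrow> cint r (\<lambda>w. poly (p k) (Psi w) * deriv Psi w * sig j w) = (if k = j then 1 else 0)"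
  using ip_eq_cint[of "poly (p k)" UNIV r j] by (simp add: ip_p poly_hol)

end

section \<open>Asymptotics of the functions of the second kind\<close>

definition ann :: "real \<Rightarrow> real \<Rightarrow> complex set" where
  "ann a b = {w. a \<le> norm w \<and> norm w \<le> b}"

lemma compact_ann: "compact (ann a b)"
proof -
  have "ann a b = cball 0 b \<inter> {w. a \<le> norm w}" by (auto simp: ann_def)
  also have "compact \<dots>"
    by (intro compact_Int_closed closed_Collect_le continuous_intros) auto
  finally show ?thesis .
qed

lemma ann_empty: "\<not> a \<le> b \<Longrightarrow> ann a b = {}"
  by (auto simp: ann_def)

lemma uniform_limit_eventually_bounds:
  assumes lim: "uniform_limit K f l F"
    and "\<And>x. x \<in> K \<Longrightarrow> c \<le> norm (l x)" "\<And>x. x \<in> K \<Longrightarrow> norm (l x) \<le> C" "c' < c" "C < C'"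
  shows "eventually (\<lambda>n. \<forall>x\<in>K. c' < norm (f n x) \<and> norm (f n x) < C') F"
proof -
  define e where "e = min (c - c') (C' - C)"
  have "e > 0" using assms by (simp add: e_def)
  then have "eventually (\<lambda>n. \<forall>x\<in>K. dist (f n x) (l x) < e) F" by (rule uniform_limitD[OF lim])
  then show ?thesis
  proof eventually_elim
    case (elim n)
    show ?case
    proof
      fix x assume x: "x \<in> K"
      have "\<bar>norm (f n x) - norm (l x)\<bar> < e"
        using elim x norm_triangle_ineq3[of "f n x" "l x"] by (force simp: dist_norm)
      then show "c' < norm (f n x) \<and> norm (f n x) < C'"
        using assms(2)[OF x] assms(3)[OF x] unfolding e_def by linarith
    qed
  qed
qed

lemma uniform_limit_shift:
  "uniform_limit K f l sequentially \<Longrightarrow> filterlim g sequentially F \<Longrightarrow> uniform_limit K (\<lambda>n. f (g n)) l F"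
  by (rule filterlim_compose)

lemma cint_uniform_limit:
  assumes "eventually (\<lambda>n. continuous_on (sphere 0 r) (f n)) F"
    and "uniform_limit (sphere 0 r) f l F" "F \<noteq> bot" "0 < r"
  shows "((\<lambda>n. cint r (f n)) \<longlongrightarrow> cint r l) F"
proof -
  have "eventually (\<lambda>n. f n contour_integrable_on (circlepath 0 r)) F"
    using assms(1) by eventually_elim (simp add: circle_integrable assms)
  then show ?thesis unfolding cint_def
    using assms by (intro tendsto_intros contour_integral_uniform_limit_circlepath) auto
qed

text \<open>Finitely many initial terms are absorbed into the constant, which makes the bound hold
  for every n.\<close>

lemma geometric_growth:
  fixes f :: "nat \<Rightarrow> 'a \<Rightarrow> real"
  assumes bd: "\<And>n. \<exists>B. \<forall>w\<in>K. f n w \<le> B" and q: "0 < q"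
    and step: "eventually (\<lambda>n. \<forall>w\<in>K. f (Suc n) w \<le> q * f n w) sequentially"
  obtains C where "C > 0" "\<And>n w. w \<in> K \<Longrightarrow> f n w \<le> C * q ^ n"
proof -
  obtain B where B: "\<And>n w. w \<in> K \<Longrightarrow> f n w \<le> B n" using bd by metis
  obtain N where N: "\<And>n w. n \<ge> N \<Longrightarrow> w \<in> K \<Longrightarrow> f (Suc n) w \<le> q * f n w"
    using step by (auto simp: eventually_sequentially)
  define C where "C = (\<Sum>n\<le>N. (\<bar>B n\<bar> + 1) / q ^ n)"
  have Cn: "(\<bar>B n\<bar> + 1) / q ^ n \<le> C" if "n \<le> N" for n
    unfolding C_def using that q by (intro member_le_sum) auto
  have C: "C > 0" using Cn[of 0] by simp
  have lo: "f n w \<le> C * q ^ n" if "w \<in> K" "n \<le> N" for n w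
  proof -
    have "f n w \<le> \<bar>B n\<bar> + 1" using B[OF that(1), of n] by linarith
    also have "\<dots> \<le> C * q ^ n" using Cn[OF that(2)] q by (simp add: field_simps)
    finally show ?thesis .
  qed
  have hi: "f (N + k) w \<le> C * q ^ (N + k)" if "w \<in> K" for k w
  proof (induction k)
    case (Suc k)
    have "f (N + Suc k) w \<le> q * f (N + k) w" using N[of "N + k" w] that by simp
    also have "\<dots> \<le> q * (C * q ^ (N + k))" using Suc q by (intro mult_left_mono) auto
    finally show ?case by (simp add: algebra_simps)
  qed (use lo that in auto)
  show ?thesis
  proof (rule that[OF C])
    fix n w assume "w \<in> K"
    then show "f n w \<le> C * q ^ n" using lo[of w n] hi[of w "n - N"] by (cases "n \<le> N") auto
  qed
qed

lemma cint_powi: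
  assumes r: "0 < r"
  shows "cint r (\<lambda>w. w powi i * (1 / w)) = (if i = 0 then 1 else 0)"
proof (cases "i \<le> 0")
  case True0: True
  have "((\<lambda>w::complex. w * (w powi i * (1 / w))) \<longlongrightarrow> (if i = 0 then 1 else 0)) at_infinity"
  proof (cases "i = 0")
    case True
    have "eventually (\<lambda>w::complex. 1 = w * (w powi i * (1 / w))) at_infinity"
      unfolding eventually_at_infinity using True by (intro exI[of _ 1]) auto
    from Lim_transform_eventually[OF tendsto_const this] True show ?thesis by simp
  next
    case False
    obtain k where k: "i = - int (Suc k)" using \<open>i \<le> 0\<close>
      using that[of "nat (- i - 1)"] False True0 by simp
    have "((\<lambda>w::complex. inverse w ^ Suc k) \<longlongrightarrow> 0 ^ Suc k) at_infinity"
      by (intro tendsto_power tendsto_inverse_0)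
    moreover have ev: "eventually (\<lambda>w::complex. inverse w ^ Suc k = w * (w powi i * (1 / w))) at_infinity"
      unfolding eventually_at_infinity k
      by (intro exI[of _ 1]) (auto simp: power_int_minus power_inverse simp del: of_nat_Suc)
    ultimately have "((\<lambda>w::complex. w * (w powi i * (1 / w))) \<longlongrightarrow> 0 ^ Suc k) at_infinity"
      by (rule Lim_transform_eventually)
    then show ?thesis using False by simp
  qed
  then show ?thesis
    using r by (intro cint_limit_at_infinity[where s=0]) (auto intro!: holomorphic_intros)
next
  case False
  then obtain k where k: "i = int (Suc k)"
    using that[of "nat (i - 1)"] by simp
  have "cint r (\<lambda>w. w powi i * (1 / w)) = cint r (\<lambda>w. w ^ k)"
    using r by (intro cint_cong) (auto simp: k field_simps simp del: of_nat_Suc)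
  also have "((\<lambda>w. w ^ k) has_contour_integral 0) (circlepath 0 r)"
    by (rule Cauchy_theorem_convex_simple[of _ UNIV]) (auto intro!: holomorphic_intros)
  then have "cint r (\<lambda>w. w ^ k) = 0" by (simp add: cint_def contour_integral_unique)
  finally show ?thesis using False by simp
qed

lemma frac_le_pos: "1 < a \<Longrightarrow> a \<le> x \<Longrightarrow> x \<le> b \<Longrightarrow> 1 / b \<le> 1 / x \<and> 1 / x \<le> 1 \<and> 1 / x \<le> 1 / a" for a b x :: real
  by (auto intro!: divide_left_mono)

locale ratio_orthonormal = orthonormal +
  assumes ratio: "\<And>K. closed K \<Longrightarrow> K \<subseteq> - E \<Longrightarrow>
     uniform_limit K (\<lambda>n z. poly (p n) z / poly (p (Suc n)) z) (\<lambda>z. 1 / Phi z) sequentially"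
begin

section \<open>Ratio asymptotics in the exterior of the disc\<close>

definition pw :: "nat \<Rightarrow> complex \<Rightarrow> complex" where "pw n w = poly (p n) (Psi w)"

text \<open>The factor \<open>deriv Psi\<close> makes the circle integrals of \<open>v\<close> those
  of \<open>biorthogonal\<close>.\<close>

definition v :: "nat \<Rightarrow> complex \<Rightarrow> complex" where "v n w = pw n w * deriv Psi w * sig n w"

lemma pw_hol: "pw n holomorphic_on {w. 1 < norm w}"
  unfolding pw_def by (rule Psi_comp_hol[OF poly_hol[of _ UNIV]]) auto

lemma v_hol: "v n holomorphic_on {w. 1 < norm w}"
  unfolding v_def by (intro holomorphic_intros pw_hol Psi_deriv_hol sig_hol)

lemma ann_sub: "1 < a \<Longrightarrow> ann a b \<subseteq> {w. 1 < norm w}"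
  by (auto simp: ann_def)

lemma compact_Psi_ann: "1 < a \<Longrightarrow> compact (Psi ` ann a b)"
  by (intro compact_continuous_image compact_ann continuous_on_subset[OF Psi_cont] ann_sub)

lemma pw_ratio:
  assumes a: "1 < a"
  shows "uniform_limit (ann a b) (\<lambda>n w. pw n w / pw (Suc n) w) (\<lambda>w. 1 / w) sequentially"
proof -
  have "uniform_limit (Psi ` ann a b) (\<lambda>n z. poly (p n) z / poly (p (Suc n)) z) (\<lambda>z. 1 / Phi z) sequentially"
    using compact_imp_closed[OF compact_Psi_ann[OF a]] a by (intro ratio) (auto simp: ann_def Psi_notin)
  then have "uniform_limit (ann a b) (\<lambda>n w. pw n w / pw (Suc n) w) (\<lambda>w. 1 / Phi (Psi w)) sequentially"
    by (simp add: uniform_limit_iff pw_def)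
  moreover have "Phi (Psi w) = w" if "w \<in> ann a b" for w using that a by (simp add: ann_def Phi_Psi)
  ultimately show ?thesis by (simp cong: uniform_limit_cong')
qed

text \<open>The quotients converge to 1/w, which is bounded away from 0 on the annulus. A quotient
  with zero numerator or zero denominator has the value 0, so neither vanishes from some n
  on.\<close>

lemma pw_nz:
  assumes a: "1 < a"
  shows "eventually (\<lambda>n. \<forall>w\<in>ann a b. pw n w \<noteq> 0) sequentially"
proof (cases "a \<le> b")
  case True
  then have b: "0 < b" using a by simp
  have "eventually (\<lambda>n. \<forall>w\<in>ann a b. 0 < norm (pw n w / pw (Suc n) w) \<and> norm (pw n w / pw (Suc n) w) < 2) sequentially"
    by (rule uniform_limit_eventually_bounds[OF pw_ratio[OF a], where c="1/b" and C=1])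
       (use a b in \<open>auto simp: ann_def norm_divide frac_le_pos\<close>)
  then show ?thesis by eventually_elim auto
next
  case False
  then show ?thesis by (simp add: ann_empty)
qed

lemma bounded_power_ann: "0 < a \<Longrightarrow> bounded ((\<lambda>w. w powi i) ` ann a b)"
  by (intro compact_imp_bounded compact_continuous_image compact_ann continuous_intros) (auto simp: ann_def)

text \<open>A telescoping product of i shifted ratios; the truncated subtraction affects only
  finitely many n.\<close>

lemma pw_down:
  assumes a: "1 < a"
  shows "uniform_limit (ann a b) (\<lambda>n w. pw (n - i) w / pw n w) (\<lambda>w. w powi (- int i)) sequentially"
proof (induction i)
  case 0
  have "eventually (\<lambda>n. \<forall>w\<in>ann a b. pw (n - 0) w / pw n w = w powi (- int 0)) sequentially"
    using pw_nz[OF a, of b] by eventually_elim auto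
  then show ?case
    by (intro uniform_limitI; eventually_elim) auto
next
  case (Suc i)
  have fl: "filterlim (\<lambda>n::nat. n - 1) sequentially sequentially"
    by (rule filterlim_minus_const_nat_at_top)
  have A: "uniform_limit (ann a b) (\<lambda>n w. pw (n - 1 - i) w / pw (n - 1) w) (\<lambda>w. w powi (- int i)) sequentially"
    using uniform_limit_shift[OF Suc fl] .
  have B: "uniform_limit (ann a b) (\<lambda>n w. pw (n - 1) w / pw (Suc (n - 1)) w) (\<lambda>w. 1 / w) sequentially"
    using uniform_limit_shift[OF pw_ratio[OF a] fl] .
  have bd: "bounded ((\<lambda>w. w powi (- int i)) ` ann a b)" "bounded ((\<lambda>w. 1 / w) ` ann a b)"
    using bounded_power_ann[of a "- int i" b] bounded_power_ann[of a "-1" b] a by (auto simp: power_int_minus divide_inverse)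
  have AB: "uniform_limit (ann a b) (\<lambda>n w. (pw (n - 1 - i) w / pw (n - 1) w) * (pw (n - 1) w / pw (Suc (n - 1)) w))
     (\<lambda>w. w powi (- int i) * (1 / w)) sequentially"
    by (rule uniform_lim_mult[OF A B bd])
  have ev: "eventually (\<lambda>n. \<forall>w\<in>ann a b. (pw (n - 1 - i) w / pw (n - 1) w) * (pw (n - 1) w / pw (Suc (n - 1)) w)
       = pw (n - Suc i) w / pw n w) sequentially"
    using eventually_compose_filterlim[OF pw_nz[OF a, of b] fl] eventually_gt_at_top[of 0]
    by eventually_elim auto
  have eq: "w powi (- int i) * (1 / w) = w powi (- int (Suc i))" if "w \<in> ann a b" for w
    using that a by (auto simp: ann_def power_int_minus field_simps simp del: of_nat_Suc)
  show ?case
    by (rule uniform_limit_cong[THEN iffD1, OF ev _ AB]) (use eq in auto)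
qed

text \<open>The reciprocal of \<open>pw_down\<close> at n + i, whose limit is at least b^(-i) in
  modulus on the annulus.\<close>

lemma pw_up:
  assumes a: "1 < a"
  shows "uniform_limit (ann a b) (\<lambda>n w. pw (n + i) w / pw n w) (\<lambda>w. w powi (int i)) sequentially"
proof (cases "a \<le> b")
  case True
  then have b: "0 < b" using a by simp
  have "uniform_limit (ann a b) (\<lambda>n w. pw ((n + i) - i) w / pw (n + i) w) (\<lambda>w. w powi (- int i)) sequentially"
    by (rule uniform_limit_shift[OF pw_down[OF a] filterlim_add_const_nat_at_top])
  then have D: "uniform_limit (ann a b) (\<lambda>n w. pw n w / pw (n + i) w) (\<lambda>w. w powi (- int i)) sequentially" by simp
  have "uniform_limit (ann a b) (\<lambda>n w. inverse (pw n w / pw (n + i) w)) (inverse \<circ> (\<lambda>w. w powi (- int i))) sequentially"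
  proof (rule uniform_lim_inverse[OF D, where b="inverse (b ^ i)"])
    fix w assume "w \<in> ann a b"
    then show "inverse (b ^ i) \<le> norm (w powi (- int i))"
      using a b by (auto simp: ann_def power_int_minus norm_inverse norm_power intro!: le_imp_inverse_le power_mono zero_less_power)
  qed (use b in auto)
  then show ?thesis by (simp add: o_def power_int_minus)
qed (simp add: ann_empty)

lemma sphere_ann: "sphere 0 r = ann r r"
  by (auto simp: ann_def)

text \<open>Replacing \<open>w powi i\<close> by \<open>pw (n + i) w / pw n w\<close> changes
  nothing in the limit and turns the moment into a biorthogonality integral of p_(n+i) against the
  n-th function of the second kind. So V has the Laurent moments of 1/w.\<close>

lemma v_moments:
  assumes g: "strict_mono (g :: nat \<Rightarrow> nat)" and r: "1 < r"
    and lim: "uniform_limit (sphere 0 r) (\<lambda>n. v (g n)) V sequentially"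
  shows "cint r (\<lambda>w. w powi i * V w) = (if i = 0 then 1 else 0)"
proof -
  \<comment> \<open>For n < -i the index is truncated at 0; the integrals are evaluated only where
    the index of the subsequence is at least -i.\<close>
  define q where "q n w = pw (nat (int n + i)) w / pw n w" for n w
  have cv: "continuous_on (sphere 0 r) (v n)" for n
    by (rule continuous_on_subset[OF holomorphic_on_imp_continuous_on[OF v_hol]]) (use r in auto)
  have cp: "continuous_on (sphere 0 r) (pw n)" for n
    by (rule continuous_on_subset[OF holomorphic_on_imp_continuous_on[OF pw_hol]]) (use r in auto)
  have gl: "filterlim g sequentially sequentially" using g by (rule filterlim_subseq)
  have q: "uniform_limit (sphere 0 r) q (\<lambda>w. w powi i) sequentially"
  proof (cases "i \<ge> 0")
    case True
    then show ?thesis using pw_up[OF r, where b=r and i="nat i"]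
      by (simp add: q_def[abs_def] sphere_ann nat_add_distrib)
  next
    case False
    then have "nat (int n + i) = n - nat (- i)" for n by linarith
    then show ?thesis using pw_down[OF r, where b=r and i="nat (- i)"] False
      by (simp add: q_def[abs_def] sphere_ann)
  qed
  have qg: "uniform_limit (sphere 0 r) (\<lambda>n. q (g n)) (\<lambda>w. w powi i) sequentially"
    by (rule uniform_limit_shift[OF q gl])
  have cV: "continuous_on (sphere 0 r) V"
    by (rule uniform_limit_theorem[OF _ lim]) (auto simp: cv)
  have qv: "uniform_limit (sphere 0 r) (\<lambda>n w. q (g n) w * v (g n) w) (\<lambda>w. w powi i * V w) sequentially"
    by (rule uniform_lim_mult[OF qg lim])
       (use bounded_power_ann[of r i r] r compact_imp_bounded[OF compact_continuous_image[OF cV compact_sphere]] in \<open>auto simp: sphere_ann\<close>)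
  have nz: "eventually (\<lambda>n. \<forall>w\<in>sphere 0 r. pw (g n) w \<noteq> 0) sequentially"
    unfolding sphere_ann by (rule eventually_compose_filterlim[OF pw_nz[OF r] gl])
  have "eventually (\<lambda>n. continuous_on (sphere 0 r) (\<lambda>w. q (g n) w * v (g n) w)) sequentially"
    using nz unfolding q_def by eventually_elim (auto intro!: continuous_intros cv cp)
  then have L: "(\<lambda>n. cint r (\<lambda>w. q (g n) w * v (g n) w)) \<longlonglongrightarrow> cint r (\<lambda>w. w powi i * V w)"
    using qv r by (intro cint_uniform_limit) auto
  have "eventually (\<lambda>n. cint r (\<lambda>w. q (g n) w * v (g n) w) = (if i = 0 then 1 else 0)) sequentially"
    using nz eventually_compose_filterlim[OF eventually_ge_at_top[of "nat (- i)"] gl]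
  proof eventually_elim
    case (elim n)
    have "cint r (\<lambda>w. q (g n) w * v (g n) w) =
      cint r (\<lambda>w. poly (p (nat (int (g n) + i))) (Psi w) * deriv Psi w * sig (g n) w)"
      using elim r by (intro cint_cong) (auto simp: q_def v_def pw_def)
    also have "\<dots> = (if nat (int (g n) + i) = g n then 1 else 0)" by (rule biorthogonal[OF r])
    also have "nat (int (g n) + i) = g n \<longleftrightarrow> i = 0" using elim(2) by linarith
    finally show ?case .
  qed
  then have "(\<lambda>n. cint r (\<lambda>w. q (g n) w * v (g n) w)) \<longlonglongrightarrow> (if i = 0 then 1 else 0)"
    by (rule tendsto_eventually)
  with L show ?thesis by (rule LIMSEQ_unique)
qed

lemma v_bounded:
  assumes "compact K" "K \<subseteq> {w. 1 < norm w}"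
  shows "\<exists>B. \<forall>n. \<forall>w\<in>K. norm (v n w) \<le> B"
proof -
  have "compact (Psi ` K)" by (intro compact_continuous_image continuous_on_subset[OF Psi_cont] assms)
  moreover have "Psi ` K \<inter> E = {}" using assms(2) Psi_notin by auto
  ultimately obtain d where d: "d > 0" "\<And>z \<zeta>. z \<in> Psi ` K \<Longrightarrow> \<zeta> \<in> E \<Longrightarrow> d \<le> dist z \<zeta>"
    using separate_compact_closed[OF _ closed_E] by metis
  have "compact (deriv Psi ` K)"
    by (intro compact_continuous_image continuous_on_subset[OF holomorphic_on_imp_continuous_on[OF Psi_deriv_hol]] assms)
  then obtain B where B: "\<And>w. w \<in> K \<Longrightarrow> norm (deriv Psi w) \<le> B"
    using compact_imp_bounded by (fastforce simp: bounded_iff)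
  have "norm (v n w) \<le> 1 / d * \<bar>B\<bar>" if "w \<in> K" for n w
  proof -
    have "norm (pw n w * sig n w) \<le> 1 / d" unfolding pw_def sig_def
      using d that by (intro p_times_s_bound) (auto simp: dist_norm)
    moreover have "norm (deriv Psi w) \<le> \<bar>B\<bar>" using B[OF that] by linarith
    ultimately have "norm (pw n w * sig n w) * norm (deriv Psi w) \<le> 1 / d * \<bar>B\<bar>"
      using d by (intro mult_mono) auto
    then show ?thesis by (simp add: v_def norm_mult mult_ac)
  qed
  then show ?thesis by blast
qed

text \<open>Montel's theorem: the biorthogonality relations determine the Laurent coefficients of every
  limit function.\<close>

theorem v_limit:
  assumes a: "1 < a"
  shows "uniform_limit (ann a b) v (\<lambda>w. 1 / w) sequentially"
proof (rule ccontr)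
  assume "\<not> ?thesis"
  then obtain e where e: "e > 0" "\<not> eventually (\<lambda>n. \<forall>w\<in>ann a b. dist (v n w) (1 / w) < e) sequentially"
    unfolding uniform_limit_iff by blast
  obtain g1 where g1: "strict_mono (g1 :: nat \<Rightarrow> nat)" "\<And>n. \<not> (\<forall>w\<in>ann a b. dist (v (g1 n) w) (1 / w) < e)"
    using not_eventually_sequentiallyD[OF e(2)] by blast
  define \<H> where "\<H> = range v"
  obtain V g2 where V: "V holomorphic_on {w. 1 < norm w}" "strict_mono (g2 :: nat \<Rightarrow> nat)"
    "\<And>K. compact K \<Longrightarrow> K \<subseteq> {w. 1 < norm w} \<Longrightarrow> uniform_limit K ((\<lambda>n. v (g1 n)) \<circ> g2) V sequentially"
  proof (rule Montel[of "{w. 1 < norm w}" \<H> "\<lambda>n. v (g1 n)"])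
    show "open {w::complex. 1 < norm w}" by (rule open_exterior)
    show "\<And>h. h \<in> \<H> \<Longrightarrow> h holomorphic_on {w. 1 < norm w}" using v_hol by (auto simp: \<H>_def)
    show "\<exists>B. \<forall>h\<in>\<H>. \<forall>z\<in>K. norm (h z) \<le> B" if "compact K" "K \<subseteq> {w. 1 < norm w}" for K
      using v_bounded[OF that] by (auto simp: \<H>_def)
    show "range (\<lambda>n. v (g1 n)) \<subseteq> \<H>" by (auto simp: \<H>_def)
  qed blast
  have g: "strict_mono (\<lambda>n. g1 (g2 n))" using g1(1) V(2) by (simp add: strict_mono_def)
  have V0: "V w = 1 / w" if w: "1 < norm w" for w
  proof -
    have "V w - 1 / w = 0"
    proof (rule laurent_unique[of "\<lambda>w. V w - 1 / w" 1])
      show "(\<lambda>w. V w - 1 / w) holomorphic_on {w. 1 < norm w}"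
        by (intro holomorphic_intros V) auto
      fix r :: real and i :: int assume r: "1 < r"
      have cV: "continuous_on (sphere 0 r) V"
        by (rule continuous_on_subset[OF holomorphic_on_imp_continuous_on[OF V(1)]]) (use r in auto)
      have "uniform_limit (sphere 0 r) (\<lambda>n. v (g1 (g2 n))) V sequentially"
      proof -
        have "sphere 0 r \<subseteq> {w::complex. 1 < norm w}" using r by auto
        from V(3)[OF compact_sphere this] show ?thesis by (simp add: o_def)
      qed
      then have m: "cint r (\<lambda>w. w powi i * V w) = (if i = 0 then 1 else 0)"
        by (rule v_moments[OF g r])
      have "cint r (\<lambda>w. w powi i * (V w - 1 / w)) = cint r (\<lambda>w. w powi i * V w - w powi i * (1 / w))"
        by (simp add: right_diff_distrib)
      also have "\<dots> = cint r (\<lambda>w. w powi i * V w) - cint r (\<lambda>w. w powi i * (1 / w))"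
        using r by (intro cint_diff) (auto intro!: continuous_intros cV)
      also have "\<dots> = 0" unfolding m using r by (subst cint_powi) auto
      finally show "cint r (\<lambda>w. w powi i * (V w - 1 / w)) = 0" .
    qed (use w in auto)
    then show ?thesis by simp
  qed
  have "uniform_limit (ann a b) ((\<lambda>n. v (g1 n)) \<circ> g2) V sequentially"
    by (rule V(3)[OF compact_ann ann_sub[OF a]])
  then have "eventually (\<lambda>n. \<forall>w\<in>ann a b. dist (v (g1 (g2 n)) w) (V w) < e) sequentially"
    using e(1) by (auto simp: uniform_limit_iff)
  then obtain n where n: "\<forall>w\<in>ann a b. dist (v (g1 (g2 n)) w) (V w) < e"
    by (auto simp: eventually_sequentially)
  have "V w = 1 / w" if "w \<in> ann a b" for w using V0[of w] that a by (simp add: ann_def)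
  with n g1(2)[of "g2 n"] show False by auto
qed

text \<open>\<open>v n\<close> tends to 1/w, which does not vanish, and contains
  \<open>sig n\<close> as a factor.\<close>

lemma sig_nz:
  assumes a: "1 < a"
  shows "eventually (\<lambda>n. \<forall>w\<in>ann a b. sig n w \<noteq> 0) sequentially"
proof (cases "a \<le> b")
  case True
  then have b: "0 < b" using a by simp
  have "eventually (\<lambda>n. \<forall>w\<in>ann a b. 0 < norm (v n w) \<and> norm (v n w) < 2) sequentially"
    by (rule uniform_limit_eventually_bounds[OF v_limit[OF a], where c="1/b" and C=1])
       (use a b in \<open>auto simp: ann_def norm_divide frac_le_pos\<close>)
  then show ?thesis by eventually_elim (auto simp: v_def)
qed (simp add: ann_empty)

text \<open>v_(n+i)/v_n tends to 1, the factor \<open>deriv Psi\<close> cancels, and the remaining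
  quotient of the \<open>pw\<close> is known from \<open>pw_down\<close>.\<close>

theorem sig_ratio:
  assumes a: "1 < a"
  shows "uniform_limit (ann a b) (\<lambda>n w. sig (n + i) w / sig n w) (\<lambda>w. w powi (- int i)) sequentially"
proof (cases "a \<le> b")
  case True
  then have b: "0 < b" using a by simp
  have bd: "bounded ((\<lambda>w. w powi k) ` ann a b)" for k using bounded_power_ann[of a k b] a by simp
  have bd1: "bounded ((\<lambda>w. 1 / w) ` ann a b)" using bd[of "-1"] by (simp add: power_int_minus divide_inverse)
  have inv: "1 / b \<le> norm (1 / w)" if "w \<in> ann a b" for w
    using that a by (auto simp: ann_def norm_divide frac_le_pos)
  have V: "uniform_limit (ann a b) (\<lambda>n. v (n + i)) (\<lambda>w. 1 / w) sequentially"
    by (rule uniform_limit_shift[OF v_limit[OF a] filterlim_add_const_nat_at_top])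
  have Q: "uniform_limit (ann a b) (\<lambda>n w. v (n + i) w / v n w) (\<lambda>w. (1 / w) / (1 / w)) sequentially"
    by (rule uniform_lim_divide[OF V v_limit[OF a] bd1 inv]) (use b in auto)
  have D: "uniform_limit (ann a b) (\<lambda>n w. pw ((n + i) - i) w / pw (n + i) w) (\<lambda>w. w powi (- int i)) sequentially"
    by (rule uniform_limit_shift[OF pw_down[OF a] filterlim_add_const_nat_at_top])
  have one: "(\<lambda>w. (1 / w) / (1 / w)) ` ann a b \<subseteq> {1}" using a by (auto simp: ann_def)
  have QD: "uniform_limit (ann a b) (\<lambda>n w. (v (n + i) w / v n w) * (pw ((n + i) - i) w / pw (n + i) w))
     (\<lambda>w. ((1 / w) / (1 / w)) * w powi (- int i)) sequentially"
    by (rule uniform_lim_mult[OF Q D _ bd]) (rule bounded_subset[OF _ one], simp)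
  have fl: "filterlim (\<lambda>n. n + i) sequentially sequentially" by (rule filterlim_add_const_nat_at_top)
  have "eventually (\<lambda>n. \<forall>w\<in>ann a b. (v (n + i) w / v n w) * (pw ((n + i) - i) w / pw (n + i) w)
       = sig (n + i) w / sig n w) sequentially"
    using pw_nz[OF a, of b] eventually_compose_filterlim[OF pw_nz[OF a, of b] fl]
  proof eventually_elim
    case (elim n)
    show ?case
    proof
      fix w assume w: "w \<in> ann a b"
      then have "deriv Psi w \<noteq> 0" using a by (intro Psi_deriv_nz) (simp add: ann_def)
      then show "(v (n + i) w / v n w) * (pw ((n + i) - i) w / pw (n + i) w) = sig (n + i) w / sig n w"
        using elim w by (simp add: v_def)
    qed
  qed
  then show ?thesis
    by (rule uniform_limit_cong[THEN iffD1, OF _ _ QD]) (use a in \<open>auto simp: ann_def\<close>)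
qed (simp add: ann_empty)

section \<open>Geometric bounds for the two families\<close>

lemma sig_step:
  assumes a: "1 < a" and q: "1 / a < q"
  shows "eventually (\<lambda>n. \<forall>w\<in>ann a b. sig n w \<noteq> 0 \<and> norm (sig (Suc n) w) \<le> q * norm (sig n w)) sequentially"
proof -
  have "eventually (\<lambda>n. \<forall>w\<in>ann a b. - 1 < norm (sig (n + 1) w / sig n w) \<and> norm (sig (n + 1) w / sig n w) < q) sequentially"
    by (rule uniform_limit_eventually_bounds[OF sig_ratio[OF a], where c=0 and C="1/a"])
       (use a q in \<open>auto simp: ann_def power_int_minus norm_inverse inverse_eq_divide norm_divide frac_le_pos\<close>)
  then show ?thesis using sig_nz[OF a, of b]
  proof eventually_elim
    case (elim n)
    show ?case
    proof
      fix w assume w: "w \<in> ann a b"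
      then have "norm (sig (n + 1) w / sig n w) \<le> q" "sig n w \<noteq> 0" using elim by auto
      then show "sig n w \<noteq> 0 \<and> norm (sig (Suc n) w) \<le> q * norm (sig n w)"
        by (simp add: norm_divide field_simps)
    qed
  qed
qed

text \<open>A bound relative to \<open>sig n\<close> at the same point, simultaneous in k. It
  controls the functions \<open>sig (n + k) / sig n\<close>; combining \<open>sig_upper\<close> with
  \<open>sig_lower\<close> instead would lose an exponential factor in n.\<close>

lemma sig_tail:
  assumes a: "1 < a" and q: "1 / a < q"
  shows "eventually (\<lambda>n. \<forall>k. \<forall>w\<in>ann a b. sig n w \<noteq> 0 \<and> norm (sig (n + k) w) \<le> q ^ k * norm (sig n w)) sequentially"
proof -
  have q0: "0 < q" using a q by (smt (verit) divide_pos_pos)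
  obtain N where N: "\<And>n w. n \<ge> N \<Longrightarrow> w \<in> ann a b \<Longrightarrow> sig n w \<noteq> 0 \<and> norm (sig (Suc n) w) \<le> q * norm (sig n w)"
    using sig_step[OF a q, of b] by (auto simp: eventually_sequentially)
  have "norm (sig (n + k) w) \<le> q ^ k * norm (sig n w)" if "n \<ge> N" "w \<in> ann a b" for n k w
  proof (induction k)
    case (Suc k)
    have "norm (sig (n + Suc k) w) \<le> q * norm (sig (n + k) w)" using N[of "n + k" w] that by simp
    also have "\<dots> \<le> q * (q ^ k * norm (sig n w))" using Suc q0 by (intro mult_left_mono) auto
    finally show ?case by (simp add: mult_ac)
  qed simp
  then show ?thesis using N unfolding eventually_sequentially by blast
qed

lemma sig_upper:
  assumes a: "1 < a" and q: "1 / a < q"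
  obtains C where "C > 0" "\<And>n w. w \<in> ann a b \<Longrightarrow> norm (sig n w) \<le> C * q ^ n"
proof (rule geometric_growth[of "ann a b" "\<lambda>n w. norm (sig n w)" q])
  have "compact (sig n ` ann a b)" for n
    by (intro compact_continuous_image compact_ann
        continuous_on_subset[OF holomorphic_on_imp_continuous_on[OF sig_hol]] ann_sub a)
  then show "\<exists>B. \<forall>w\<in>ann a b. norm (sig n w) \<le> B" for n
    using compact_imp_bounded[of "sig n ` ann a b"] by (auto simp: bounded_iff)
  show "0 < q" using a q by (smt (verit) divide_pos_pos)
  show "eventually (\<lambda>n. \<forall>w\<in>ann a b. norm (sig (Suc n) w) \<le> q * norm (sig n w)) sequentially"
    using sig_step[OF a q, of b] by eventually_elim auto
qed (use that in blast)

text \<open>The price of dividing by \<open>sig n\<close>: up to an arbitrarily small loss in the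
  base, it can shrink no faster than b^(-n) on the annulus.\<close>

lemma sig_lower:
  assumes a: "1 < a" "a \<le> b" and q: "0 < q" "q < 1 / b"
  obtains c where "c > 0" "eventually (\<lambda>n. \<forall>w\<in>ann a b. c * q ^ n \<le> norm (sig n w)) sequentially"
proof -
  have "eventually (\<lambda>n. \<forall>w\<in>ann a b. q < norm (sig (n + 1) w / sig n w) \<and> norm (sig (n + 1) w / sig n w) < 2) sequentially"
    by (rule uniform_limit_eventually_bounds[OF sig_ratio[OF a(1)], where c="1/b" and C=1])
       (use a q in \<open>auto simp: ann_def power_int_minus norm_inverse inverse_eq_divide norm_divide frac_le_pos divide_le_eq_1\<close>)
  then have "eventually (\<lambda>n. \<forall>w\<in>ann a b. q * norm (sig n w) \<le> norm (sig (Suc n) w) \<and> sig n w \<noteq> 0) sequentially"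
    using sig_nz[OF a(1), of b]
  proof eventually_elim
    case (elim n)
    show ?case
    proof
      fix w assume w: "w \<in> ann a b"
      then have "q \<le> norm (sig (n + 1) w / sig n w)" "sig n w \<noteq> 0" using elim by auto
      then show "q * norm (sig n w) \<le> norm (sig (Suc n) w) \<and> sig n w \<noteq> 0"
        by (simp add: norm_divide field_simps)
    qed
  qed
  then obtain N where N: "\<And>n w. n \<ge> N \<Longrightarrow> w \<in> ann a b \<Longrightarrow> q * norm (sig n w) \<le> norm (sig (Suc n) w) \<and> sig n w \<noteq> 0"
    by (auto simp: eventually_sequentially)
  have ne: "ann a b \<noteq> {}" using a by (auto simp: ann_def intro!: exI[of _ "of_real a"])
  have "continuous_on (ann a b) (\<lambda>w. norm (sig N w))"
    by (intro continuous_intros continuous_on_subset[OF holomorphic_on_imp_continuous_on[OF sig_hol]] ann_sub a)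
  then obtain w0 where w0: "w0 \<in> ann a b" "\<And>w. w \<in> ann a b \<Longrightarrow> norm (sig N w0) \<le> norm (sig N w)"
    using continuous_attains_inf[OF compact_ann ne] by metis
  define c where "c = norm (sig N w0) / q ^ N"
  have c: "c > 0" using N[of N w0] w0 q by (simp add: c_def)
  have "c * q ^ (N + k) \<le> norm (sig (N + k) w)" if "w \<in> ann a b" for k w
  proof (induction k)
    case 0
    then show ?case using w0(2)[OF that] q by (simp add: c_def)
  next
    case (Suc k)
    have "c * q ^ (N + Suc k) = q * (c * q ^ (N + k))" by simp
    also have "\<dots> \<le> q * norm (sig (N + k) w)" using Suc q by (intro mult_left_mono) auto
    also have "\<dots> \<le> norm (sig (N + Suc k) w)" using N[of "N + k" w] that by simp
    finally show ?case .
  qed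
  then have "c * q ^ n \<le> norm (sig n w)" if "w \<in> ann a b" "n \<ge> N" for n w
    using that by (metis le_add_diff_inverse)
  then show ?thesis using that[OF c] by (auto simp: eventually_sequentially)
qed

text \<open>Ratio asymptotics give the growth on the level curve, and the maximum principle carries
  it inside.\<close>

lemma p_upper:
  assumes r: "1 < r" and q: "r < q"
  obtains C where "C > 0" "\<And>n z. z \<in> Dcl r \<Longrightarrow> norm (poly (p n) z) \<le> C * q ^ n"
proof -
  have up: "uniform_limit (ann r r) (\<lambda>n w. pw (n + 1) w / pw n w) (\<lambda>w. w powi (int 1)) sequentially"
    by (rule pw_up[OF r])
  have "eventually (\<lambda>n. \<forall>w\<in>ann r r. - 1 < norm (pw (n + 1) w / pw n w) \<and> norm (pw (n + 1) w / pw n w) < q) sequentially"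
    by (rule uniform_limit_eventually_bounds[OF up, where c=0 and C=r]) (use r q in \<open>auto simp: ann_def\<close>)
  then have ev: "eventually (\<lambda>n. \<forall>w\<in>ann r r. norm (pw (Suc n) w) \<le> q * norm (pw n w)) sequentially"
    using pw_nz[OF r, of r]
  proof eventually_elim
    case (elim n)
    show ?case
    proof
      fix w assume w: "w \<in> ann r r"
      then have "norm (pw (n + 1) w / pw n w) \<le> q" "pw n w \<noteq> 0" using elim by auto
      then show "norm (pw (Suc n) w) \<le> q * norm (pw n w)" by (simp add: norm_divide field_simps)
    qed
  qed
  obtain C where C: "C > 0" "\<And>n w. w \<in> ann r r \<Longrightarrow> norm (pw n w) \<le> C * q ^ n"
  proof (rule geometric_growth[of "ann r r" "\<lambda>n w. norm (pw n w)" q])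
    have "compact (pw n ` ann r r)" for n
      by (intro compact_continuous_image compact_ann
          continuous_on_subset[OF holomorphic_on_imp_continuous_on[OF pw_hol]] ann_sub r)
    then show "\<exists>B. \<forall>w\<in>ann r r. norm (pw n w) \<le> B" for n
      using compact_imp_bounded[of "pw n ` ann r r"] by (auto simp: bounded_iff)
  qed (use ev r q in auto)
  show ?thesis
  proof (rule that[OF C(1)])
    fix n z assume z: "z \<in> Dcl r"
    show "norm (poly (p n) z) \<le> C * q ^ n"
    proof (rule maximum_modulus_frontier[where S="Dcl r" and f="poly (p n)" and \<xi>=z])
      show "bounded (Dcl r)" by (rule Dcl_bounded)
      fix z assume z: "z \<in> frontier (Dcl r)"
      have "frontier (Dcl r) \<subseteq> Dcl r - Dop r"
        unfolding frontier_def using compact_imp_closed[OF compact_Dcl[OF r]]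
          interior_maximal[OF Dcl_Dop(2) open_Dop[OF r]] by auto
      then have "z \<notin> E" "norm (Phi z) = r" using z by (auto simp: Dcl_def Dop_def)
      then show "norm (poly (p n) z) \<le> C * q ^ n"
        using C(2)[of "Phi z" n] by (simp add: ann_def pw_def Psi_Phi)
    qed (use z in \<open>auto intro!: continuous_intros poly_hol\<close>)
  qed
qed

end

section \<open>Expansion in orthonormal polynomials\<close>

context ratio_orthonormal
begin

text \<open>For large |z| the Taylor polynomial t of the kernel 1/(z - \<zeta>) leaves a tiny
  remainder g. The partial sum reproduces t exactly, since its degree is below N, so the error is g
  minus the partial sum of its own expansion. The threshold on |z| makes g at most
  (1/(2\<sigma>))^N, which leaves (1/2)^N after the growth \<sigma>^N of the polynomials.\<close>

lemma kernel_partial_sum_bound: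
  assumes R0: "1 \<le> R0" "E \<subseteq> cball 0 R0" "norm \<zeta> \<le> R0" and s: "1 \<le> \<sigma>"
    and C: "0 \<le> C" "\<And>n. norm (poly (p n) \<zeta>) \<le> C * \<sigma> ^ n" and z: "2 * R0 * \<sigma> \<le> norm z" and N: "N \<ge> 1"
  shows "norm (1 / (z - \<zeta>) - (\<Sum>j<N. s j z * poly (p j) \<zeta>)) \<le> (1/2) ^ N + real N * (1/2) ^ N * (mass * C)"
proof -
  have R0s: "R0 \<le> R0 * \<sigma>" using R0 s by simp
  have zR: "2 * R0 \<le> norm z" using R0s z by simp
  then have z0: "z \<noteq> 0" using R0 by auto
  have zn: "1 \<le> norm (z - \<xi>)" if "norm \<xi> \<le> R0" for \<xi>
    using norm_triangle_ineq2[of z \<xi>] that zR R0 by linarith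
  define t where "t = (\<Sum>k<N. monom (1 / z ^ Suc k) k)"
  have tval: "poly t \<xi> = (\<Sum>k<N. \<xi> ^ k / z ^ Suc k)" for \<xi>
    by (simp add: t_def poly_sum poly_monom mult.commute)
  have tdeg: "degree t \<le> N - 1"
    unfolding t_def using N by (intro degree_sum_le) (auto intro: order_trans[OF degree_monom_le])
  define g where "g \<xi> = 1 / (z - \<xi>) - poly t \<xi>" for \<xi>
  have gb: "norm (g \<xi>) \<le> (1 / (2 * \<sigma>)) ^ N" if \<xi>: "norm \<xi> \<le> R0" for \<xi>
  proof -
    have "z \<noteq> \<xi>" using zn[OF \<xi>] by auto
    then have "g \<xi> = (\<xi> / z) ^ N / (z - \<xi>)"
      unfolding g_def tval using geometric_kernel[of z \<xi> N] z0 by auto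
    then have "norm (g \<xi>) = (norm \<xi> / norm z) ^ N / norm (z - \<xi>)" by (simp add: norm_divide norm_power)
    also have "\<dots> \<le> (norm \<xi> / norm z) ^ N / 1"
      using zn[OF \<xi>] by (intro divide_left_mono) auto
    also have "(norm \<xi> / norm z) ^ N / 1 \<le> (1 / (2 * \<sigma>)) ^ N"
    proof -
      have "norm \<xi> * (2 * \<sigma>) \<le> R0 * (2 * \<sigma>)" using \<xi> s by (intro mult_right_mono) auto
      then have "norm \<xi> * (2 * \<sigma>) \<le> norm z" using z by (simp add: mult_ac)
      then have "norm \<xi> / norm z \<le> 1 / (2 * \<sigma>)" using z0 s by (simp add: field_simps)
      then show ?thesis by (simp add: power_mono)
    qed
    finally show ?thesis .
  qed
  have zE: "z - \<xi> \<noteq> 0" if "\<xi> \<in> E" for \<xi> using zn[of \<xi>] that R0 by auto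
  have cg: "continuous_on E g" unfolding g_def using zE by (auto intro!: continuous_intros)
  have ipf: "s j z = ip g j + ip (poly t) j" for j
  proof -
    have "ip (\<lambda>\<xi>. g \<xi> + poly t \<xi>) j = ip g j + ip (poly t) j"
      by (intro ip_add cg continuous_intros)
    then show ?thesis by (simp add: s_def g_def)
  qed
  have tz: "poly t \<zeta> = (\<Sum>j<N. ip (poly t) j * poly (p j) \<zeta>)"
  proof -
    have "{..N - 1} = {..<N}" using N by auto
    then show ?thesis using poly_expand_eval[OF tdeg, of \<zeta>] by simp
  qed
  have "1 / (z - \<zeta>) - (\<Sum>j<N. s j z * poly (p j) \<zeta>) = g \<zeta> - (\<Sum>j<N. ip g j * poly (p j) \<zeta>)"
    using tz by (simp add: ipf g_def distrib_right sum.distrib)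
  also have "norm \<dots> \<le> norm (g \<zeta>) + norm (\<Sum>j<N. ip g j * poly (p j) \<zeta>)"
    by (rule norm_triangle_ineq4)
  also have "norm (\<Sum>j<N. ip g j * poly (p j) \<zeta>) \<le> (\<Sum>j<N. (1/2) ^ N * (mass * C))"
  proof (rule sum_norm_le)
    fix j assume j: "j \<in> {..<N}"
    have "norm (ip g j) \<le> (1 / (2 * \<sigma>)) ^ N * mass"
      using R0 gb by (intro norm_ip_le cg) auto
    moreover have "norm (poly (p j) \<zeta>) \<le> C * \<sigma> ^ N"
      using C(2)[of j] mult_left_mono[OF power_increasing[of j N \<sigma>] C(1)] j s by fastforce
    ultimately have "norm (ip g j) * norm (poly (p j) \<zeta>) \<le> ((1 / (2 * \<sigma>)) ^ N * mass) * (C * \<sigma> ^ N)"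
      using s mass_pos by (intro mult_mono) auto
    also have "\<dots> = (1/2) ^ N * (mass * C)" using s by (simp add: power_mult_distrib power_divide)
    finally show "norm (ip g j * poly (p j) \<zeta>) \<le> (1/2) ^ N * (mass * C)" by (simp add: norm_mult)
  qed
  also have "norm (g \<zeta>) \<le> (1/2) ^ N"
    using gb[OF R0(3)] s by (intro order_trans[OF gb[OF R0(3)]] power_mono) (auto simp: field_simps)
  finally show ?thesis by simp
qed

text \<open>The series converges locally uniformly for |w| > r, because the decay of
  \<open>sig j\<close> beats the growth of \<open>p j\<close>. Its sum is known directly only for
  very large w, from \<open>kernel_partial_sum_bound\<close>; the identity theorem on the connected
  exterior extends the formula inward.\<close>

theorem kernel_expansion:
  assumes r: "1 < r" and \<zeta>: "\<zeta> \<in> Dcl r" and a: "r < a"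
  shows "uniform_limit (ann a b) (\<lambda>N w. \<Sum>j<N. sig j w * poly (p j) \<zeta>) (\<lambda>w. 1 / (Psi w - \<zeta>)) sequentially"
proof -
  define f where "f j w = sig j w * poly (p j) \<zeta>" for j w
  define X where "X w = (\<Sum>j. f j w)" for w
  have ul: "uniform_limit (ann a b) (\<lambda>N w. \<Sum>j<N. f j w) X sequentially" if a: "r < a" for a b
  proof -
    define \<sigma> where "\<sigma> = (r + a) / 2"
    have \<sigma>: "r < \<sigma>" "\<sigma> < a" "0 < \<sigma>" "1 < a" using a r by (auto simp: \<sigma>_def)
    \<comment> \<open>A rate above the decay 1/a of \<open>sig\<close> and below 1/\<sigma>, so that
      \<open>q * \<sigma> < 1\<close> makes the dominating series geometric.\<close>
    define q where "q = (1 / a + 1 / \<sigma>) / 2"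
    have "1 / a < 1 / \<sigma>" using \<sigma> by (simp add: field_simps)
    then have q: "1 / a < q" "q < 1 / \<sigma>" by (auto simp: q_def)
    obtain C1 where C1: "C1 > 0" "\<And>n w. w \<in> ann a b \<Longrightarrow> norm (sig n w) \<le> C1 * q ^ n"
      using sig_upper[OF \<sigma>(4) q(1)] by metis
    obtain C2 where C2: "C2 > 0" "\<And>n z. z \<in> Dcl r \<Longrightarrow> norm (poly (p n) z) \<le> C2 * \<sigma> ^ n"
      using p_upper[OF r \<sigma>(1)] by metis
    have q0: "0 < q" using q \<sigma> by (smt (verit) divide_pos_pos)
    have q\<sigma>: "q * \<sigma> < 1" using q \<sigma> by (simp add: field_simps)
    show ?thesis unfolding X_def
    proof (rule Weierstrass_m_test)
      fix n w assume w: "w \<in> ann a b"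
      have "norm (f n w) \<le> (C1 * q ^ n) * (C2 * \<sigma> ^ n)"
        unfolding f_def norm_mult using C1 C2 \<zeta> w q0 by (intro mult_mono) auto
      then show "norm (f n w) \<le> C1 * C2 * (q * \<sigma>) ^ n" by (simp add: power_mult_distrib mult_ac)
    next
      show "summable (\<lambda>n. C1 * C2 * (q * \<sigma>) ^ n)"
        using q0 \<sigma> q\<sigma> by (intro summable_mult summable_geometric) auto
    qed
  qed
  have sub1: "{w::complex. r < norm w} \<subseteq> {w. 1 < norm w}" using r by auto
  have fhol: "f j holomorphic_on {w. r < norm w}" for j
    unfolding f_def by (intro holomorphic_intros holomorphic_on_subset[OF sig_hol sub1])
  have Xhol: "X holomorphic_on {w. r < norm w}"
  proof (rule holomorphic_uniform_sequence[OF open_exterior, where f="\<lambda>N w. \<Sum>j<N. f j w"])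
    show "(\<lambda>w. \<Sum>j<N. f j w) holomorphic_on {w. r < norm w}" for N
      by (intro holomorphic_intros fhol)
    fix x :: complex assume x: "x \<in> {w. r < norm w}"
    define d where "d = (norm x - r) / 2"
    have d: "d > 0" using x by (simp add: d_def)
    have *: "\<bar>norm w - norm x\<bar> \<le> d" if "w \<in> cball x d" for w
      using that norm_triangle_ineq3[of w x] by (simp add: dist_norm norm_minus_commute)
    have sub: "cball x d \<subseteq> ann (norm x - d) (norm x + d)"
    proof
      fix w assume "w \<in> cball x d"
      from *[OF this] show "w \<in> ann (norm x - d) (norm x + d)" by (auto simp: ann_def)
    qed
    have rx: "r < norm x - d" using x by (simp add: d_def field_simps)
    have "cball x d \<subseteq> {w. r < norm w}" using sub rx by (force simp: ann_def)
    then show "\<exists>d>0. cball x d \<subseteq> {w. r < norm w} \<and>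
        uniform_limit (cball x d) (\<lambda>N w. \<Sum>j<N. f j w) X sequentially"
      using d uniform_limit_on_subset[OF ul[OF rx] sub] by blast
  qed
  have ne: "Psi w - \<zeta> \<noteq> 0" if "r < norm w" for w
    using \<zeta> that r Psi_in_Dcl[of w r] by auto
  define \<sigma> where "\<sigma> = r + 1"
  have \<sigma>: "r < \<sigma>" "1 \<le> \<sigma>" using r by (auto simp: \<sigma>_def)
  obtain C where C: "C > 0" "\<And>n z. z \<in> Dcl r \<Longrightarrow> norm (poly (p n) z) \<le> C * \<sigma> ^ n"
    using p_upper[OF r \<sigma>(1)] by metis
  obtain R1 where R1: "E \<subseteq> cball 0 R1"
    using compact_imp_bounded[OF compact_E] by (auto simp: bounded_iff subset_iff)
  define R0 where "R0 = max 1 (max R1 (norm \<zeta>))"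
  have R0: "1 \<le> R0" "E \<subseteq> cball 0 R0" "norm \<zeta> \<le> R0" using R1 by (auto simp: R0_def)
  obtain M where M: "\<And>w. M \<le> norm w \<Longrightarrow> 2 * R0 * \<sigma> \<le> norm (Psi w)"
    using eventually_norm_ge[OF Psi_at_infinity, of "2 * R0 * \<sigma>"] by (auto simp: eventually_at_infinity)
  have large: "X w = 1 / (Psi w - \<zeta>)" if w: "M \<le> norm w" "r < norm w" for w
  proof -
    have "(\<lambda>N. (1/2) ^ N + real N * (1/2) ^ N * (mass * C)) \<longlonglongrightarrow> 0 + 0 * (mass * C)"
      by (intro tendsto_intros LIMSEQ_power_zero lim_n_over_pown[of "2::real", simplified] powser_times_n_limit_0) auto
    moreover have "eventually (\<lambda>N. norm (1 / (Psi w - \<zeta>) - (\<Sum>j<N. f j w))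
       \<le> (1/2) ^ N + real N * (1/2) ^ N * (mass * C)) sequentially"
      using eventually_ge_at_top[of 1]
    proof eventually_elim
      case (elim N)
      show ?case unfolding f_def sig_def
        by (rule kernel_partial_sum_bound[OF R0 \<sigma>(2)]) (use C \<zeta> M w elim in auto)
    qed
    ultimately have "(\<lambda>N. 1 / (Psi w - \<zeta>) - (\<Sum>j<N. f j w)) \<longlonglongrightarrow> 0"
      using Lim_null_comparison by fastforce
    then have "(\<lambda>N. 1 / (Psi w - \<zeta>) - (1 / (Psi w - \<zeta>) - (\<Sum>j<N. f j w))) \<longlonglongrightarrow> 1 / (Psi w - \<zeta>) - 0"
      by (intro tendsto_intros)
    then have "(\<lambda>N. \<Sum>j<N. f j w) \<longlonglongrightarrow> 1 / (Psi w - \<zeta>)" by simp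
    moreover have "(\<lambda>N. \<Sum>j<N. f j w) \<longlonglongrightarrow> X w"
      by (rule tendsto_uniform_limitI[OF ul[OF w(2), of "norm w"]]) (simp add: ann_def)
    ultimately show ?thesis by (rule LIMSEQ_unique[symmetric])
  qed
  have Xeq: "X w = 1 / (Psi w - \<zeta>)" if w: "r < norm w" for w
  proof -
    define U where "U = {w::complex. max M r < norm w}"
    define \<xi> :: complex where "\<xi> = of_real (max 0 (max M r) + 1)"
    have \<xi>: "\<xi> \<in> U" unfolding U_def \<xi>_def by (simp only: mem_Collect_eq norm_of_real)
    have "X w - 1 / (Psi w - \<zeta>) = 0"
    proof (rule analytic_continuation[where f="\<lambda>w. X w - 1 / (Psi w - \<zeta>)" and S="{w. r < norm w}" and U=U and \<xi>=\<xi>])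
      show "(\<lambda>w. X w - 1 / (Psi w - \<zeta>)) holomorphic_on {w. r < norm w}"
        using ne by (intro holomorphic_intros Xhol holomorphic_on_subset[OF Psi_hol sub1]) auto
      show "open {w::complex. r < norm w}" "connected {w::complex. r < norm w}"
        by (rule open_exterior connected_exterior)+
      show "U \<subseteq> {w. r < norm w}" by (auto simp: U_def)
      then show "\<xi> \<in> {w. r < norm w}" using \<xi> by blast
      have "\<xi> \<in> interior U" using \<xi> open_exterior[of "max M r"] by (simp add: U_def interior_open)
      then show "\<xi> islimpt U" by (rule interior_limit_point)
      show "X z - 1 / (Psi z - \<zeta>) = 0" if "z \<in> U" for z using large[of z] that by (simp add: U_def)
    qed (use w in auto)
    then show ?thesis by simp
  qed
  have "uniform_limit (ann a b) (\<lambda>N w. \<Sum>j<N. f j w) (\<lambda>w. 1 / (Psi w - \<zeta>)) sequentially"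
    by (rule uniform_limit_cong'[THEN iffD1, OF _ _ ul[OF a]]) (use Xeq a in \<open>auto simp: ann_def\<close>)
  then show ?thesis by (simp add: f_def)
qed

text \<open>The kernel expansion integrated against \<open>H (Psi w) * deriv Psi w\<close> over the
  circle of radius r': the kernel gives H(\<zeta>), and each \<open>sig j\<close> gives a Fourier
  coefficient.\<close>

theorem orthonormal_expansion:
  assumes hol: "H holomorphic_on T" and T: "open T" "Dcl r' \<subseteq> T" and r: "1 < r" "r < r'"
    and \<zeta>: "\<zeta> \<in> Dcl r"
  shows "(\<lambda>j. ip H j * poly (p j) \<zeta>) sums H \<zeta>"
proof -
  have r': "1 < r'" using r by simp
  define h where "h w = H (Psi w) * deriv Psi w" for w
  have "Psi ` sphere 0 r' \<subseteq> T" using T r' Psi_in_Dcl[of _ r'] by auto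
  then have ch: "continuous_on (sphere 0 r') h"
    unfolding h_def using r'
    by (intro continuous_intros holomorphic_on_imp_continuous_on[OF Psi_comp_hol[OF hol]]
          continuous_on_subset[OF holomorphic_on_imp_continuous_on[OF Psi_deriv_hol]]) auto
  have K: "uniform_limit (sphere 0 r') (\<lambda>N w. \<Sum>j<N. sig j w * poly (p j) \<zeta>) (\<lambda>w. 1 / (Psi w - \<zeta>)) sequentially"
    unfolding sphere_ann by (rule kernel_expansion[OF r(1) \<zeta> r(2)])
  have ne: "Psi w - \<zeta> \<noteq> 0" if "norm w = r'" for w
    using \<zeta> that r Psi_in_Dcl[of w r] by auto
  have ck: "continuous_on (sphere 0 r') (\<lambda>w. 1 / (Psi w - \<zeta>))"
    using ne r' by (intro continuous_intros continuous_on_subset[OF Psi_cont]) auto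
  have "uniform_limit (sphere 0 r') (\<lambda>N w. h w * (\<Sum>j<N. sig j w * poly (p j) \<zeta>)) (\<lambda>w. h w * (1 / (Psi w - \<zeta>))) sequentially"
    by (rule uniform_lim_mult[OF uniform_limit_const K])
       (use compact_imp_bounded[OF compact_continuous_image[OF ch compact_sphere]]
         compact_imp_bounded[OF compact_continuous_image[OF ck compact_sphere]] in auto)
  moreover have cont: "continuous_on (sphere 0 r') (\<lambda>w. h w * (\<Sum>j<N. sig j w * poly (p j) \<zeta>))" for N
    by (intro continuous_intros ch sig_cont r')
  ultimately have "(\<lambda>N. cint r' (\<lambda>w. h w * (\<Sum>j<N. sig j w * poly (p j) \<zeta>)))
     \<longlonglongrightarrow> cint r' (\<lambda>w. h w * (1 / (Psi w - \<zeta>)))"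
    using r' by (intro cint_uniform_limit) auto
  also have "cint r' (\<lambda>w. h w * (1 / (Psi w - \<zeta>))) = H \<zeta>"
    using Cauchy_exterior[OF hol T r'] \<zeta> Dcl_Dop(1)[OF r(2)] by (auto simp: h_def)
  also have "(\<lambda>N. cint r' (\<lambda>w. h w * (\<Sum>j<N. sig j w * poly (p j) \<zeta>))) = (\<lambda>N. \<Sum>j<N. ip H j * poly (p j) \<zeta>)"
  proof
    fix N
    have "cint r' (\<lambda>w. h w * (\<Sum>j<N. sig j w * poly (p j) \<zeta>)) = cint r' (\<lambda>w. \<Sum>j<N. poly (p j) \<zeta> * (h w * sig j w))"
      by (simp add: sum_distrib_left mult_ac)
    also have "\<dots> = (\<Sum>j<N. poly (p j) \<zeta> * cint r' (\<lambda>w. h w * sig j w))"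
      using r' by (subst cint_sum; (subst cint_cmult)?) (auto intro!: continuous_intros ch sig_cont)
    also have "\<dots> = (\<Sum>j<N. ip H j * poly (p j) \<zeta>)"
      unfolding ip_eq_cint[OF hol T r'] h_def by (simp add: mult.commute)
    finally show "cint r' (\<lambda>w. h w * (\<Sum>j<N. sig j w * poly (p j) \<zeta>)) = (\<Sum>j<N. ip H j * poly (p j) \<zeta>)" .
  qed
  finally show ?thesis unfolding sums_def .
qed

end

section \<open>Residue functionals on an annulus\<close>

text \<open>For a function with finitely many poles between the two circles this is the sum of its
  residues there.\<close>

definition Lf :: "real \<Rightarrow> real \<Rightarrow> (complex \<Rightarrow> complex) \<Rightarrow> complex" where
  "Lf r0 r1 h = cint r1 h - cint r0 h"

definition oann :: "real \<Rightarrow> real \<Rightarrow> complex set" where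
  "oann a b = {w. a < norm w \<and> norm w < b}"

text \<open>A list keeps repeated poles as repeated factors and allows division by one node at a
  time.\<close>

definition nodes :: "complex list \<Rightarrow> complex \<Rightarrow> complex" where
  "nodes xs w = (\<Prod>x\<leftarrow>xs. w - x)"

lemma nodes_simps [simp]: "nodes [] w = 1" "nodes (x # xs) w = (w - x) * nodes xs w"
  by (simp_all add: nodes_def)

lemma nodes_eq_0_iff: "nodes xs w = 0 \<longleftrightarrow> w \<in> set xs"
  by (induction xs) auto

lemma nodes_hol: "nodes xs holomorphic_on A"
proof (induction xs)
  case (Cons x xs)
  then have "(\<lambda>w. (w - x) * nodes xs w) holomorphic_on A" by (intro holomorphic_intros)
  then show ?case by (simp add: nodes_def)
qed (simp add: nodes_def[abs_def])

lemma open_oann: "open (oann a b)"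
  unfolding oann_def by (intro open_Collect_conj open_Collect_less continuous_intros)

lemma max_modulus_annulus:
  assumes f: "f holomorphic_on oann a b" and ab: "a < r0" "r0 < r1" "r1 < b" "0 \<le> a"
    and M: "\<And>w. norm w = r0 \<or> norm w = r1 \<Longrightarrow> norm (f w) \<le> M"
    and x: "r0 \<le> norm x" "norm x \<le> r1"
  shows "norm (f x) \<le> M"
proof (rule maximum_modulus_frontier[where S="ann r0 r1" and f=f and \<xi>=x])
  have sub: "ann r0 r1 \<subseteq> oann a b" using ab by (auto simp: ann_def oann_def)
  have cl: "closed (ann r0 r1)" by (rule compact_imp_closed[OF compact_ann])
  show "f holomorphic_on interior (ann r0 r1)"
    by (rule holomorphic_on_subset[OF f]) (use sub interior_subset in blast)
  show "continuous_on (closure (ann r0 r1)) f"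
    using cl sub by (simp add: continuous_on_subset[OF holomorphic_on_imp_continuous_on[OF f]])
  show "bounded (ann r0 r1)" by (rule compact_imp_bounded[OF compact_ann])
  show "x \<in> ann r0 r1" using x by (simp add: ann_def)
  fix z assume z: "z \<in> frontier (ann r0 r1)"
  have "oann r0 r1 \<subseteq> interior (ann r0 r1)"
    by (rule interior_maximal[OF _ open_oann]) (auto simp: ann_def oann_def)
  then have "z \<in> ann r0 r1" "z \<notin> oann r0 r1" using z cl by (auto simp: frontier_def)
  then have "norm z = r0 \<or> norm z = r1" by (auto simp: ann_def oann_def)
  then show "norm (f z) \<le> M" by (rule M)
qed

text \<open>Newton interpolation: each node replaces f by its divided difference. The constant
  depends on the radii and the nodes only, not on f. The alternative y = 0 serves the empty list,
  where no degree is small enough.\<close>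

lemma newton_division:
  assumes ab: "a < r0" "r0 < r1" "r1 < b" "0 \<le> a"
    and xs: "\<And>x. x \<in> set xs \<Longrightarrow> r0 < norm x \<and> norm x < r1"
  shows "\<exists>C>0. \<forall>f M. f holomorphic_on oann a b \<longrightarrow> (\<forall>w. norm w = r0 \<or> norm w = r1 \<longrightarrow> norm (f w) \<le> M) \<longrightarrow>
    (\<exists>y k. k holomorphic_on oann a b \<and> (y = 0 \<or> degree y < length xs) \<and> (\<forall>i. norm (coeff y i) \<le> C * M) \<and>
       (\<forall>w\<in>oann a b. f w = poly y w + nodes xs w * k w))"
  using xs
proof (induction xs)
  case Nil
  show ?case
  proof (intro exI[of _ "1::real"] conjI allI impI)
    fix f :: "complex \<Rightarrow> complex" and M :: real
    assume f: "f holomorphic_on oann a b" "\<forall>w. norm w = r0 \<or> norm w = r1 \<longrightarrow> norm (f w) \<le> M"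
    then have "norm (f (of_real r0)) \<le> M" using ab by auto
    then have "0 \<le> M" by (rule order_trans[OF norm_ge_zero])
    then show "\<exists>y k. k holomorphic_on oann a b \<and> (y = 0 \<or> degree y < length []) \<and> (\<forall>i. norm (coeff y i) \<le> 1 * M) \<and>
       (\<forall>w\<in>oann a b. f w = poly y w + nodes [] w * k w)"
      using f by (intro exI[of _ 0] exI[of _ f]) auto
  qed simp
next
  case (Cons x xs)
  define d where "d = min (norm x - r0) (r1 - norm x)"
  have x: "r0 < norm x" "norm x < r1" using Cons.prems by auto
  have d: "d > 0" using x by (simp add: d_def)
  obtain C where C: "C > 0" and IH: "\<And>f M. f holomorphic_on oann a b \<Longrightarrow> (\<And>w. norm w = r0 \<or> norm w = r1 \<Longrightarrow> norm (f w) \<le> M) \<Longrightarrow>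
    (\<exists>y k. k holomorphic_on oann a b \<and> (y = 0 \<or> degree y < length xs) \<and> (\<forall>i. norm (coeff y i) \<le> C * M) \<and>
       (\<forall>w\<in>oann a b. f w = poly y w + nodes xs w * k w))"
    using Cons by (metis list.set_intros(2))
  \<comment> \<open>1 bounds the value at x, 2/d the divided difference, and r1 + 1 the
    multiplication by w - x.\<close>
  define C' where "C' = 1 + (r1 + 1) * (C * (2 / d))"
  have C': "C' > 0" unfolding C'_def using C d ab by (intro add_pos_nonneg) auto
  show ?case
  proof (intro exI[of _ C'] conjI C' allI impI)
    fix f :: "complex \<Rightarrow> complex" and M :: real
    assume f: "f holomorphic_on oann a b" and "\<forall>w. norm w = r0 \<or> norm w = r1 \<longrightarrow> norm (f w) \<le> M"
    then have M: "\<And>w. norm w = r0 \<or> norm w = r1 \<Longrightarrow> norm (f w) \<le> M" by blast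
    have fx: "norm (f x) \<le> M"
      using x by (intro max_modulus_annulus[OF f ab M]) auto
    have M0: "0 \<le> M" using fx norm_ge_zero[of "f x"] by linarith
    define f1 where "f1 w = (if w = x then deriv f x else (f w - f x) / (w - x))" for w
    have f1: "f1 holomorphic_on oann a b"
      unfolding f1_def using x ab by (intro pole_lemma_open f open_oann)
    have f1b: "norm (f1 w) \<le> 2 / d * M" if w: "norm w = r0 \<or> norm w = r1" for w
    proof -
      have dw: "d \<le> norm (w - x)" using w norm_triangle_ineq3[of w x] by (auto simp: d_def)
      then have "w \<noteq> x" using d by auto
      then have "norm (f1 w) = norm (f w - f x) / norm (w - x)" by (simp add: f1_def norm_divide)
      also have "\<dots> \<le> (M + M) / d"
        using dw d M[OF w] fx norm_triangle_ineq4[of "f w" "f x"] M0 by (intro frac_le) auto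
      finally show ?thesis by simp
    qed
    obtain y k where yk: "k holomorphic_on oann a b" "y = 0 \<or> degree y < length xs"
      "\<And>i. norm (coeff y i) \<le> C * (2 / d * M)" "\<And>w. w \<in> oann a b \<Longrightarrow> f1 w = poly y w + nodes xs w * k w"
      using IH[OF f1 f1b] by blast
    define y' where "y' = [:f x:] + [:- x, 1:] * y"
    have "f w = poly y' w + nodes (x # xs) w * k w" if w: "w \<in> oann a b" for w
    proof -
      have "f w = f x + (w - x) * f1 w" by (auto simp: f1_def)
      then show ?thesis by (simp add: yk(4)[OF w] y'_def algebra_simps)
    qed
    moreover have "degree y' < length (x # xs)"
    proof -
      have "degree ([:- x, 1:] * y) \<le> length xs"
        using yk(2) degree_mult_le[of "[:- x, 1:]" y] by auto
      then have "degree y' \<le> length xs" unfolding y'_def by (intro degree_add_le) auto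
      then show ?thesis by simp
    qed
    moreover have "norm (coeff y' i) \<le> C' * M" for i
    proof -
      let ?B = "C * (2 / d * M)"
      have "coeff y' i = coeff [:f x:] i + (- x * coeff y i + coeff (pCons 0 y) i)"
        by (simp add: y'_def)
      also have "norm \<dots> \<le> norm (coeff [:f x:] i) + (norm (- x * coeff y i) + norm (coeff (pCons 0 y) i))"
        by (intro order_trans[OF norm_triangle_ineq] add_left_mono norm_triangle_ineq)
      also have "norm (coeff [:f x:] i) \<le> M" using fx M0 by (cases i) auto
      also have "norm (- x * coeff y i) \<le> r1 * ?B"
        unfolding norm_mult norm_minus_cancel using x yk(3)[of i] ab by (intro mult_mono) auto
      also have "norm (coeff (pCons 0 y) i) \<le> ?B"
        using yk(3)[of "i - 1"] C d M0 by (cases i) auto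
      also have "M + (r1 * ?B + ?B) = C' * M" by (simp add: C'_def algebra_simps add_divide_distrib)
      finally show ?thesis by simp
    qed
    ultimately show "\<exists>y k. k holomorphic_on oann a b \<and> (y = 0 \<or> degree y < length (x # xs)) \<and> (\<forall>i. norm (coeff y i) \<le> C' * M) \<and>
       (\<forall>w\<in>oann a b. f w = poly y w + nodes (x # xs) w * k w)"
      using yk(1) by blast
  qed
qed

text \<open>An inverse b modulo the earlier nodes is improved at the new node x: 1 - B b' = (1 - B
  b) (1 - B / B(x)), and the second factor vanishes at x. This later removes the factor B inside the
  residue functional.\<close>

lemma inverse_modulo_nodes:
  assumes B: "B holomorphic_on \<Omega>" and \<Omega>: "open \<Omega>" and xs: "\<And>x. x \<in> set xs \<Longrightarrow> x \<in> \<Omega> \<and> B x \<noteq> 0"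
  shows "\<exists>b k. b holomorphic_on \<Omega> \<and> k holomorphic_on \<Omega> \<and> (\<forall>w\<in>\<Omega>. B w * b w = 1 + nodes xs w * k w)"
  using xs
proof (induction xs)
  case Nil
  show ?case by (intro exI[of _ "\<lambda>_. 0"] exI[of _ "\<lambda>_. -1"]) auto
next
  case (Cons x xs)
  obtain b k where bk: "b holomorphic_on \<Omega>" "k holomorphic_on \<Omega>" "\<And>w. w \<in> \<Omega> \<Longrightarrow> B w * b w = 1 + nodes xs w * k w"
    using Cons by (metis list.set_intros(2))
  have x: "x \<in> \<Omega>" "B x \<noteq> 0" using Cons.prems by auto
  define l where "l w = (if w = x then deriv B x else (B w - B x) / (w - x))" for w
  have l: "l holomorphic_on \<Omega>" unfolding l_def using x by (intro pole_lemma_open B \<Omega>)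
  define b' where "b' w = b w + 1 / B x - B w * b w / B x" for w
  define k' where "k' w = - k w * l w / B x" for w
  have "B w * b' w = 1 + nodes (x # xs) w * k' w" if w: "w \<in> \<Omega>" for w
  proof -
    have Bw: "B w = B x + (w - x) * l w" by (auto simp: l_def)
    have "1 - B w * b' w = (1 - B w * b w) * (1 - B w / B x)" by (simp add: b'_def algebra_simps)
    also have "1 - B w * b w = - nodes xs w * k w" using bk(3)[OF w] by simp
    also have "1 - B w / B x = - (w - x) * l w / B x" using x by (subst Bw) (simp add: field_simps)
    also have "- nodes xs w * k w * (- (w - x) * l w / B x) = - (nodes (x # xs) w * k' w)"
      by (simp only: k'_def nodes_simps mult_minus_left mult_minus_right minus_minus times_divide_eq_left
          times_divide_eq_right minus_divide_left[symmetric] mult_ac)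
    finally have *: "1 - B w * b' w = - (nodes (x # xs) w * k' w)" .
    have "B w * b' w = 1 - (1 - B w * b' w)" by simp
    then show ?thesis unfolding * by simp
  qed
  moreover have "b' holomorphic_on \<Omega>" "k' holomorphic_on \<Omega>"
    unfolding b'_def k'_def using x by (intro holomorphic_intros bk B l; simp)+
  ultimately show ?case by blast
qed

section \<open>Control of residue functionals by finitely many values\<close>

locale annulus =
  fixes a r0 r1 b :: real and xs :: "complex list"
  assumes ab: "1 < a" "a < r0" "r0 < r1" "r1 < b"
    and xs: "\<And>x. x \<in> set xs \<Longrightarrow> r0 < norm x \<and> norm x < r1"
begin

abbreviation "\<Omega> \<equiv> oann a b"
abbreviation "L \<equiv> Lf r0 r1"
abbreviation "W \<equiv> nodes xs"

definition circ :: "complex set" where "circ = sphere 0 r0 \<union> sphere 0 r1"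

lemma circ_iff: "w \<in> circ \<longleftrightarrow> norm w = r0 \<or> norm w = r1"
  by (auto simp: circ_def)

lemma circ_sub: "circ \<subseteq> \<Omega>" using ab by (auto simp: circ_def oann_def)

lemma W_nz: "w \<in> circ \<Longrightarrow> W w \<noteq> 0"
  using xs[of w] by (auto simp: nodes_eq_0_iff circ_iff)

lemma Omega_nz: "w \<in> \<Omega> \<Longrightarrow> w \<noteq> 0" using ab by (auto simp: oann_def)

lemma hol_cont: "f holomorphic_on \<Omega> \<Longrightarrow> continuous_on circ f"
  by (rule continuous_on_subset[OF holomorphic_on_imp_continuous_on circ_sub])

lemma hol_cont_div: "f holomorphic_on \<Omega> \<Longrightarrow> continuous_on circ (\<lambda>w. f w / W w)"
  using W_nz by (intro continuous_intros hol_cont nodes_hol) auto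

lemma circ_split: "continuous_on circ f \<Longrightarrow> continuous_on (sphere 0 r0) f"
  "continuous_on circ f \<Longrightarrow> continuous_on (sphere 0 r1) f"
  by (auto simp: circ_def elim: continuous_on_subset)

lemma L_hol: "h holomorphic_on \<Omega> \<Longrightarrow> L h = 0"
  unfolding Lf_def using ab by (subst cint_eq[OF _ open_oann, of h a b r0 r1]) (auto simp: oann_def)

lemma L_cong: "(\<And>w. w \<in> circ \<Longrightarrow> f w = g w) \<Longrightarrow> L f = L g"
  unfolding Lf_def using ab by (intro arg_cong2[where f="(-)"] cint_cong) (auto simp: circ_iff)

lemma L_add: "continuous_on circ f \<Longrightarrow> continuous_on circ g \<Longrightarrow> L (\<lambda>w. f w + g w) = L f + L g"
  unfolding Lf_def using ab by (simp add: cint_add circ_split)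

lemma L_cmult: "continuous_on circ f \<Longrightarrow> L (\<lambda>w. c * f w) = c * L f"
  unfolding Lf_def using ab by (simp add: cint_cmult circ_split right_diff_distrib)

lemma L_sum:
  assumes "finite I" "\<And>i. i \<in> I \<Longrightarrow> continuous_on circ (f i)"
  shows "L (\<lambda>w. \<Sum>i\<in>I. f i w) = (\<Sum>i\<in>I. L (f i))"
  unfolding Lf_def using ab assms by (simp add: cint_sum circ_split sum_subtractf)

text \<open>Modulo the nodes every holomorphic function is a combination of \<open>1/w, \<dots>, 1/w^m\<close>, so the functional
  \<open>g \<mapsto> L (y B g / W)\<close> is controlled by its values on functions close to these.\<close>

theorem L_control:
  assumes B: "B holomorphic_on \<Omega>" and m: "m = length xs" "m \<ge> 1"
  obtains C \<epsilon> where "C > 0" "\<epsilon> > 0"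
    "\<And>y h \<delta> g M. y holomorphic_on \<Omega> \<Longrightarrow> (\<And>i. i \<in> {1..m} \<Longrightarrow> h i holomorphic_on \<Omega>) \<Longrightarrow>
       (\<And>i w. i \<in> {1..m} \<Longrightarrow> w \<in> circ \<Longrightarrow> norm (w powi (- int i) - h i w) \<le> \<epsilon>) \<Longrightarrow>
       (\<And>i. i \<in> {1..m} \<Longrightarrow> norm (L (\<lambda>w. y w * B w * h i w / W w)) \<le> \<delta>) \<Longrightarrow>
       g holomorphic_on \<Omega> \<Longrightarrow> (\<And>w. w \<in> circ \<Longrightarrow> norm (g w) \<le> M) \<Longrightarrow>
       norm (L (\<lambda>w. y w * B w * g w / W w)) \<le> C * \<delta> * M"
proof -
  have a0: "0 \<le> a" using ab by simp
  obtain C1 where C1: "C1 > 0" and div: "\<And>f M. f holomorphic_on \<Omega> \<Longrightarrow> (\<And>w. norm w = r0 \<or> norm w = r1 \<Longrightarrow> norm (f w) \<le> M) \<Longrightarrow>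
    (\<exists>y k. k holomorphic_on \<Omega> \<and> (y = 0 \<or> degree y < length xs) \<and> (\<forall>i. norm (coeff y i) \<le> C1 * M) \<and>
       (\<forall>w\<in>\<Omega>. f w = poly y w + W w * k w))"
    using newton_division[OF ab(2-4) a0 xs] by metis
  define K where "K = real m * (C1 * r1 ^ m)"
  have K: "K > 0" unfolding K_def using C1 ab m by (intro mult_pos_pos) auto
  have pw: "(\<lambda>w. w powi j) holomorphic_on \<Omega>" for j
    using Omega_nz by (intro holomorphic_intros) auto
  have step: "norm (L (\<lambda>w. y w * B w * g w / W w)) \<le> K * \<beta> * M"
    if y: "y holomorphic_on \<Omega>" and g: "g holomorphic_on \<Omega>" and M: "\<And>w. w \<in> circ \<Longrightarrow> norm (g w) \<le> M"
      and \<beta>: "\<And>i. i \<in> {1..m} \<Longrightarrow> norm (L (\<lambda>w. y w * B w * w powi (- int i) / W w)) \<le> \<beta>" for y g M \<beta>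
  proof -
    have M0: "0 \<le> M" using M[of "of_real r0"] ab by (auto simp: circ_iff intro: order_trans[OF norm_ge_zero])
    have \<beta>0: "0 \<le> \<beta>" using \<beta>[of 1] m by (auto intro: order_trans[OF norm_ge_zero])
    \<comment> \<open>Not g but w^m g is divided by the nodes: after division by w^m the remainder
      is a combination of w^(-1), ..., w^(-m), the functions that the \<open>h i\<close>
      approximate.\<close>
    obtain t k where tk: "k holomorphic_on \<Omega>" "t = 0 \<or> degree t < length xs"
      "\<And>i. norm (coeff t i) \<le> C1 * (r1 ^ m * M)" "\<And>w. w \<in> \<Omega> \<Longrightarrow> w ^ m * g w = poly t w + W w * k w"
    proof -
      have bd: "norm (w ^ m * g w) \<le> r1 ^ m * M" if "norm w = r0 \<or> norm w = r1" for w
        unfolding norm_mult norm_power using that M[of w] ab M0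
        by (intro mult_mono power_mono) (auto simp: circ_iff)
      have hol: "(\<lambda>w. w ^ m * g w) holomorphic_on \<Omega>" by (intro holomorphic_intros g)
      obtain y k where "k holomorphic_on \<Omega>" "y = 0 \<or> degree y < length xs"
        "\<forall>i. norm (coeff y i) \<le> C1 * (r1 ^ m * M)" "\<forall>w\<in>\<Omega>. w ^ m * g w = poly y w + W w * k w"
        using div[OF hol bd] by blast
      then show ?thesis by (intro that[of k y]) auto
    qed
    have teval: "poly t w = (\<Sum>i<m. coeff t i * w ^ i)" for w
    proof -
      have "poly t w = (\<Sum>i\<le>degree t. coeff t i * w ^ i)" by (rule poly_altdef)
      also have "\<dots> = (\<Sum>i<m. coeff t i * w ^ i)"
        using tk(2) m by (cases "t = 0") (auto intro!: sum.mono_neutral_left intro: le_degree)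
      finally show ?thesis .
    qed
    have hk: "(\<lambda>w. y w * B w * k w * w powi (- int m)) holomorphic_on \<Omega>"
      by (intro holomorphic_intros y B tk pw)
    have hs: "continuous_on circ (\<lambda>w. y w * B w * w powi j / W w)" for j
      by (intro hol_cont_div holomorphic_intros y B pw)
    have "L (\<lambda>w. y w * B w * g w / W w)
      = L (\<lambda>w. (\<Sum>i<m. coeff t i * (y w * B w * w powi (- int (m - i)) / W w)) + y w * B w * k w * w powi (- int m))"
    proof (rule L_cong)
      fix w assume w: "w \<in> circ"
      then have w\<Omega>: "w \<in> \<Omega>" using circ_sub by auto
      have w0: "w \<noteq> 0" using Omega_nz[OF w\<Omega>] .
      have p: "w ^ i * w powi (- int m) = w powi (- int (m - i))" if "i < m" for i
      proof -
        have "w ^ i * w powi (- int m) = w powi (int i + - int m)"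
          using w0 by (simp only: power_int_add power_int_of_nat simp_thms)
        also have "int i + - int m = - int (m - i)" using that by simp
        finally show ?thesis .
      qed
      have "g w = w ^ m * g w * w powi (- int m)" using w0 by (simp add: power_int_minus)
      also have "\<dots> = (\<Sum>i<m. coeff t i * w powi (- int (m - i))) + W w * k w * w powi (- int m)"
        using p by (simp add: tk(4)[OF w\<Omega>] teval distrib_right sum_distrib_right mult.assoc)
      finally have "y w * B w * g w / W w =
        y w * B w / W w * (\<Sum>i<m. coeff t i * w powi (- int (m - i))) + y w * B w / W w * (W w * k w * w powi (- int m))"
        by (simp add: distrib_left add_divide_distrib)
      then show "y w * B w * g w / W w = (\<Sum>i<m. coeff t i * (y w * B w * w powi (- int (m - i)) / W w)) + y w * B w * k w * w powi (- int m)"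
        using W_nz[OF w] by (simp add: sum_distrib_left mult_ac)
    qed
    also have "\<dots> = (\<Sum>i<m. coeff t i * L (\<lambda>w. y w * B w * w powi (- int (m - i)) / W w))"
    proof -
      have c: "continuous_on circ (\<lambda>w. coeff t i * (y w * B w * w powi (- int (m - i)) / W w))" for i
        by (intro continuous_on_mult_left hs)
      show ?thesis
        by (subst L_add[OF continuous_on_sum[OF c] hol_cont[OF hk]], subst L_hol[OF hk],
            subst L_sum[OF finite_lessThan c], subst L_cmult[OF hs]) simp
    qed
    also have "norm \<dots> \<le> (\<Sum>i<m. C1 * (r1 ^ m * M) * \<beta>)"
    proof (rule sum_norm_le)
      fix i assume "i \<in> {..<m}"
      then show "norm (coeff t i * L (\<lambda>w. y w * B w * w powi (- int (m - i)) / W w)) \<le> C1 * (r1 ^ m * M) * \<beta>"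
        unfolding norm_mult using tk(3)[of i] \<beta>[of "m - i"] C1 ab M0 by (intro mult_mono) auto
    qed
    also have "\<dots> = K * \<beta> * M" by (simp add: K_def)
    finally show ?thesis .
  qed
  show ?thesis
  \<comment> \<open>With the tolerance 1/(2K), replacing the powers by the \<open>h i\<close> costs
    at most half of the largest functional value \<beta>, which is absorbed on the left.\<close>
  proof (rule that[of "2 * K" "1 / (2 * K)"])
    fix y :: "complex \<Rightarrow> complex" and h :: "nat \<Rightarrow> complex \<Rightarrow> complex" and \<delta> M :: real and g :: "complex \<Rightarrow> complex"
    assume y: "y holomorphic_on \<Omega>" and h: "\<And>i. i \<in> {1..m} \<Longrightarrow> h i holomorphic_on \<Omega>"
      and he: "\<And>i w. i \<in> {1..m} \<Longrightarrow> w \<in> circ \<Longrightarrow> norm (w powi (- int i) - h i w) \<le> 1 / (2 * K)"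
      and \<delta>: "\<And>i. i \<in> {1..m} \<Longrightarrow> norm (L (\<lambda>w. y w * B w * h i w / W w)) \<le> \<delta>"
      and g: "g holomorphic_on \<Omega>" and M: "\<And>w. w \<in> circ \<Longrightarrow> norm (g w) \<le> M"
    define \<beta> where "\<beta> = Max ((\<lambda>i. norm (L (\<lambda>w. y w * B w * w powi (- int i) / W w))) ` {1..m})"
    have \<beta>: "norm (L (\<lambda>w. y w * B w * w powi (- int i) / W w)) \<le> \<beta>" if "i \<in> {1..m}" for i
      unfolding \<beta>_def using that by (intro Max_ge) auto
    have "\<beta> \<in> (\<lambda>i. norm (L (\<lambda>w. y w * B w * w powi (- int i) / W w))) ` {1..m}"
      unfolding \<beta>_def using m by (intro Max_in) auto
    then obtain i where i: "i \<in> {1..m}" "\<beta> = norm (L (\<lambda>w. y w * B w * w powi (- int i) / W w))" by blast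
    have d: "(\<lambda>w. w powi (- int i) - h i w) holomorphic_on \<Omega>" by (intro holomorphic_intros pw h i)
    have "L (\<lambda>w. y w * B w * w powi (- int i) / W w) =
      L (\<lambda>w. y w * B w * h i w / W w + y w * B w * (w powi (- int i) - h i w) / W w)"
      by (intro L_cong) (simp add: algebra_simps add_divide_distrib diff_divide_distrib)
    also have "\<dots> = L (\<lambda>w. y w * B w * h i w / W w) + L (\<lambda>w. y w * B w * (w powi (- int i) - h i w) / W w)"
      by (intro L_add hol_cont_div holomorphic_intros y B h i pw)
    also have "norm \<dots> \<le> \<delta> + K * \<beta> * (1 / (2 * K))"
      by (intro norm_triangle_mono \<delta> i step[OF y d he \<beta>])
    finally have "\<beta> \<le> 2 * \<delta>" using i K by simp
    have "norm (L (\<lambda>w. y w * B w * g w / W w)) \<le> K * (2 * \<delta>) * M"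
      using \<beta> \<open>\<beta> \<le> 2 * \<delta>\<close> by (intro step[OF y g M]) force+
    then show "norm (L (\<lambda>w. y w * B w * g w / W w)) \<le> 2 * K * \<delta> * M" by (simp add: mult_ac)
  qed (use K in auto)
qed

end

text \<open>Gaussian elimination, one equation per step. It supplies the m + 1 coefficients of a
  denominator subject to m orthogonality relations.\<close>

lemma underdetermined_system:
  fixes M :: "nat \<Rightarrow> nat \<Rightarrow> complex"
  shows "\<exists>c. (\<exists>j\<le>m. c j \<noteq> 0) \<and> (\<forall>i<m. (\<Sum>j\<le>m. c j * M i j) = 0)"
proof (induction m arbitrary: M)
  case 0
  show ?case by (intro exI[of _ "\<lambda>_. 1"]) auto
next
  case (Suc m)
  show ?case
  proof (cases "\<forall>j\<le>Suc m. M m j = 0")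
    case True
    obtain c where c: "\<exists>j\<le>m. c j \<noteq> 0" "\<And>i. i < m \<Longrightarrow> (\<Sum>j\<le>m. c j * M i j) = 0"
      using Suc.IH[of M] by blast
    define c' where "c' = c(Suc m := 0)"
    have "(\<Sum>j\<le>Suc m. c' j * M i j) = 0" if "i < Suc m" for i
    proof (cases "i = m")
      case True
      then show ?thesis using \<open>\<forall>j\<le>Suc m. M m j = 0\<close> by (intro sum.neutral) auto
    next
      case False
      have "(\<Sum>j\<le>Suc m. c' j * M i j) = (\<Sum>j\<le>m. c j * M i j)" by (simp add: c'_def)
      then show ?thesis using c(2)[of i] that False by simp
    qed
    moreover have "\<exists>j\<le>Suc m. c' j \<noteq> 0"
    proof -
      obtain j where "j \<le> m" "c j \<noteq> 0" using c(1) by blast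
      then show ?thesis by (intro exI[of _ j]) (simp add: c'_def)
    qed
    ultimately show ?thesis by blast
  next
    case False
    then obtain k where k: "k \<le> Suc m" "M m k \<noteq> 0" by blast
    \<comment> \<open>Skips the pivot column k, so that the induction hypothesis applies to the m +
      1 remaining columns.\<close>
    define \<pi> where "\<pi> j = (if j < k then j else Suc j)" for j
    have inj: "inj_on \<pi> {..m}" by (auto simp: \<pi>_def inj_on_def split: if_splits)
    have img: "\<pi> ` {..m} = {..Suc m} - {k}"
    proof (intro card_subset_eq)
      show "\<pi> ` {..m} \<subseteq> {..Suc m} - {k}" using k by (auto simp: \<pi>_def)
      show "card (\<pi> ` {..m}) = card ({..Suc m} - {k})" using k by (simp add: card_image[OF inj])
    qed simp
    obtain c where c: "\<exists>j\<le>m. c j \<noteq> 0"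
      "\<And>i. i < m \<Longrightarrow> (\<Sum>j\<le>m. c j * (M i (\<pi> j) - M m (\<pi> j) / M m k * M i k)) = 0"
      using Suc.IH[of "\<lambda>i j. M i (\<pi> j) - M m (\<pi> j) / M m k * M i k"] by blast
    define s where "s = (\<Sum>j\<le>m. c j * M m (\<pi> j)) / M m k"
    define c' where "c' j = (if j = k then - s else c (the_inv_into {..m} \<pi> j))" for j
    have c'\<pi>: "c' (\<pi> j) = c j" if "j \<le> m" for j
    proof -
      have "\<pi> j \<noteq> k" by (auto simp: \<pi>_def)
      then show ?thesis using that by (simp add: c'_def the_inv_into_f_f[OF inj])
    qed
    have sum: "(\<Sum>j\<le>Suc m. c' j * M i j) = (\<Sum>j\<le>m. c j * M i (\<pi> j)) - s * M i k" for i
    proof -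
      have "(\<Sum>j\<le>Suc m. c' j * M i j) = c' k * M i k + (\<Sum>j\<in>{..Suc m} - {k}. c' j * M i j)"
        using k by (intro sum.remove) auto
      also have "(\<Sum>j\<in>{..Suc m} - {k}. c' j * M i j) = (\<Sum>j\<le>m. c' (\<pi> j) * M i (\<pi> j))"
        unfolding img[symmetric] by (simp add: sum.reindex[OF inj])
      also have "\<dots> = (\<Sum>j\<le>m. c j * M i (\<pi> j))" by (intro sum.cong) (auto simp: c'\<pi>)
      finally show ?thesis by (simp add: c'_def)
    qed
    have "(\<Sum>j\<le>Suc m. c' j * M i j) = 0" if "i < Suc m" for i
    proof (cases "i = m")
      case True
      then show ?thesis using k by (simp only: sum s_def) simp
    next
      case False
      have "0 = (\<Sum>j\<le>m. c j * (M i (\<pi> j) - M m (\<pi> j) / M m k * M i k))"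
        using c(2)[of i] that False by simp
      also have "\<dots> = (\<Sum>j\<le>m. c j * M i (\<pi> j)) - s * M i k"
        unfolding s_def by (simp add: right_diff_distrib sum_subtractf sum_divide_distrib sum_distrib_right mult.assoc)
      finally show ?thesis using sum[of i] by simp
    qed
    moreover have "\<exists>j\<le>Suc m. c' j \<noteq> 0"
    proof -
      obtain j where j: "j \<le> m" "c j \<noteq> 0" using c(1) by blast
      then have "c' (\<pi> j) \<noteq> 0" "\<pi> j \<le> Suc m" using c'\<pi> by (auto simp: \<pi>_def)
      then show ?thesis by blast
    qed
    ultimately show ?thesis by blast
  qed
qed

section \<open>Denominators of the approximants\<close>

lemma coeff_le_coeff_norm: "i \<le> m \<Longrightarrow> norm (coeff Q i) \<le> coeff_norm m Q"
  unfolding coeff_norm_def by (intro Max_ge) auto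

lemma coeff_norm_le: "(\<And>i. i \<le> m \<Longrightarrow> norm (coeff Q i) \<le> B) \<Longrightarrow> coeff_norm m Q \<le> B"
  unfolding coeff_norm_def by (subst Max_le_iff) auto

lemma coeff_norm_nonneg: "0 \<le> coeff_norm m Q"
  using coeff_le_coeff_norm[of 0 m Q] norm_ge_zero[of "coeff Q 0"] by linarith

lemma coeff_norm_pos: "degree Q \<le> m \<Longrightarrow> Q \<noteq> 0 \<Longrightarrow> 0 < coeff_norm m Q"
  using coeff_le_coeff_norm[of "degree Q" m Q] by (metis leading_coeff_0_iff less_le_trans zero_less_norm_iff)

lemma coeff_norm_add: "coeff_norm m (P + Q) \<le> coeff_norm m P + coeff_norm m Q"
  by (rule coeff_norm_le) (auto intro!: order_trans[OF norm_triangle_ineq] add_mono coeff_le_coeff_norm)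

lemma norm_poly_le_coeff_norm:
  assumes "degree Q \<le> m" "norm z \<le> M" "1 \<le> M"
  shows "norm (poly Q z) \<le> (real m + 1) * M ^ m * coeff_norm m Q"
proof -
  have "poly Q z = (\<Sum>i\<le>m. coeff Q i * z ^ i)"
    unfolding poly_altdef using assms(1) by (intro sum.mono_neutral_left) (auto simp: coeff_eq_0)
  also have "norm \<dots> \<le> (\<Sum>i\<le>m. coeff_norm m Q * M ^ m)"
  proof (rule sum_norm_le)
    fix i assume i: "i \<in> {..m}"
    have "norm z ^ i \<le> M ^ i" using assms by (intro power_mono) auto
    also have "\<dots> \<le> M ^ m" using assms i by (intro power_increasing) auto
    finally show "norm (coeff Q i * z ^ i) \<le> coeff_norm m Q * M ^ m"
      unfolding norm_mult norm_power using i
      by (intro mult_mono coeff_le_coeff_norm coeff_norm_nonneg) auto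
  qed
  finally show ?thesis by (simp add: mult_ac algebra_simps)
qed

text \<open>The radius is at least 1, so the factors w^(-i) in Cauchy's formula are at most 1 and
  one bound serves all coefficients.\<close>

lemma Cauchy_coeff:
  fixes T :: "complex poly"
  assumes rho: "1 \<le> \<rho>" and B: "\<And>z. norm z = \<rho> \<Longrightarrow> norm (poly T z) \<le> B"
  shows "norm (coeff T i) \<le> B"
proof -
  have r0: "0 < \<rho>" using rho by simp
  have "norm (poly T (of_real \<rho>)) \<le> B" using rho by (intro B) auto
  then have B0: "0 \<le> B" by (rule order_trans[OF norm_ge_zero])
  have c: "continuous_on (sphere 0 \<rho>) (\<lambda>w::complex. w powi k * (1 / w))" for k :: int
    using rho by (intro continuous_intros) auto
  have "cint \<rho> (\<lambda>w. poly T w * (w powi (- int i) * (1 / w)))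
      = cint \<rho> (\<lambda>w. \<Sum>j\<le>degree T. coeff T j * (w powi (int j - int i) * (1 / w)))"
  proof (rule cint_cong[OF r0])
    fix w :: complex assume "norm w = \<rho>"
    then have w: "w \<noteq> 0" using r0 by auto
    have "w ^ j * w powi (- int i) = w powi (int j - int i)" for j
      using w power_int_add[of w "int j" "- int i"] by simp
    then have "coeff T j * w ^ j * (w powi (- int i) * (1 / w)) = coeff T j * (w powi (int j - int i) * (1 / w))" for j
      by (metis mult.assoc)
    then show "poly T w * (w powi (- int i) * (1 / w)) = (\<Sum>j\<le>degree T. coeff T j * (w powi (int j - int i) * (1 / w)))"
      unfolding poly_altdef sum_distrib_right by (intro sum.cong refl)
  qed
  also have "\<dots> = (\<Sum>j\<le>degree T. cint \<rho> (\<lambda>w. coeff T j * (w powi (int j - int i) * (1 / w))))"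
    by (intro cint_sum r0 continuous_on_mult_left c) simp
  also have "\<dots> = (\<Sum>j\<le>degree T. coeff T j * cint \<rho> (\<lambda>w. w powi (int j - int i) * (1 / w)))"
    by (simp only: cint_cmult[OF r0 c])
  also have "\<dots> = (\<Sum>j\<le>degree T. if j = i then coeff T j else 0)"
    using cint_powi[OF r0] by (intro sum.cong) auto
  also have "\<dots> = coeff T i" by (simp add: coeff_eq_0)
  finally have "norm (coeff T i) = norm (cint \<rho> (\<lambda>w. poly T w * (w powi (- int i) * (1 / w))))" by simp
  also have "\<dots> \<le> \<rho> * (B / \<rho>)"
  proof (rule norm_cint_le[OF r0])
    show "continuous_on (sphere 0 \<rho>) (\<lambda>w. poly T w * (w powi (- int i) * (1 / w)))"
      by (intro continuous_on_mult c continuous_intros)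
    fix w :: complex assume w: "norm w = \<rho>"
    have "norm (w powi (- int i)) \<le> 1"
      using rho w by (simp add: power_int_minus norm_inverse norm_power inverse_le_1_iff)
    then have "norm (poly T w) * (norm (w powi (- int i)) * (1 / \<rho>)) \<le> B * (1 * (1 / \<rho>))"
      using B[OF w] B0 r0 by (intro mult_mono) auto
    then show "norm (poly T w * (w powi (- int i) * (1 / w))) \<le> B / \<rho>"
      by (simp add: norm_mult norm_divide w)
  qed
  finally show ?thesis using r0 by simp
qed

text \<open>The images of the poles under Phi lie between r0 and r1, the range from a to b leaves
  room around these two circles, R is the radius of the outer contour, and A is holomorphic up to
  the larger radius \<rho>0. Keeping \<rho>0 finite treats bounded and unbounded canonical domains
  alike.\<close>

locale montessus = ratio_orthonormal E Phi \<mu> p + annulus a r0 r1 b xs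
  for E Phi \<mu> p a r0 r1 b xs +
  fixes m :: nat and lam :: "nat \<Rightarrow> complex" and A F :: "complex \<Rightarrow> complex" and R \<rho>0 :: real
  assumes m: "m \<ge> 1" and lam_notin: "\<And>k. k \<in> {1..m} \<Longrightarrow> lam k \<notin> E"
    and xs_def: "xs = map (\<lambda>k. Phi (lam k)) [1..<Suc m]"
    and bR: "b < R" "R < \<rho>0"
    and A_hol: "A holomorphic_on Dop \<rho>0" and A_nz: "\<And>k. k \<in> {1..m} \<Longrightarrow> A (lam k) \<noteq> 0"
    and F_eq: "\<And>z. z \<in> E \<Longrightarrow> F z = A z / (\<Prod>k\<in>{1..m}. z - lam k)"
begin

section \<open>The polynomial of the poles and its pullback\<close>

definition Qm :: "complex poly" where "Qm = (\<Prod>k\<in>{1..m}. [:- lam k, 1:])"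

abbreviation "nrm \<equiv> coeff_norm m"

lemma poly_Qm: "poly Qm z = (\<Prod>k\<in>{1..m}. z - lam k)"
  by (simp add: Qm_def poly_prod)

lemma Qm_0_iff: "poly Qm z = 0 \<longleftrightarrow> z \<in> lam ` {1..m}"
  by (auto simp: poly_Qm)

lemma degree_Qm: "degree Qm = m" and coeff_Qm: "coeff Qm m = 1"
proof -
  have "degree Qm = (\<Sum>k\<in>{1..m}. degree [:- lam k, 1:])"
    unfolding Qm_def by (intro degree_prod_eq_sum_degree) auto
  then show 1: "degree Qm = m" by simp
  have "lead_coeff Qm = 1" unfolding Qm_def lead_coeff_prod by simp
  with 1 show "coeff Qm m = 1" by simp
qed

lemma set_xs: "set xs = (\<lambda>k. Phi (lam k)) ` {1..m}"
  unfolding xs_def by (simp only: set_map set_upt atLeastLessThanSuc_atLeastAtMost)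

lemma node: "k \<in> {1..m} \<Longrightarrow> r0 < norm (Phi (lam k)) \<and> norm (Phi (lam k)) < r1"
  by (rule xs) (auto simp: set_xs)

lemma length_xs: "length xs = m" by (simp add: xs_def)

lemma W_prod: "W w = (\<Prod>k\<in>{1..m}. w - Phi (lam k))"
  using prod.distinct_set_conv_list[of "[1..<Suc m]" "\<lambda>k. w - Phi (lam k)"]
  by (simp add: nodes_def xs_def o_def atLeastLessThanSuc_atLeastAtMost del: upt_Suc)

lemma Psi_node: "k \<in> {1..m} \<Longrightarrow> Psi (Phi (lam k)) = lam k"
  by (rule Psi_Phi[OF lam_notin])

lemma params: "1 < r0" "r0 < r1" "r1 < R" "1 < R" "1 < r1" "1 < b" "0 < r1" "0 < R" "0 < r0"
  using ab bR by auto

text \<open>Pulling back z - lam k gives the linear factor \<open>w - Phi (lam k)\<close> times this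
  divided difference of \<open>Psi\<close>, which is zero-free by injectivity. Thus all zeros of the
  pulled-back \<open>Qm\<close> sit in the polynomial \<open>W\<close>.\<close>

definition lq :: "nat \<Rightarrow> complex \<Rightarrow> complex" where
  "lq k w = (if w = Phi (lam k) then deriv Psi (Phi (lam k)) else (Psi w - Psi (Phi (lam k))) / (w - Phi (lam k)))"

definition Lq :: "complex \<Rightarrow> complex" where "Lq w = (\<Prod>k\<in>{1..m}. lq k w)"

lemma lq_hol: "k \<in> {1..m} \<Longrightarrow> lq k holomorphic_on {w. 1 < norm w}"
  unfolding lq_def by (rule pole_lemma_open[OF Psi_hol open_exterior])

lemma Lq_hol: "Lq holomorphic_on {w. 1 < norm w}"
  unfolding Lq_def by (intro holomorphic_on_prod lq_hol)

lemma lq_nz: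
  assumes k: "k \<in> {1..m}" and w: "1 < norm w" shows "lq k w \<noteq> 0"
proof -
  have n: "1 < norm (Phi (lam k))" using node[OF k] params by simp
  show ?thesis
  proof (cases "w = Phi (lam k)")
    case True
    then show ?thesis using Psi_deriv_nz[OF n] by (simp add: lq_def)
  next
    case False
    then have "Psi w \<noteq> Psi (Phi (lam k))" using Phi_Psi[OF w] Phi_Psi[OF n] by metis
    then show ?thesis using False by (simp add: lq_def)
  qed
qed

lemma Lq_nz: "1 < norm w \<Longrightarrow> Lq w \<noteq> 0"
  using lq_nz by (auto simp: Lq_def)

lemma Qm_factor: "poly Qm (Psi w) = W w * Lq w"
proof -
  have "Psi w - lam k = (w - Phi (lam k)) * lq k w" if "k \<in> {1..m}" for k
    using Psi_node[OF that] by (auto simp: lq_def)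
  then show ?thesis by (simp add: poly_Qm W_prod Lq_def prod.distrib)
qed

text \<open>The integrand of \<open>\<langle>Q F, p_j\<rangle>\<close> pulled back by \<open>Psi\<close> is \<open>Q(Psi) sig_j B / W\<close>, with all poles in \<open>W\<close>.\<close>

definition B :: "complex \<Rightarrow> complex" where "B w = A (Psi w) * deriv Psi w / Lq w"

lemma B_hol: "B holomorphic_on oann 1 \<rho>0"
proof -
  have sub: "oann 1 \<rho>0 \<subseteq> {w. 1 < norm w}" by (auto simp: oann_def)
  have "Psi ` oann 1 \<rho>0 \<subseteq> Dop \<rho>0" using Psi_in_Dop by (auto simp: oann_def)
  then show ?thesis unfolding B_def using Lq_nz sub
    by (intro holomorphic_intros Psi_comp_hol[OF A_hol sub] holomorphic_on_subset[OF Psi_deriv_hol sub]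
        holomorphic_on_subset[OF Lq_hol sub]) auto
qed

lemma Omega_sub: "\<Omega> \<subseteq> oann 1 \<rho>0" "oann 1 \<rho>0 \<subseteq> {w. 1 < norm w}" "\<Omega> \<subseteq> {w. 1 < norm w}"
  using ab bR by (auto simp: oann_def)

lemma B_holO: "B holomorphic_on \<Omega>" by (rule holomorphic_on_subset[OF B_hol Omega_sub(1)])

lemma B_nz: "x \<in> set xs \<Longrightarrow> B x \<noteq> 0"
proof -
  assume "x \<in> set xs"
  then obtain k where k: "k \<in> {1..m}" "x = Phi (lam k)" by (auto simp: set_xs)
  have "1 < norm x" using node[OF k(1)] k(2) params by simp
  then show ?thesis using A_nz[OF k(1)] Lq_nz Psi_deriv_nz Psi_node[OF k(1)] by (simp add: B_def k(2))
qed

lemma F_Qm: "z \<in> E \<Longrightarrow> F z = A z / poly Qm z" using F_eq by (simp add: poly_Qm)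

lemma Qm_nz: "z \<in> E \<Longrightarrow> poly Qm z \<noteq> 0" using lam_notin by (auto simp: Qm_0_iff)

lemma F_cont: "continuous_on E F"
proof -
  have "E \<subseteq> Dop \<rho>0" by (rule Dcl_Dop)
  then have "continuous_on E (\<lambda>z. A z / poly Qm z)"
    using Qm_nz by (intro continuous_intros continuous_on_subset[OF holomorphic_on_imp_continuous_on[OF A_hol]]) auto
  then show ?thesis using F_Qm by (subst continuous_on_cong[OF refl]) auto
qed

section \<open>Moving the contour across the poles\<close>

definition Tset :: "complex set" where "Tset = Dop \<rho>0 - lam ` {1..m}"

lemma open_Tset: "open Tset"
  unfolding Tset_def using params bR by (intro open_Diff open_Dop finite_imp_closed) auto

lemma Dcl_r0_Tset: "Dcl r0 \<subseteq> Tset"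
proof -
  have "Dcl r0 \<subseteq> Dop \<rho>0" using params bR by (intro Dcl_Dop) simp
  moreover have "lam k \<notin> Dcl r0" if "k \<in> {1..m}" for k
    using node[OF that] lam_notin[OF that] by (auto simp: Dcl_def)
  ultimately show ?thesis by (auto simp: Tset_def)
qed

lemma Qm_Tset: "z \<in> Tset \<Longrightarrow> poly Qm z \<noteq> 0" by (auto simp: Tset_def Qm_0_iff)

lemma quot_hol: "(\<lambda>z. poly Q z * A z / poly Qm z) holomorphic_on Tset"
  using Qm_Tset by (intro holomorphic_intros poly_hol holomorphic_on_subset[OF A_hol]) (auto simp: Tset_def)

definition pQ :: "complex poly \<Rightarrow> complex \<Rightarrow> complex" where "pQ Q w = poly Q (Psi w)"

lemma pQ_hol: "pQ Q holomorphic_on {w. 1 < norm w}"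
  unfolding pQ_def by (rule Psi_comp_hol[OF poly_hol[of _ UNIV]]) auto

definition X :: "complex poly \<Rightarrow> nat \<Rightarrow> complex \<Rightarrow> complex" where
  "X Q j w = pQ Q w * sig j w * B w / W w"

text \<open>Up to the circle r0 the continuation of Q F is holomorphic, and its coefficient is an
  integral over that circle. Pushing the contour out to R crosses all the poles, which contributes
  the functional \<open>L\<close>; between r1 and R there are none.\<close>

lemma ip_split:
  "ip (\<lambda>z. poly Q z * F z) j = cint R (X Q j) - L (X Q j)"
proof -
  let ?H = "\<lambda>z. poly Q z * A z / poly Qm z"
  have "ip (\<lambda>z. poly Q z * F z) j = ip ?H j" by (rule ip_cong) (simp add: F_Qm)
  also have "\<dots> = cint r0 (\<lambda>w. ?H (Psi w) * deriv Psi w * sig j w)"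
    by (rule ip_eq_cint[OF quot_hol open_Tset Dcl_r0_Tset params(1)])
  also have "\<dots> = cint r0 (X Q j)"
  proof (rule cint_cong)
    fix w :: complex assume w: "norm w = r0"
    then have "Lq w \<noteq> 0" using params by (intro Lq_nz) simp
    moreover have "W w \<noteq> 0" using w by (intro W_nz) (simp add: circ_iff)
    ultimately show "?H (Psi w) * deriv Psi w * sig j w = X Q j w"
      by (simp add: X_def pQ_def B_def Qm_factor mult_ac)
  qed (use params in simp)
  also have "cint r1 (X Q j) = cint R (X Q j)"
  proof (rule cint_eq[where S="oann 1 \<rho>0 - set xs"])
    show "X Q j holomorphic_on oann 1 \<rho>0 - set xs"
      unfolding X_def using Omega_sub
      by (intro holomorphic_intros holomorphic_on_subset[OF pQ_hol] holomorphic_on_subset[OF sig_hol]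
          holomorphic_on_subset[OF B_hol] nodes_hol) (auto simp: nodes_eq_0_iff)
    show "open (oann 1 \<rho>0 - set xs)" by (intro open_Diff open_oann finite_imp_closed) auto
    show "w \<in> oann 1 \<rho>0 - set xs" if "r1 \<le> norm w" "norm w \<le> R" for w
      using that xs[of w] params bR by (auto simp: oann_def)
  qed (use params in auto)
  then have "cint r0 (X Q j) = cint R (X Q j) - L (X Q j)" by (simp add: Lf_def)
  finally show ?thesis .
qed

lemma pQ_bound:
  obtains C where "C > 0" "\<And>Q w. degree Q \<le> m \<Longrightarrow> r0 \<le> norm w \<Longrightarrow> norm w \<le> R \<Longrightarrow> norm (pQ Q w) \<le> C * nrm Q"
proof -
  obtain M where M: "\<And>z. z \<in> Psi ` ann r0 R \<Longrightarrow> norm z \<le> M"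
    using compact_imp_bounded[OF compact_Psi_ann[OF params(1)]] by (fastforce simp: bounded_iff)
  define M' where "M' = max 1 M"
  show ?thesis
  proof (rule that[of "(real m + 1) * M' ^ m"])
    show "0 < (real m + 1) * M' ^ m" by (intro mult_pos_pos zero_less_power) (auto simp: M'_def)
    fix Q :: "complex poly" and w :: complex
    assume "degree Q \<le> m" "r0 \<le> norm w" "norm w \<le> R"
    then show "norm (pQ Q w) \<le> (real m + 1) * M' ^ m * nrm Q"
      unfolding pQ_def using M[of "Psi w"]
      by (intro norm_poly_le_coeff_norm) (auto simp: M'_def ann_def le_max_iff_disj)
  qed
qed

text \<open>On the circle of radius R the functions \<open>sig j\<close> decay at any rate above
  1/R; the other factors of the integrand are fixed or controlled by the coefficients of Q.\<close>

lemma outer_bound: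
  assumes \<tau>: "1 / R < \<tau>"
  obtains C where "C > 0" "\<And>Q j. degree Q \<le> m \<Longrightarrow> norm (cint R (X Q j)) \<le> C * nrm Q * \<tau> ^ j"
proof -
  obtain C1 where C1: "C1 > 0" "\<And>Q w. degree Q \<le> m \<Longrightarrow> r0 \<le> norm w \<Longrightarrow> norm w \<le> R \<Longrightarrow> norm (pQ Q w) \<le> C1 * nrm Q"
    using pQ_bound by metis
  obtain C2 where C2: "C2 > 0" "\<And>n w. w \<in> ann R R \<Longrightarrow> norm (sig n w) \<le> C2 * \<tau> ^ n"
    using sig_upper[OF params(4) \<tau>] by metis
  have sub: "sphere 0 R \<subseteq> oann 1 \<rho>0" using params bR by (auto simp: oann_def)
  have Wn: "W w \<noteq> 0" if "w \<in> sphere 0 R" for w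
    using that xs[of w] params by (auto simp: nodes_eq_0_iff)
  have cBW: "continuous_on (sphere 0 R) (\<lambda>w. B w / W w)"
    using Wn by (intro continuous_intros holomorphic_on_imp_continuous_on[OF nodes_hol]
        continuous_on_subset[OF holomorphic_on_imp_continuous_on[OF B_hol] sub]) auto
  obtain C3 where C3: "\<And>w. w \<in> sphere 0 R \<Longrightarrow> norm (B w / W w) \<le> C3"
    using compact_imp_bounded[OF compact_continuous_image[OF cBW compact_sphere]] by (fastforce simp: bounded_iff)
  have \<tau>0: "0 < \<tau>" using \<tau> params by (smt (verit) divide_pos_pos)
  show ?thesis
  proof (rule that[of "R * (C1 * C2 * (\<bar>C3\<bar> + 1))"])
    show "0 < R * (C1 * C2 * (\<bar>C3\<bar> + 1))" using C1 C2 params by (intro mult_pos_pos) auto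
    fix Q :: "complex poly" and j assume Q: "degree Q \<le> m"
    have "norm (cint R (X Q j)) \<le> R * (C1 * nrm Q * (C2 * \<tau> ^ j) * (\<bar>C3\<bar> + 1))"
    proof (rule norm_cint_le[OF params(8)])
      have "continuous_on (sphere 0 R) (\<lambda>w. pQ Q w * sig j w * (B w / W w))"
        using params by (intro continuous_on_mult cBW sig_cont
            continuous_on_subset[OF holomorphic_on_imp_continuous_on[OF pQ_hol]]) auto
      then show "continuous_on (sphere 0 R) (X Q j)" by (simp add: X_def[abs_def])
      fix w :: complex assume w: "norm w = R"
      have "norm (pQ Q w * sig j w * (B w / W w)) \<le> C1 * nrm Q * (C2 * \<tau> ^ j) * (\<bar>C3\<bar> + 1)"
        unfolding norm_mult
        using C1(2)[OF Q, of w] C2(2)[of w j] C3[of w] w params C1 C2 \<tau>0 coeff_norm_nonneg[of m Q]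
        by (intro mult_mono) (auto simp: ann_def intro!: mult_nonneg_nonneg)
      then show "norm (X Q j w) \<le> C1 * nrm Q * (C2 * \<tau> ^ j) * (\<bar>C3\<bar> + 1)"
        by (simp add: X_def)
    qed
    then show "norm (cint R (X Q j)) \<le> R * (C1 * C2 * (\<bar>C3\<bar> + 1)) * nrm Q * \<tau> ^ j"
      by (simp add: mult_ac)
  qed
qed

text \<open>The part of the Pade conditions that does not involve P, which is orthogonal to
  \<open>p j\<close> for j > n. Without a normalization these Q form a linear space, so differences
  of solutions are covered.\<close>

definition orthQ :: "nat \<Rightarrow> complex poly \<Rightarrow> bool" where
  "orthQ n Q \<longleftrightarrow> degree Q \<le> m \<and> (\<forall>j\<in>{n+1..n+m}. ip (\<lambda>z. poly Q z * F z) j = 0)"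

section \<open>Estimates drawn from the orthogonality relations\<close>

lemma circ_ann: "circ \<subseteq> ann r0 r1" "\<Omega> \<subseteq> ann a b"
  using ab by (auto simp: circ_iff ann_def oann_def)

lemma sig_holO: "sig n holomorphic_on \<Omega>"
  by (rule holomorphic_on_subset[OF sig_hol Omega_sub(3)])

lemma pQ_holO: "pQ Q holomorphic_on \<Omega>"
  by (rule holomorphic_on_subset[OF pQ_hol Omega_sub(3)])

text \<open>This is \<open>L_control\<close> with y = \<open>pQ Q * sig n\<close> and
  \<open>h i\<close> = \<open>sig (n + i) / sig n\<close>. The relation for j = n + i makes the
  residue functional at \<open>h i\<close> equal to an integral over the outer circle, which is
  exponentially small.\<close>

lemma main_estimate:
  assumes \<tau>: "1 / R < \<tau>" "\<tau> < 1"
  obtains C where "C > 0" "eventually (\<lambda>n. \<forall>Q. orthQ n Q \<longrightarrow> (\<forall>g M. g holomorphic_on \<Omega> \<longrightarrow>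
      (\<forall>w\<in>circ. norm (g w) \<le> M) \<longrightarrow>
      norm (L (\<lambda>w. pQ Q w * sig n w * B w * g w / W w)) \<le> C * nrm Q * \<tau> ^ n * M)) sequentially"
proof -
  obtain C0 \<epsilon> where C0: "C0 > 0" "\<epsilon> > 0" and ctl:
    "\<And>y h \<delta> g M. y holomorphic_on \<Omega> \<Longrightarrow> (\<And>i. i \<in> {1..m} \<Longrightarrow> h i holomorphic_on \<Omega>) \<Longrightarrow>
       (\<And>i w. i \<in> {1..m} \<Longrightarrow> w \<in> circ \<Longrightarrow> norm (w powi (- int i) - h i w) \<le> \<epsilon>) \<Longrightarrow>
       (\<And>i. i \<in> {1..m} \<Longrightarrow> norm (L (\<lambda>w. y w * B w * h i w / W w)) \<le> \<delta>) \<Longrightarrow>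
       g holomorphic_on \<Omega> \<Longrightarrow> (\<And>w. w \<in> circ \<Longrightarrow> norm (g w) \<le> M) \<Longrightarrow>
       norm (L (\<lambda>w. y w * B w * g w / W w)) \<le> C0 * \<delta> * M"
    by (rule L_control[OF B_holO length_xs[symmetric] m]) blast
  obtain C1 where C1: "C1 > 0" "\<And>Q j. degree Q \<le> m \<Longrightarrow> norm (cint R (X Q j)) \<le> C1 * nrm Q * \<tau> ^ j"
    using outer_bound[OF \<tau>(1)] by metis
  have \<tau>0: "0 < \<tau>" using \<tau> params by (smt (verit) divide_pos_pos)
  have ev1: "eventually (\<lambda>n. \<forall>i\<in>{1..m}. \<forall>w\<in>ann r0 r1. dist (sig (n + i) w / sig n w) (w powi (- int i)) < \<epsilon>) sequentially"
    using C0 by (intro eventually_ball_finite ballI uniform_limitD[OF sig_ratio[OF params(1)]]) auto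
  have ev2: "eventually (\<lambda>n. \<forall>w\<in>ann a b. sig n w \<noteq> 0) sequentially"
    using ab by (intro sig_nz) auto
  show ?thesis
  proof (rule that[of "C0 * C1"])
    show "0 < C0 * C1" using C0 C1 by simp
    show "eventually (\<lambda>n. \<forall>Q. orthQ n Q \<longrightarrow> (\<forall>g M. g holomorphic_on \<Omega> \<longrightarrow>
      (\<forall>w\<in>circ. norm (g w) \<le> M) \<longrightarrow>
      norm (L (\<lambda>w. pQ Q w * sig n w * B w * g w / W w)) \<le> C0 * C1 * nrm Q * \<tau> ^ n * M)) sequentially"
      using ev1 ev2
    proof eventually_elim
      case (elim n)
      show ?case
      proof (intro allI impI)
        fix Q g M assume Q: "orthQ n Q" and g: "g holomorphic_on \<Omega>" and M: "\<forall>w\<in>circ. norm (g w) \<le> M"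
        have dQ: "degree Q \<le> m" using Q by (simp add: orthQ_def)
        have sn: "sig n w \<noteq> 0" if "w \<in> \<Omega>" for w using elim(2) that circ_ann by blast
        have "norm (L (\<lambda>w. (pQ Q w * sig n w) * B w * g w / W w)) \<le> C0 * (C1 * nrm Q * \<tau> ^ n) * M"
        proof (rule ctl[where h="\<lambda>i w. sig (n + i) w / sig n w"])
          show "(\<lambda>w. pQ Q w * sig n w) holomorphic_on \<Omega>"
            by (intro holomorphic_intros pQ_holO sig_holO)
          show "(\<lambda>w. sig (n + i) w / sig n w) holomorphic_on \<Omega>" for i
            using sn by (intro holomorphic_intros sig_holO) auto
          show "norm (w powi - int i - sig (n + i) w / sig n w) \<le> \<epsilon>" if "i \<in> {1..m}" "w \<in> circ" for i w
          proof -
            have "w \<in> ann r0 r1" using that(2) circ_ann by blast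
            then show ?thesis using elim(1) that(1) by (metis dist_commute dist_norm less_imp_le)
          qed
          show "norm (L (\<lambda>w. pQ Q w * sig n w * B w * (sig (n + i) w / sig n w) / W w)) \<le> C1 * nrm Q * \<tau> ^ n"
            if i: "i \<in> {1..m}" for i
          proof -
            have "L (\<lambda>w. pQ Q w * sig n w * B w * (sig (n + i) w / sig n w) / W w) = L (X Q (n + i))"
              using sn circ_sub by (intro L_cong) (auto simp: X_def)
            also have "\<dots> = cint R (X Q (n + i))"
              using ip_split[of Q "n + i"] Q i by (simp add: orthQ_def)
            also have "norm \<dots> \<le> C1 * nrm Q * \<tau> ^ (n + i)" by (rule C1(2)[OF dQ])
            also have "\<dots> \<le> C1 * nrm Q * \<tau> ^ n"
              using C1 coeff_norm_nonneg[of m Q] \<tau> \<tau>0 by (intro mult_left_mono power_decreasing) auto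
            finally show ?thesis .
          qed
        qed (use g M in auto)
        then show "norm (L (\<lambda>w. pQ Q w * sig n w * B w * g w / W w)) \<le> C0 * C1 * nrm Q * \<tau> ^ n * M"
          by (simp add: mult_ac)
      qed
    qed
  qed
qed

text \<open>The integral over the outer circle has the rate \<tau>^(n+i); the residue part is
  \<open>main_estimate\<close> at g = \<open>sig (n + i) / sig n\<close>, of size q^i. The separate
  factor q^i allows summation over i.\<close>

lemma tail_coeffs:
  assumes \<tau>: "1 / R < \<tau>" "\<tau> \<le> q" and q: "1 / r0 < q" "q < 1"
  obtains C where "C > 0" "eventually (\<lambda>n. \<forall>Q. orthQ n Q \<longrightarrow>
     (\<forall>i. norm (ip (\<lambda>z. poly Q z * F z) (n + i)) \<le> C * nrm Q * \<tau> ^ n * q ^ i)) sequentially"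
proof -
  have \<tau>1: "\<tau> < 1" using \<tau> q by simp
  have \<tau>0: "0 < \<tau>" using \<tau> params by (smt (verit) divide_pos_pos)
  obtain C0 where C0: "C0 > 0" and ev0: "eventually (\<lambda>n. \<forall>Q. orthQ n Q \<longrightarrow> (\<forall>g M. g holomorphic_on \<Omega> \<longrightarrow>
      (\<forall>w\<in>circ. norm (g w) \<le> M) \<longrightarrow>
      norm (L (\<lambda>w. pQ Q w * sig n w * B w * g w / W w)) \<le> C0 * nrm Q * \<tau> ^ n * M)) sequentially"
    by (rule main_estimate[OF \<tau>(1) \<tau>1])
  obtain C1 where C1: "C1 > 0" "\<And>Q j. degree Q \<le> m \<Longrightarrow> norm (cint R (X Q j)) \<le> C1 * nrm Q * \<tau> ^ j"
    using outer_bound[OF \<tau>(1)] by metis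
  have ev1: "eventually (\<lambda>n. \<forall>k. \<forall>w\<in>ann r0 r1. sig n w \<noteq> 0 \<and> norm (sig (n + k) w) \<le> q ^ k * norm (sig n w)) sequentially"
    by (rule sig_tail[OF params(1) q(1)])
  have ev2: "eventually (\<lambda>n. \<forall>w\<in>ann a b. sig n w \<noteq> 0) sequentially"
    using ab by (intro sig_nz) auto
  show ?thesis
  proof (rule that[of "C0 + C1"])
    show "0 < C0 + C1" using C0 C1 by simp
    show "eventually (\<lambda>n. \<forall>Q. orthQ n Q \<longrightarrow>
      (\<forall>i. norm (ip (\<lambda>z. poly Q z * F z) (n + i)) \<le> (C0 + C1) * nrm Q * \<tau> ^ n * q ^ i)) sequentially"
      using ev0 ev1 ev2
    proof eventually_elim
      case (elim n)
      show ?case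
      proof (intro allI impI)
        fix Q i assume Q: "orthQ n Q"
        have dQ: "degree Q \<le> m" using Q by (simp add: orthQ_def)
        have sn: "sig n w \<noteq> 0" if "w \<in> \<Omega>" for w using elim(3) that circ_ann by blast
        have hol: "(\<lambda>w. sig (n + i) w / sig n w) holomorphic_on \<Omega>"
          using sn by (intro holomorphic_intros sig_holO) auto
        have bd: "\<forall>w\<in>circ. norm (sig (n + i) w / sig n w) \<le> q ^ i"
        proof
          fix w assume "w \<in> circ"
          then have "w \<in> ann r0 r1" using circ_ann by blast
          then have "sig n w \<noteq> 0" "norm (sig (n + i) w) \<le> q ^ i * norm (sig n w)" using elim(2) by auto
          then show "norm (sig (n + i) w / sig n w) \<le> q ^ i" by (simp add: norm_divide field_simps)
        qed
        have "L (X Q (n + i)) = L (\<lambda>w. pQ Q w * sig n w * B w * (sig (n + i) w / sig n w) / W w)"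
          using sn circ_sub by (intro L_cong) (auto simp: X_def)
        moreover have "norm (L (\<lambda>w. pQ Q w * sig n w * B w * (sig (n + i) w / sig n w) / W w)) \<le> C0 * nrm Q * \<tau> ^ n * q ^ i"
          using elim(1) Q hol bd by blast
        ultimately have 1: "norm (L (X Q (n + i))) \<le> C0 * nrm Q * \<tau> ^ n * q ^ i" by (simp only:)
        have "norm (cint R (X Q (n + i))) \<le> C1 * nrm Q * \<tau> ^ (n + i)" by (rule C1(2)[OF dQ])
        also have "\<dots> = C1 * nrm Q * \<tau> ^ n * \<tau> ^ i" by (simp add: power_add mult.assoc)
        also have "\<dots> \<le> C1 * nrm Q * \<tau> ^ n * q ^ i"
          using C1 coeff_norm_nonneg[of m Q] \<tau> \<tau>0 by (intro mult_left_mono power_mono mult_nonneg_nonneg) auto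
        finally have 2: "norm (cint R (X Q (n + i))) \<le> C1 * nrm Q * \<tau> ^ n * q ^ i" .
        have "norm (ip (\<lambda>z. poly Q z * F z) (n + i)) \<le> norm (cint R (X Q (n + i))) + norm (L (X Q (n + i)))"
          unfolding ip_split by (rule norm_triangle_ineq4)
        also have "\<dots> \<le> (C0 + C1) * nrm Q * \<tau> ^ n * q ^ i" using 1 2 by (simp add: algebra_simps)
        finally show "norm (ip (\<lambda>z. poly Q z * F z) (n + i)) \<le> (C0 + C1) * nrm Q * \<tau> ^ n * q ^ i" .
      qed
    qed
  qed
qed

text \<open>Modulo the nodes B has an inverse b', so g = \<open>b' * h / sig n\<close> strips the
  factor \<open>sig n * B\<close>. Dividing by \<open>sig n\<close> costs \<kappa>^(-n) with
  1/\<kappa> > r1; here the rate of the denominators drops from 1/R to r1/R.\<close>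

lemma small_modulo:
  assumes \<tau>: "1 / R < \<tau>" "\<tau> < 1" and \<kappa>: "0 < \<kappa>" "\<kappa> < 1 / r1"
  obtains C where "C > 0" "eventually (\<lambda>n. \<forall>Q. orthQ n Q \<longrightarrow> (\<forall>h M. h holomorphic_on \<Omega> \<longrightarrow>
      (\<forall>w\<in>circ. norm (h w) \<le> M) \<longrightarrow>
      norm (L (\<lambda>w. pQ Q w * h w / W w)) \<le> C * nrm Q * (\<tau> / \<kappa>) ^ n * M)) sequentially"
proof -
  have \<tau>0: "0 < \<tau>" using \<tau> params by (smt (verit) divide_pos_pos)
  obtain C0 where C0: "C0 > 0" and ev0: "eventually (\<lambda>n. \<forall>Q. orthQ n Q \<longrightarrow> (\<forall>g M. g holomorphic_on \<Omega> \<longrightarrow>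
      (\<forall>w\<in>circ. norm (g w) \<le> M) \<longrightarrow>
      norm (L (\<lambda>w. pQ Q w * sig n w * B w * g w / W w)) \<le> C0 * nrm Q * \<tau> ^ n * M)) sequentially"
    by (rule main_estimate[OF \<tau>])
  have "x \<in> \<Omega> \<and> B x \<noteq> 0" if "x \<in> set xs" for x
    using B_nz[OF that] xs[OF that] ab by (auto simp: oann_def)
  then obtain b' k where b': "b' holomorphic_on \<Omega>" "k holomorphic_on \<Omega>"
    "\<And>w. w \<in> \<Omega> \<Longrightarrow> B w * b' w = 1 + W w * k w"
    using inverse_modulo_nodes[OF B_holO open_oann, of xs] by blast
  have cc: "compact circ" unfolding circ_def by (intro compact_Un compact_sphere)
  obtain C1 where C1: "\<And>w. w \<in> circ \<Longrightarrow> norm (b' w) \<le> C1"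
    using compact_imp_bounded[OF compact_continuous_image[OF hol_cont[OF b'(1)] cc]] by (fastforce simp: bounded_iff)
  have r01: "r0 \<le> r1" using params by simp
  obtain c where c: "c > 0" and ev1: "eventually (\<lambda>n. \<forall>w\<in>ann r0 r1. c * \<kappa> ^ n \<le> norm (sig n w)) sequentially"
    by (rule sig_lower[OF params(1) r01 \<kappa>])
  have ev2: "eventually (\<lambda>n. \<forall>w\<in>ann a b. sig n w \<noteq> 0) sequentially"
    using ab by (intro sig_nz) auto
  define C where "C = C0 * (\<bar>C1\<bar> + 1) / c"
  show ?thesis
  proof (rule that[of C])
    show "0 < C" unfolding C_def using C0 c by (intro divide_pos_pos mult_pos_pos) auto
    show "eventually (\<lambda>n. \<forall>Q. orthQ n Q \<longrightarrow> (\<forall>h M. h holomorphic_on \<Omega> \<longrightarrow>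
      (\<forall>w\<in>circ. norm (h w) \<le> M) \<longrightarrow>
      norm (L (\<lambda>w. pQ Q w * h w / W w)) \<le> C * nrm Q * (\<tau> / \<kappa>) ^ n * M)) sequentially"
      using ev0 ev1 ev2
    proof eventually_elim
      case (elim n)
      show ?case
      proof (intro allI impI)
        fix Q h M assume Q: "orthQ n Q" and h: "h holomorphic_on \<Omega>" and M: "\<forall>w\<in>circ. norm (h w) \<le> M"
        have M0: "0 \<le> M" using M circ_iff[of "of_real r0"] params by (force intro: order_trans[OF norm_ge_zero])
        have sn: "sig n w \<noteq> 0" if "w \<in> \<Omega>" for w using elim(3) that circ_ann by blast
        define g where "g w = b' w * h w / sig n w" for w
        have g: "g holomorphic_on \<Omega>" unfolding g_def using sn by (intro holomorphic_intros b' h sig_holO) auto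
        have gb: "\<forall>w\<in>circ. norm (g w) \<le> (\<bar>C1\<bar> + 1) * M / (c * \<kappa> ^ n)"
        proof
          fix w assume w: "w \<in> circ"
          then have "c * \<kappa> ^ n \<le> norm (sig n w)" using elim(2) circ_ann by blast
          moreover have "norm (b' w) * norm (h w) \<le> (\<bar>C1\<bar> + 1) * M"
            using C1[OF w] M w by (intro mult_mono) auto
          ultimately show "norm (g w) \<le> (\<bar>C1\<bar> + 1) * M / (c * \<kappa> ^ n)"
            unfolding g_def norm_divide norm_mult using c \<kappa> M0 by (intro frac_le) auto
        qed
        have "L (\<lambda>w. pQ Q w * sig n w * B w * g w / W w) = L (\<lambda>w. pQ Q w * h w / W w + pQ Q w * h w * k w)"
        proof (rule L_cong)
          fix w assume w: "w \<in> circ"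
          then have w\<Omega>: "w \<in> \<Omega>" using circ_sub by blast
          have "pQ Q w * sig n w * B w * g w = pQ Q w * h w * (B w * b' w)"
            using sn[OF w\<Omega>] by (simp add: g_def)
          then have "pQ Q w * sig n w * B w * g w / W w = pQ Q w * h w * (1 + W w * k w) / W w"
            by (simp only: b'(3)[OF w\<Omega>])
          then show "pQ Q w * sig n w * B w * g w / W w = pQ Q w * h w / W w + pQ Q w * h w * k w"
            using W_nz[OF w] by (simp add: field_simps)
        qed
        also have "\<dots> = L (\<lambda>w. pQ Q w * h w / W w) + L (\<lambda>w. pQ Q w * h w * k w)"
          by (intro L_add hol_cont_div hol_cont holomorphic_intros pQ_holO h b')
        also have "L (\<lambda>w. pQ Q w * h w * k w) = 0"
          by (intro L_hol holomorphic_intros pQ_holO h b')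
        finally have "norm (L (\<lambda>w. pQ Q w * h w / W w)) = norm (L (\<lambda>w. pQ Q w * sig n w * B w * g w / W w))" by simp
        also have "\<dots> \<le> C0 * nrm Q * \<tau> ^ n * ((\<bar>C1\<bar> + 1) * M / (c * \<kappa> ^ n))"
          using elim(1) Q g gb by blast
        also have "\<dots> = C * nrm Q * (\<tau> / \<kappa>) ^ n * M" by (simp add: C_def power_divide field_simps)
        finally show "norm (L (\<lambda>w. pQ Q w * h w / W w)) \<le> C * nrm Q * (\<tau> / \<kappa>) ^ n * M" .
      qed
    qed
  qed
qed

text \<open>The remainder \<open>T\<close> of \<open>Q\<close> modulo \<open>Qm\<close> is recovered from residues with the kernel
  \<open>(Qm(z) - Qm(\<zeta>)) / (z - \<zeta>)\<close>.\<close>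

lemma recovery:
  assumes Q: "degree Q \<le> m"
  defines "T \<equiv> Q - smult (coeff Q m) Qm"
  shows "L (\<lambda>w. pQ Q w * (pQ (synthetic_div Qm \<zeta>) w * deriv Psi w / Lq w) / W w) = poly T \<zeta>"
proof -
  let ?\<chi> = "synthetic_div Qm \<zeta>" and ?c = "coeff Q m"
  have degT: "degree T < m \<or> T = 0"
  proof -
    have "degree T \<le> m" unfolding T_def using Q degree_Qm
      by (intro degree_diff_le order_trans[OF degree_smult_le]) auto
    moreover have "coeff T m = 0" by (simp add: T_def coeff_Qm)
    ultimately show ?thesis by (metis leading_coeff_0_iff le_neq_implies_less)
  qed
  have QT: "poly Q z = ?c * poly Qm z + poly T z" for z by (simp add: T_def)
  define H where "H z = poly T z * poly ?\<chi> z / poly Qm z" for z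
  have Hhol: "H holomorphic_on Tset"
    unfolding H_def using Qm_Tset by (intro holomorphic_intros poly_hol) auto
  define wm where "wm = Max ((\<lambda>k. norm (Phi (lam k))) ` {1..m})"
  have wm: "norm (Phi (lam k)) \<le> wm" if "k \<in> {1..m}" for k unfolding wm_def using that by (intro Max_ge) auto
  have wm1: "1 < wm" using wm[of 1] node[of 1] m params by simp
  have wmr: "wm < r1" unfolding wm_def using node m by (subst Max_less_iff) auto
  have Qnz: "poly Qm (Psi w) \<noteq> 0" if "wm < norm w" for w
  proof
    assume "poly Qm (Psi w) = 0"
    then obtain k where k: "k \<in> {1..m}" "Psi w = lam k" by (auto simp: Qm_0_iff)
    then have "w = Phi (lam k)" using Phi_Psi[of w] that wm1 by simp
    then show False using wm[OF k(1)] that by simp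
  qed
  define h where "h w = H (Psi w) * deriv Psi w" for w
  have sub: "{w::complex. wm < norm w} \<subseteq> {w. 1 < norm w}" using wm1 by auto
  have hhol: "h holomorphic_on {w. wm < norm w}"
    unfolding h_def H_def using Qnz
    by (intro holomorphic_intros holomorphic_on_subset[OF Psi_deriv_hol sub] Psi_comp_hol[OF poly_hol[of _ UNIV] sub]) auto
  \<comment> \<open>In Q = c Qm + T the multiple of \<open>Qm\<close> cancels the denominator and
    leaves a holomorphic term, which has no residues.\<close>
  have "L (\<lambda>w. pQ Q w * (pQ ?\<chi> w * deriv Psi w / Lq w) / W w) = L (\<lambda>w. ?c * (pQ ?\<chi> w * deriv Psi w) + h w)"
  proof (rule L_cong)
    fix w assume w: "w \<in> circ"
    then have "1 < norm w" using params by (auto simp: circ_iff)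
    then have nz: "Lq w \<noteq> 0" "W w \<noteq> 0" using Lq_nz W_nz[OF w] by auto
    have "pQ Q w * (pQ ?\<chi> w * deriv Psi w / Lq w) / W w = pQ Q w / (W w * Lq w) * pQ ?\<chi> w * deriv Psi w"
      by (simp add: mult_ac)
    also have "pQ Q w / (W w * Lq w) = ?c + poly T (Psi w) / poly Qm (Psi w)"
      using nz by (simp add: pQ_def QT Qm_factor add_divide_distrib)
    finally show "pQ Q w * (pQ ?\<chi> w * deriv Psi w / Lq w) / W w = ?c * (pQ ?\<chi> w * deriv Psi w) + h w"
      by (simp add: h_def H_def pQ_def distrib_right mult.assoc) 
  qed
  also have "\<dots> = L (\<lambda>w. ?c * (pQ ?\<chi> w * deriv Psi w)) + L h"
  proof (rule L_add)
    show "continuous_on circ (\<lambda>w. ?c * (pQ ?\<chi> w * deriv Psi w))"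
      by (intro hol_cont holomorphic_intros pQ_holO holomorphic_on_subset[OF Psi_deriv_hol Omega_sub(3)])
    have "continuous_on (sphere 0 r0) h"
    proof -
      have "Psi ` sphere 0 r0 \<subseteq> Tset" using Dcl_r0_Tset Psi_in_Dcl[of _ r0] params by auto
      then show ?thesis unfolding h_def using params
        by (intro continuous_intros holomorphic_on_imp_continuous_on[OF Psi_comp_hol[OF Hhol]]
          continuous_on_subset[OF holomorphic_on_imp_continuous_on[OF Psi_deriv_hol]]) auto
    qed
    moreover have "continuous_on (sphere 0 r1) h"
      by (rule continuous_on_subset[OF holomorphic_on_imp_continuous_on[OF hhol]]) (use wmr in auto)
    ultimately show "continuous_on circ h" unfolding circ_def by (intro continuous_on_closed_Un) auto
  qed
  also have "L (\<lambda>w. ?c * (pQ ?\<chi> w * deriv Psi w)) = 0"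
    by (intro L_hol holomorphic_intros pQ_holO holomorphic_on_subset[OF Psi_deriv_hol Omega_sub(3)])
  \<comment> \<open>The inner circle contributes nothing, since H is holomorphic on
    \<open>Dcl r0\<close>.\<close>
  also have "L h = cint r1 h"
    unfolding Lf_def h_def using Cauchy_exterior_zero[OF Hhol open_Tset Dcl_r0_Tset params(1)] by simp
  also have "cint r1 h = poly T \<zeta>"
  proof -
    \<comment> \<open>The circle is enlarged until its image surrounds \<zeta>; beyond the radius wm
      no zero of the pulled-back \<open>Qm\<close> is crossed.\<close>
    define s1 where "s1 = (if \<zeta> \<in> E then wm else max wm (norm (Phi \<zeta>)))"
    define r2 where "r2 = max r1 (s1 + 1)"
    have s1: "wm \<le> s1" "s1 < r2" "r1 \<le> r2" by (auto simp: s1_def r2_def)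
    have r2: "1 < r2" "0 < r2" using s1 params by auto
    have \<zeta>D: "\<zeta> \<in> Dop r2" using s1 by (auto simp: Dop_def s1_def)
    have ne: "Psi w \<noteq> \<zeta>" if "s1 < norm w" for w
      using that s1 wm1 Psi_notin[of w] Phi_Psi[of w] by (auto simp: s1_def split: if_splits)
    have "cint r1 h = cint r2 h"
      by (rule cint_eq[OF hhol open_exterior]) (use s1 params wmr in auto)
    define f1 where "f1 w = poly T (Psi w) * deriv Psi w / (Psi w - \<zeta>)" for w
    define f2 where "f2 w = deriv Psi w / (Psi w - \<zeta>) * (poly T (Psi w) / poly Qm (Psi w))" for w
    have sub1: "{w::complex. s1 < norm w} \<subseteq> {w. 1 < norm w}" using wm1 s1 by auto
    have f12: "f1 holomorphic_on {w. s1 < norm w}" "f2 holomorphic_on {w. s1 < norm w}"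
      unfolding f1_def f2_def using ne Qnz s1
      by (intro holomorphic_intros holomorphic_on_subset[OF Psi_deriv_hol sub1]
          holomorphic_on_subset[OF Psi_hol sub1] Psi_comp_hol[OF poly_hol[of _ UNIV] sub1]; force)+
    have c12: "continuous_on (sphere 0 r2) f1" "continuous_on (sphere 0 r2) f2"
      using f12 s1 by (auto intro!: continuous_on_subset[OF holomorphic_on_imp_continuous_on])
    have "cint r2 h = cint r2 (\<lambda>w. f1 w - poly Qm \<zeta> * f2 w)"
    proof (rule cint_cong[OF r2(2)])
      fix w :: complex assume w: "norm w = r2"
      then have n: "Psi w - \<zeta> \<noteq> 0" "poly Qm (Psi w) \<noteq> 0" using ne[of w] Qnz[of w] s1 by auto
      have "poly Qm (Psi w) - poly Qm \<zeta> = (Psi w - \<zeta>) * poly ?\<chi> (Psi w)"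
        using arg_cong[OF synthetic_div_correct'[of \<zeta> Qm], of "\<lambda>q. poly q (Psi w)"] by (simp add: algebra_simps)
      then have "poly ?\<chi> (Psi w) = (poly Qm (Psi w) - poly Qm \<zeta>) / (Psi w - \<zeta>)" using n by simp
      moreover have "t * ((q - c) / x) / q * d = t * d / x - c * (d / x * (t / q))"
        if "x \<noteq> 0" "q \<noteq> 0" for t q c x d :: complex
        using that by (simp add: field_simps)
      ultimately show "h w = f1 w - poly Qm \<zeta> * f2 w"
        using n by (simp only: h_def H_def f1_def f2_def simp_thms)
    qed
    also have "\<dots> = cint r2 f1 - poly Qm \<zeta> * cint r2 f2"
      using r2 c12 by (subst cint_diff; (subst cint_cmult)?) (auto intro!: continuous_on_mult_left)
    also have "cint r2 f1 = poly T \<zeta>"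
      unfolding f1_def by (rule Cauchy_exterior[OF poly_hol[of _ UNIV] open_UNIV _ r2(1) \<zeta>D]) simp
    \<comment> \<open>The degree of T is below m, so the integrand decays faster than 1/w at
      infinity.\<close>
    also have "cint r2 f2 = 0"
    proof (rule cint_limit_at_infinity[OF f12(2) r2(2) s1(2)])
      have "((\<lambda>z. poly T z / poly Qm z) \<longlongrightarrow> 0) at_infinity"
        using degT degree_Qm by (cases "T = 0") (auto intro: poly_divide_tendsto_0_at_infinity)
      then have "((\<lambda>w. poly T (Psi w) / poly Qm (Psi w)) \<longlongrightarrow> 0) at_infinity"
        by (rule filterlim_compose[OF _ Psi_at_infinity])
      then have "((\<lambda>w. (w * (deriv Psi w / (Psi w - \<zeta>))) * (poly T (Psi w) / poly Qm (Psi w))) \<longlongrightarrow> 1 * 0) at_infinity"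
        by (intro tendsto_mult Psi_kernel_limit)
      then show "((\<lambda>w. w * f2 w) \<longlongrightarrow> 0) at_infinity" by (simp add: f2_def mult.assoc)
    qed
    finally show ?thesis using \<open>cint r1 h = cint r2 h\<close> by simp
  qed
  finally show ?thesis by simp
qed

text \<open>The coefficients of the remainder are controlled by its values on one large circle, and
  each such value is a residue functional by \<open>recovery\<close>.\<close>

lemma Q_mod_small:
  assumes \<tau>: "1 / R < \<tau>" "\<tau> < 1" and \<kappa>: "0 < \<kappa>" "\<kappa> < 1 / r1"
  obtains C where "C > 0" "eventually (\<lambda>n. \<forall>Q. orthQ n Q \<longrightarrow>
      nrm (Q - smult (coeff Q m) Qm) \<le> C * nrm Q * (\<tau> / \<kappa>) ^ n) sequentially"
proof -
  obtain C0 where C0: "C0 > 0" and ev0: "eventually (\<lambda>n. \<forall>Q. orthQ n Q \<longrightarrow> (\<forall>h M. h holomorphic_on \<Omega> \<longrightarrow>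
      (\<forall>w\<in>circ. norm (h w) \<le> M) \<longrightarrow>
      norm (L (\<lambda>w. pQ Q w * h w / W w)) \<le> C0 * nrm Q * (\<tau> / \<kappa>) ^ n * M)) sequentially"
    by (rule small_modulo[OF \<tau> \<kappa>])
  have "compact (Psi ` ann r0 r1)" by (rule compact_Psi_ann[OF params(1)])
  then obtain M1 where M1: "\<And>w. w \<in> ann r0 r1 \<Longrightarrow> norm (Psi w) \<le> M1"
    using compact_imp_bounded by (fastforce simp: bounded_iff)
  \<comment> \<open>Points \<zeta> on this circle have distance at least 1 from the image of the
    annulus, so the kernel (Qm(z) - Qm(\<zeta>)) / (z - \<zeta>) stays bounded there.\<close>
  define \<rho> where "\<rho> = max 1 (M1 + 1)"
  have \<rho>: "1 \<le> \<rho>" "M1 + 1 \<le> \<rho>" by (auto simp: \<rho>_def)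
  have cQ: "continuous_on (cball 0 \<rho>) (poly Qm)" by (intro continuous_intros)
  obtain M2 where M2: "\<And>z. z \<in> cball 0 \<rho> \<Longrightarrow> norm (poly Qm z) \<le> M2"
    using compact_imp_bounded[OF compact_continuous_image[OF cQ compact_cball]] by (fastforce simp: bounded_iff)
  have cc: "compact circ" unfolding circ_def by (intro compact_Un compact_sphere)
  have hD: "(\<lambda>w. deriv Psi w / Lq w) holomorphic_on \<Omega>"
    using Lq_nz Omega_sub(3)
    by (intro holomorphic_intros holomorphic_on_subset[OF Psi_deriv_hol Omega_sub(3)]
       holomorphic_on_subset[OF Lq_hol Omega_sub(3)]) auto
  obtain M3 where M3: "\<And>w. w \<in> circ \<Longrightarrow> norm (deriv Psi w / Lq w) \<le> M3"
    using compact_imp_bounded[OF compact_continuous_image[OF hol_cont[OF hD] cc]] by (fastforce simp: bounded_iff)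
  define M where "M = (2 * \<bar>M2\<bar> + 1) * (\<bar>M3\<bar> + 1)"
  have M: "M > 0" unfolding M_def by (intro mult_pos_pos) auto
  show ?thesis
  proof (rule that[of "C0 * M"])
    show "0 < C0 * M" using C0 M by simp
    show "eventually (\<lambda>n. \<forall>Q. orthQ n Q \<longrightarrow>
      nrm (Q - smult (coeff Q m) Qm) \<le> C0 * M * nrm Q * (\<tau> / \<kappa>) ^ n) sequentially"
      using ev0
    proof eventually_elim
      case (elim n)
      show ?case
      proof (intro allI impI)
        fix Q assume Q: "orthQ n Q"
        then have dQ: "degree Q \<le> m" by (simp add: orthQ_def)
        show "nrm (Q - smult (coeff Q m) Qm) \<le> C0 * M * nrm Q * (\<tau> / \<kappa>) ^ n"
        proof (rule coeff_norm_le, rule Cauchy_coeff[OF \<rho>(1)])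
          fix \<zeta> :: complex assume \<zeta>: "norm \<zeta> = \<rho>"
          let ?h = "\<lambda>w. pQ (synthetic_div Qm \<zeta>) w * deriv Psi w / Lq w"
          have h: "?h holomorphic_on \<Omega>" using holomorphic_on_mult[OF pQ_holO hD] by simp
          have hb: "\<forall>w\<in>circ. norm (?h w) \<le> M"
          proof
            fix w assume w: "w \<in> circ"
            then have "norm (Psi w) \<le> M1" using M1 circ_ann by blast
            then have far: "1 \<le> norm (Psi w - \<zeta>)" and P\<rho>: "norm (Psi w) \<le> \<rho>"
              using \<zeta> \<rho> norm_triangle_ineq2[of \<zeta> "Psi w"] by (auto simp: norm_minus_commute)
            have "poly Qm (Psi w) - poly Qm \<zeta> = (Psi w - \<zeta>) * poly (synthetic_div Qm \<zeta>) (Psi w)"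
              using arg_cong[OF synthetic_div_correct'[of \<zeta> Qm], of "\<lambda>q. poly q (Psi w)"] by (simp add: algebra_simps)
            then have "norm (Psi w - \<zeta>) * norm (pQ (synthetic_div Qm \<zeta>) w) = norm (poly Qm (Psi w) - poly Qm \<zeta>)"
              by (simp add: pQ_def norm_mult)
            moreover have "norm (poly Qm (Psi w) - poly Qm \<zeta>) \<le> M2 + M2"
              using M2[of "Psi w"] M2[of \<zeta>] P\<rho> \<zeta> by (intro order_trans[OF norm_triangle_ineq4] add_mono) auto
            moreover have "1 * norm (pQ (synthetic_div Qm \<zeta>) w) \<le> norm (Psi w - \<zeta>) * norm (pQ (synthetic_div Qm \<zeta>) w)"
              using far by (intro mult_right_mono) auto
            ultimately have 1: "norm (pQ (synthetic_div Qm \<zeta>) w) \<le> 2 * \<bar>M2\<bar> + 1" by linarith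
            have 2: "norm (deriv Psi w / Lq w) \<le> \<bar>M3\<bar> + 1" using M3[OF w] by linarith
            have "norm (?h w) = norm (pQ (synthetic_div Qm \<zeta>) w) * norm (deriv Psi w / Lq w)"
              by (simp add: norm_mult norm_divide)
            also have "\<dots> \<le> M" unfolding M_def using 1 2 by (intro mult_mono) auto
            finally show "norm (?h w) \<le> M" .
          qed
          have "norm (L (\<lambda>w. pQ Q w * ?h w / W w)) \<le> C0 * nrm Q * (\<tau> / \<kappa>) ^ n * M"
            using elim Q h hb by blast
          then show "norm (poly (Q - smult (coeff Q m) Qm) \<zeta>) \<le> C0 * M * nrm Q * (\<tau> / \<kappa>) ^ n"
            unfolding recovery[OF dQ] by (simp add: mult_ac)
        qed
      qed
    qed
  qed
qed

end

section \<open>Error estimates\<close>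

context montessus
begin

section \<open>Convergence of the denominators\<close>

lemma rate_exists:
  obtains \<theta> where "r1 / R < \<theta>" "\<theta> < 1" "0 \<le> \<theta>"
proof -
  have "r1 / R < 1" using params by simp
  then obtain \<theta> where "r1 / R < \<theta>" "\<theta> < 1" using dense by blast
  moreover have "0 < r1 / R" using params by simp
  ultimately show ?thesis using that by simp
qed

lemma eventually_power_small:
  fixes \<theta> :: real
  assumes "0 \<le> \<theta>" "\<theta> < 1" "0 < e"
  shows "eventually (\<lambda>n. C * \<theta> ^ n < e) sequentially"
proof -
  have "(\<lambda>n. C * \<theta> ^ n) \<longlonglongrightarrow> C * 0"
    using assms by (intro tendsto_intros LIMSEQ_power_zero) auto
  then show ?thesis using assms by (auto elim: order_tendstoD)
qed

lemma Q_mod_rate: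
  assumes \<theta>: "r1 / R < \<theta>"
  obtains C where "C > 0" "eventually (\<lambda>n. \<forall>Q. orthQ n Q \<longrightarrow>
      nrm (Q - smult (coeff Q m) Qm) \<le> C * nrm Q * \<theta> ^ n) sequentially"
proof -
  \<comment> \<open>A factor t slightly above 1 separates \<tau> from 1/R and \<kappa> from 1/r1;
    together these losses cost t^2 in the rate.\<close>
  have "((\<lambda>t. t\<^sup>2 * r1 / R) \<longlongrightarrow> 1\<^sup>2 * r1 / R) (at_right 1)" "((\<lambda>t. t / R) \<longlongrightarrow> 1 / R) (at_right 1)"
    using params by (intro tendsto_intros; simp)+
  moreover have "1 / R < 1" using params by simp
  ultimately have "eventually (\<lambda>t. t\<^sup>2 * r1 / R < \<theta> \<and> t / R < 1 \<and> 1 < t) (at_right 1)"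
    using \<theta> by (intro eventually_conj order_tendstoD(2) eventually_at_right_less) auto
  then obtain t where t: "t\<^sup>2 * r1 / R < \<theta>" "t / R < 1" "1 < t"
    using eventually_happens[of _ "at_right (1::real)"] by auto
  define \<tau> \<kappa> where "\<tau> = t / R" and "\<kappa> = 1 / (t * r1)"
  have \<tau>: "1 / R < \<tau>" "\<tau> < 1" using t params by (auto simp: \<tau>_def divide_strict_right_mono)
  have \<kappa>: "0 < \<kappa>" "\<kappa> < 1 / r1" using t params by (auto simp: \<kappa>_def field_simps)
  have eq: "\<tau> / \<kappa> = t\<^sup>2 * r1 / R" by (simp add: \<tau>_def \<kappa>_def power2_eq_square)
  have q0: "0 \<le> \<tau> / \<kappa>" using t params by (simp add: \<tau>_def \<kappa>_def)
  obtain C where C: "C > 0" and ev: "eventually (\<lambda>n. \<forall>Q. orthQ n Q \<longrightarrow>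
      nrm (Q - smult (coeff Q m) Qm) \<le> C * nrm Q * (\<tau> / \<kappa>) ^ n) sequentially"
    by (rule Q_mod_small[OF \<tau> \<kappa>])
  show ?thesis
  proof (rule that[OF C])
    show "eventually (\<lambda>n. \<forall>Q. orthQ n Q \<longrightarrow>
      nrm (Q - smult (coeff Q m) Qm) \<le> C * nrm Q * \<theta> ^ n) sequentially"
      using ev
    proof eventually_elim
      case (elim n)
      show ?case
      proof (intro allI impI)
        fix Q assume "orthQ n Q"
        then have "nrm (Q - smult (coeff Q m) Qm) \<le> C * nrm Q * (\<tau> / \<kappa>) ^ n" using elim by blast
        also have "\<dots> \<le> C * nrm Q * \<theta> ^ n"
          using C coeff_norm_nonneg[of m Q] q0 t(1) eq by (intro mult_left_mono power_mono) auto
        finally show "nrm (Q - smult (coeff Q m) Qm) \<le> C * nrm Q * \<theta> ^ n" .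
      qed
    qed
  qed
qed

text \<open>If the coefficient of degree m vanishes, the remainder modulo \<open>Qm\<close> is Q
  itself, and for large n a nonzero Q would have a norm strictly below itself.\<close>

lemma regular: "eventually (\<lambda>n. \<forall>Q. orthQ n Q \<longrightarrow> coeff Q m = 0 \<longrightarrow> Q = 0) sequentially"
proof -
  obtain \<theta> where \<theta>: "r1 / R < \<theta>" "\<theta> < 1" "0 \<le> \<theta>" by (rule rate_exists)
  obtain C where C: "C > 0" and ev: "eventually (\<lambda>n. \<forall>Q. orthQ n Q \<longrightarrow>
      nrm (Q - smult (coeff Q m) Qm) \<le> C * nrm Q * \<theta> ^ n) sequentially"
    by (rule Q_mod_rate[OF \<theta>(1)])
  show ?thesis
    using ev eventually_power_small[OF \<theta>(3,2) zero_less_one, of C]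
  proof eventually_elim
    case (elim n)
    show ?case
    proof (intro allI impI, rule ccontr)
      fix Q assume Q: "orthQ n Q" "coeff Q m = 0" "Q \<noteq> 0"
      then have pos: "0 < nrm Q" by (intro coeff_norm_pos) (auto simp: orthQ_def)
      have "nrm Q \<le> C * nrm Q * \<theta> ^ n" using elim(1) Q by fastforce
      also have "\<dots> = nrm Q * (C * \<theta> ^ n)" by (simp add: mult_ac)
      also have "\<dots> < nrm Q * 1" using pos elim(2) by (intro mult_strict_left_mono) auto
      finally show False by simp
    qed
  qed
qed

text \<open>The bound of \<open>Q_mod_rate\<close> contains the norm of Q, which is at most the norm
  of \<open>Qm\<close> plus the distance; once \<open>C * \<theta>' ^ n\<close> is below 1/2, the
  distance is absorbed on the left.\<close>

lemma monic_close:
  assumes \<theta>: "r1 / R < \<theta>"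
  obtains C where "C > 0" "eventually (\<lambda>n. \<forall>Q. orthQ n Q \<longrightarrow> coeff Q m = 1 \<longrightarrow> nrm (Q - Qm) \<le> C * \<theta> ^ n) sequentially"
proof -
  obtain \<theta>0 where \<theta>0: "r1 / R < \<theta>0" "\<theta>0 < 1" "0 \<le> \<theta>0" by (rule rate_exists)
  \<comment> \<open>\<theta> may be 1 or more, while the absorption needs a rate below 1.\<close>
  define \<theta>' where "\<theta>' = min \<theta> \<theta>0"
  have "0 < r1 / R" using params by simp
  then have \<theta>': "r1 / R < \<theta>'" "\<theta>' < 1" "0 \<le> \<theta>'" "\<theta>' \<le> \<theta>"
    using \<theta> \<theta>0 unfolding \<theta>'_def by (simp_all add: min_less_iff_disj)
  obtain C where C: "C > 0" and ev: "eventually (\<lambda>n. \<forall>Q. orthQ n Q \<longrightarrow>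
      nrm (Q - smult (coeff Q m) Qm) \<le> C * nrm Q * \<theta>' ^ n) sequentially"
    by (rule Q_mod_rate[OF \<theta>'(1)])
  have half: "(0::real) < 1 / 2" by simp
  show ?thesis
  proof (rule that[of "2 * C * (nrm Qm + 1)"])
    show "0 < 2 * C * (nrm Qm + 1)" using C coeff_norm_nonneg[of m Qm] by (intro mult_pos_pos) auto
    show "eventually (\<lambda>n. \<forall>Q. orthQ n Q \<longrightarrow> coeff Q m = 1 \<longrightarrow> nrm (Q - Qm) \<le> 2 * C * (nrm Qm + 1) * \<theta> ^ n) sequentially"
      using ev eventually_power_small[OF \<theta>'(3,2) half, of C]
    proof eventually_elim
      case (elim n)
      show ?case
      proof (intro allI impI)
        fix Q assume Q: "orthQ n Q" "coeff Q m = 1"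
        let ?d = "nrm (Q - Qm)"
        have d0: "0 \<le> ?d" by (rule coeff_norm_nonneg)
        have n0: "0 \<le> nrm Qm" by (rule coeff_norm_nonneg)
        have p0: "0 \<le> C * \<theta>' ^ n" using C \<theta>' by simp
        have "nrm Q \<le> nrm Qm + ?d" using coeff_norm_add[of m Qm "Q - Qm"] by simp
        have "?d \<le> C * nrm Q * \<theta>' ^ n" using elim(1) Q by fastforce
        also have "\<dots> = (C * \<theta>' ^ n) * nrm Q" by (simp add: mult_ac)
        also have "\<dots> \<le> (C * \<theta>' ^ n) * (nrm Qm + ?d)" using p0 \<open>nrm Q \<le> nrm Qm + ?d\<close> by (intro mult_left_mono) auto
        also have "\<dots> = (C * \<theta>' ^ n) * nrm Qm + (C * \<theta>' ^ n) * ?d" by (simp add: distrib_left)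
        also have "(C * \<theta>' ^ n) * ?d \<le> 1 / 2 * ?d" using elim(2) d0 by (intro mult_right_mono) auto
        finally have "?d \<le> 2 * ((C * \<theta>' ^ n) * nrm Qm)" by simp
        also have "\<dots> \<le> 2 * ((C * \<theta>' ^ n) * (nrm Qm + 1))" using p0 by (intro mult_left_mono) auto
        also have "\<dots> \<le> 2 * ((C * \<theta> ^ n) * (nrm Qm + 1))"
          using C \<theta>' n0 by (intro mult_left_mono mult_right_mono power_mono) auto
        finally show "?d \<le> 2 * C * (nrm Qm + 1) * \<theta> ^ n" by (simp only: mult_ac)
      qed
    qed
  qed
qed

section \<open>Existence and uniqueness of the approximant\<close>

lemma cont_QF: "continuous_on E (\<lambda>z. poly Q z * F z)"
  by (intro continuous_intros F_cont)

lemma orthQ_diff: "orthQ n Q \<Longrightarrow> orthQ n Q' \<Longrightarrow> orthQ n (Q - Q')"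
  using ip_diff[OF cont_QF cont_QF, of Q Q']
  by (auto simp: orthQ_def left_diff_distrib degree_diff_le)

lemma orthQ_smult: "orthQ n Q \<Longrightarrow> orthQ n (smult c Q)"
  using ip_cmult[of c "\<lambda>z. poly Q z * F z"]
  by (auto simp: orthQ_def mult.assoc intro: order_trans[OF degree_smult_le])

lemma orthQ_exists: "\<exists>Q. orthQ n Q \<and> Q \<noteq> 0"
proof -
  obtain c where c: "\<exists>j\<le>m. c j \<noteq> 0" "\<And>i. i < m \<Longrightarrow> (\<Sum>j\<le>m. c j * ip (\<lambda>z. z ^ j * F z) (n + 1 + i)) = 0"
    using underdetermined_system[of m "\<lambda>i j. ip (\<lambda>z. z ^ j * F z) (n + 1 + i)"] by blast
  define Q where "Q = (\<Sum>j\<le>m. monom (c j) j)"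
  have cf: "coeff Q j = c j" if "j \<le> m" for j
    using that by (simp add: Q_def coeff_sum)
  have "Q \<noteq> 0" using c(1) cf by force
  moreover have "degree Q \<le> m"
    unfolding Q_def by (intro degree_sum_le) (auto intro: order_trans[OF degree_monom_le])
  moreover have "ip (\<lambda>z. poly Q z * F z) j = 0" if j: "j \<in> {n+1..n+m}" for j
  proof -
    have "ip (\<lambda>z. poly Q z * F z) j = ip (\<lambda>z. \<Sum>i\<le>m. c i * (z ^ i * F z)) j"
      by (intro ip_cong) (simp add: Q_def poly_sum poly_monom sum_distrib_right mult.assoc)
    also have "\<dots> = (\<Sum>i\<le>m. c i * ip (\<lambda>z. z ^ i * F z) j)"
      by (subst ip_sum) (auto intro!: continuous_intros F_cont simp: ip_cmult)
    also have "\<dots> = 0"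
    proof -
      have "n + 1 + (j - n - 1) = j" "j - n - 1 < m" using j by auto
      then show ?thesis using c(2)[of "j - n - 1"] by simp
    qed
    finally show ?thesis .
  qed
  ultimately show ?thesis by (auto simp: orthQ_def)
qed

abbreviation "pade \<equiv> pade_orthogonal \<mu> p F"

lemma pade_ip: "pade n m P Q \<longleftrightarrow> degree P \<le> n \<and> degree Q \<le> m \<and> Q \<noteq> 0 \<and> lead_coeff Q = 1 \<and>
    (\<forall>j\<le>n + m. ip (\<lambda>z. poly Q z * F z) j = ip (poly P) j)"
proof -
  have "ip (\<lambda>z. poly Q z * F z - poly P z) j = ip (\<lambda>z. poly Q z * F z) j - ip (poly P) j" for j
    by (intro ip_diff cont_QF continuous_intros)
  then show ?thesis unfolding pade_orthogonal_def by (simp flip: ip_def)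
qed

lemma pade_orthQ: "pade n m P Q \<Longrightarrow> orthQ n Q"
  by (auto simp: pade_ip orthQ_def ip_poly_high)

text \<open>P is a partial sum of the orthonormal expansion of Q F, hence determined by Q.\<close>

lemma pade_P:
  assumes "pade n m P Q" shows "P = (\<Sum>j\<le>n. smult (ip (\<lambda>z. poly Q z * F z) j) (p j))"
proof -
  have "P = (\<Sum>j\<le>n. smult (ip (poly P) j) (p j))"
    using assms by (intro poly_expand) (simp add: pade_ip)
  also have "\<dots> = (\<Sum>j\<le>n. smult (ip (\<lambda>z. poly Q z * F z) j) (p j))"
    using assms by (intro sum.cong) (auto simp: pade_ip)
  finally show ?thesis .
qed

lemma pade_intro:
  assumes "orthQ n Q" "Q \<noteq> 0" "lead_coeff Q = 1"
  shows "pade n m (\<Sum>j\<le>n. smult (ip (\<lambda>z. poly Q z * F z) j) (p j)) Q"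
proof -
  have "degree (\<Sum>j\<le>n. smult (ip (\<lambda>z. poly Q z * F z) j) (p j)) \<le> n"
    by (intro degree_sum_le) (auto intro: order_trans[OF degree_smult_le] simp: deg_p)
  moreover have "ip (\<lambda>z. poly Q z * F z) j = 0" if "\<not> j \<le> n" "j \<le> n + m" for j
    using assms(1) that by (simp add: orthQ_def)
  ultimately show ?thesis using assms unfolding pade_ip ip_span by (auto simp: orthQ_def)
qed

text \<open>By \<open>regular\<close> a denominator cannot lose degree once n is large, so monic
  then means that the coefficient of degree m is 1.\<close>

lemma pade_monic:
  "eventually (\<lambda>n. \<forall>P Q. pade n m P Q \<longrightarrow> orthQ n Q \<and> coeff Q m = 1) sequentially"
  using regular
proof eventually_elim
  case (elim n)
  show ?case
  proof (intro allI impI)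
    fix P Q assume PQ: "pade n m P Q"
    then have o: "orthQ n Q" by (rule pade_orthQ)
    then have "coeff Q m \<noteq> 0" using elim PQ by (auto simp: pade_ip)
    then have "degree Q = m" using PQ le_degree[of Q m] by (auto simp: pade_ip)
    then show "orthQ n Q \<and> coeff Q m = 1" using o PQ by (auto simp: pade_ip)
  qed
qed

text \<open>Two monic denominators differ by a solution with vanishing coefficient of degree m,
  which is 0 by \<open>regular\<close>. A nonzero solution can be made monic for the same
  reason.\<close>

theorem pade_unique: "eventually (\<lambda>n. \<exists>!r. pade_approximant \<mu> p F n m r) sequentially"
  using regular pade_monic
proof eventually_elim
  case (elim n)
  obtain Q0 where Q0: "orthQ n Q0" "Q0 \<noteq> 0" using orthQ_exists by blast
  define Q where "Q = smult (1 / coeff Q0 m) Q0"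
  have c0: "coeff Q0 m \<noteq> 0" using elim(1) Q0 by blast
  have Q: "orthQ n Q" unfolding Q_def by (rule orthQ_smult[OF Q0(1)])
  have "degree Q0 = m" using c0 Q0 le_degree[of Q0 m] by (auto simp: orthQ_def)
  then have "lead_coeff Q = 1" "Q \<noteq> 0" using c0 Q0(2) by (auto simp: Q_def)
  then have ex: "pade n m (\<Sum>j\<le>n. smult (ip (\<lambda>z. poly Q z * F z) j) (p j)) Q"
    by (intro pade_intro Q)
  have uniq: "P1 = P2 \<and> Q1 = Q2" if 1: "pade n m P1 Q1" and 2: "pade n m P2 Q2" for P1 P2 Q1 Q2
  proof -
    have "orthQ n (Q1 - Q2)" "coeff (Q1 - Q2) m = 0" using elim(2) 1 2 by (auto intro: orthQ_diff)
    then have "Q1 = Q2" using elim(1) by force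
    then show ?thesis using pade_P[OF 1] pade_P[OF 2] by simp
  qed
  show ?case unfolding pade_approximant_def using ex uniq by blast
qed

section \<open>Error bounds on E and on canonical domains\<close>

lemma pade_nrm_bounded:
  obtains C where "C > 0" "eventually (\<lambda>n. \<forall>P Q. pade n m P Q \<longrightarrow> nrm Q \<le> C) sequentially"
proof -
  obtain \<theta> where \<theta>: "r1 / R < \<theta>" "\<theta> < 1" "0 \<le> \<theta>" by (rule rate_exists)
  obtain C where C: "C > 0" and ev: "eventually (\<lambda>n. \<forall>Q. orthQ n Q \<longrightarrow> coeff Q m = 1 \<longrightarrow> nrm (Q - Qm) \<le> C * \<theta> ^ n) sequentially"
    by (rule monic_close[OF \<theta>(1)])
  show ?thesis
  proof (rule that[of "nrm Qm + C"])
    show "0 < nrm Qm + C" using C coeff_norm_nonneg[of m Qm] by simp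
    show "eventually (\<lambda>n. \<forall>P Q. pade n m P Q \<longrightarrow> nrm Q \<le> nrm Qm + C) sequentially"
      using ev pade_monic
    proof eventually_elim
      case (elim n)
      show ?case
      proof (intro allI impI)
        fix P Q assume "pade n m P Q"
        then have "nrm (Q - Qm) \<le> C * \<theta> ^ n" using elim by blast
        also have "\<dots> \<le> C * 1" using C \<theta> by (intro mult_left_mono power_le_one) auto
        finally show "nrm Q \<le> nrm Qm + C" using coeff_norm_add[of m Qm "Q - Qm"] by simp
      qed
    qed
  qed
qed

text \<open>The Fourier coefficients of Q F - P vanish up to index n + m and are those of Q F
  beyond, so \<open>tail_coeffs\<close> bounds the whole expansion. On E the polynomials grow at
  most like \<sigma>^n, and \<sigma> may be chosen near 1.\<close>

lemma error_on_E:
  assumes \<tau>: "1 / R < \<tau>" "\<tau> \<le> q" and q: "1 / r0 < q" "q < 1" and \<sigma>: "1 < \<sigma>" "q * \<sigma> < 1"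
  obtains C where "C > 0" "eventually (\<lambda>n. \<forall>P Q. pade n m P Q \<longrightarrow>
     (\<forall>z\<in>E. norm (poly Q z * F z - poly P z) \<le> C * nrm Q * (\<tau> * \<sigma>) ^ n)) sequentially"
proof -
  have \<tau>0: "0 < \<tau>" using \<tau> params by (smt (verit) divide_pos_pos)
  have q0: "0 < q" using \<tau> \<tau>0 by simp
  obtain C1 where C1: "C1 > 0" and ev: "eventually (\<lambda>n. \<forall>Q. orthQ n Q \<longrightarrow>
     (\<forall>i. norm (ip (\<lambda>z. poly Q z * F z) (n + i)) \<le> C1 * nrm Q * \<tau> ^ n * q ^ i)) sequentially"
    by (rule tail_coeffs[OF \<tau> q])
  define r where "r = min ((1 + r0) / 2) ((1 + \<sigma>) / 2)"
  have r: "1 < r" "r < r0" "r < \<sigma>" using params \<sigma> by (auto simp: r_def min_def)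
  obtain C2 where C2: "C2 > 0" "\<And>n z. z \<in> Dcl r \<Longrightarrow> norm (poly (p n) z) \<le> C2 * \<sigma> ^ n"
    using p_upper[OF r(1,3)] by metis
  define C where "C = C1 * C2 / (1 - q * \<sigma>)"
  show ?thesis
  proof (rule that[of C])
    show "C > 0" using C1 C2 \<sigma> by (simp add: C_def)
    show "eventually (\<lambda>n. \<forall>P Q. pade n m P Q \<longrightarrow>
     (\<forall>z\<in>E. norm (poly Q z * F z - poly P z) \<le> C * nrm Q * (\<tau> * \<sigma>) ^ n)) sequentially"
      using ev
    proof eventually_elim
      case (elim n)
      show ?case
      proof (intro allI impI ballI)
        fix P Q z assume PQ: "pade n m P Q" and z: "z \<in> E"
        have orth: "orthQ n Q" by (rule pade_orthQ[OF PQ])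
        \<comment> \<open>F is described on E only; its continuation \<open>A / Qm\<close> is
          holomorphic on \<open>Tset\<close>, as the expansion theorem requires.\<close>
        let ?f = "\<lambda>z. poly Q z * A z / poly Qm z - poly P z"
        have fip: "ip ?f j = ip (\<lambda>z. poly Q z * F z) j - ip (poly P) j" for j
        proof -
          have "ip ?f j = ip (\<lambda>z. poly Q z * F z - poly P z) j" by (rule ip_cong) (simp add: F_Qm)
          also have "\<dots> = ip (\<lambda>z. poly Q z * F z) j - ip (poly P) j"
            by (intro ip_diff cont_QF continuous_intros)
          finally show ?thesis .
        qed
        have lo: "ip ?f j = 0" if "j < n" for j
          using PQ that by (simp add: fip pade_ip)
        have hi: "norm (ip ?f (n + i)) \<le> C1 * nrm Q * \<tau> ^ n * q ^ i" for i
        proof (cases "i \<le> m")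
          case True
          then have "ip ?f (n + i) = 0" using PQ by (simp add: fip pade_ip)
          then show ?thesis using C1 coeff_norm_nonneg[of m Q] \<tau>0 q0 by simp
        next
          case False
          then have "ip (poly P) (n + i) = 0" using PQ by (intro ip_poly_high) (auto simp: pade_ip)
          then show ?thesis using elim orth by (simp add: fip)
        qed
        have "?f holomorphic_on Tset" by (intro holomorphic_intros quot_hol poly_hol)
        moreover have zD: "z \<in> Dcl r" using z by (simp add: Dcl_def)
        ultimately have "(\<lambda>j. ip ?f j * poly (p j) z) sums ?f z"
          by (rule orthonormal_expansion[OF _ open_Tset Dcl_r0_Tset r(1,2)])
        then have S: "(\<lambda>i. ip ?f (i + n) * poly (p (i + n)) z) sums ?f z"
          using lo by (subst sums_zero_iff_shift) auto
        have bd: "norm (ip ?f (i + n) * poly (p (i + n)) z) \<le> (C1 * C2 * nrm Q * (\<tau> * \<sigma>) ^ n) * (q * \<sigma>) ^ i" for i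
        proof -
          have "norm (ip ?f (n + i)) * norm (poly (p (n + i)) z) \<le> (C1 * nrm Q * \<tau> ^ n * q ^ i) * (C2 * \<sigma> ^ (n + i))"
            using hi[of i] C2(2)[OF zD, of "n + i"] C1 C2 coeff_norm_nonneg[of m Q] \<tau>0 q0 by (intro mult_mono) auto
          also have "\<dots> = (C1 * C2 * nrm Q * (\<tau> * \<sigma>) ^ n) * (q * \<sigma>) ^ i"
            by (simp add: power_add power_mult_distrib mult_ac)
          finally show ?thesis by (simp add: norm_mult add.commute)
        qed
        have g: "(\<lambda>i. (C1 * C2 * nrm Q * (\<tau> * \<sigma>) ^ n) * (q * \<sigma>) ^ i) sums ((C1 * C2 * nrm Q * (\<tau> * \<sigma>) ^ n) * (1 / (1 - q * \<sigma>)))"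
          using q0 \<sigma> by (intro sums_mult geometric_sums) auto
        have "norm (?f z) \<le> (C1 * C2 * nrm Q * (\<tau> * \<sigma>) ^ n) * (1 / (1 - q * \<sigma>))"
          using norm_suminf_le[OF bd sums_summable[OF g]] sums_unique[OF S] sums_unique[OF g] by simp
        also have "?f z = poly Q z * F z - poly P z" using F_Qm[OF z] by simp
        finally show "norm (poly Q z * F z - poly P z) \<le> C * nrm Q * (\<tau> * \<sigma>) ^ n"
          by (simp add: C_def mult_ac)
      qed
    qed
  qed
qed

text \<open>After multiplication by \<open>Qm\<close> the error has no poles. Up to index n + m its
  coefficients are bounded through the values on E; beyond, \<open>Qm * P\<close> has too small a
  degree to contribute, and A Q is integrated over the circle R. Summation against the growth of
  \<open>p j\<close> on \<open>Dcl r\<close> gives the rate r/R.\<close>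

theorem error_on_Dcl:
  assumes r: "1 < r" "r < R" and \<theta>: "r / R < \<theta>"
  obtains C where "C > 0" "eventually (\<lambda>n. \<forall>P Q. pade n m P Q \<longrightarrow>
     (\<forall>z\<in>Dcl r. norm (A z * poly Q z - poly Qm z * poly P z) \<le> C * \<theta> ^ n)) sequentially"
proof -
  \<comment> \<open>One t > 1 fixes three small losses: in \<tau> = t/R, in the growth of the
    polynomials on E, and in s = t r. Their product is t^3 r/R.\<close>
  have "((\<lambda>t. t ^ 3 * r / R) \<longlongrightarrow> 1 ^ 3 * r / R) (at_right 1)" "((\<lambda>t. t\<^sup>2 * r / R) \<longlongrightarrow> 1\<^sup>2 * r / R) (at_right 1)"
    "((\<lambda>t. t / R) \<longlongrightarrow> 1 / R) (at_right 1)" "((\<lambda>t. t) \<longlongrightarrow> (1::real)) (at_right 1)"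
    using params by (intro tendsto_intros; simp)+
  moreover have "1 / R < 1 / r0" "r / R < 1" using params r by (auto simp: field_simps)
  ultimately have "eventually (\<lambda>t. t ^ 3 * r / R < \<theta> \<and> t\<^sup>2 * r / R < 1 \<and> t / R < 1 / r0 \<and> t < r0 \<and> 1 < t) (at_right 1)"
    using \<theta> params by (intro eventually_conj order_tendstoD(2) eventually_at_right_less) auto
  then obtain t where t: "t ^ 3 * r / R < \<theta>" "t\<^sup>2 * r / R < 1" "t / R < 1 / r0" "t < r0" "1 < t"
    using eventually_happens[of _ "at_right (1::real)"] by auto
  define \<tau> s q where "\<tau> = t / R" and "s = t * r" and "q = (1 / r0 + 1 / t) / 2"
  have q: "1 / r0 < q" "q < 1 / t" using t params by (auto simp: q_def field_simps)
  have q1: "q < 1" using q t by (smt (verit) divide_less_eq_1_pos)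
  have \<tau>: "1 / R < \<tau>" "\<tau> \<le> q" "0 < \<tau>" using t q params by (auto simp: \<tau>_def divide_strict_right_mono)
  have qt: "q * t < 1" using q t by (simp add: field_simps)
  have s: "r < s" "1 < s" using t r by (auto simp: s_def) (smt (verit) mult_less_cancel_right2)
  have \<tau>s: "\<tau> * s < 1" using t by (simp add: \<tau>_def s_def power2_eq_square mult_ac)
  have \<theta>eq: "\<tau> * t * s < \<theta>" using t by (simp add: \<tau>_def s_def power3_eq_cube mult_ac)
  obtain C1 where C1: "C1 > 0" and ev1: "eventually (\<lambda>n. \<forall>P Q. pade n m P Q \<longrightarrow>
     (\<forall>z\<in>E. norm (poly Q z * F z - poly P z) \<le> C1 * nrm Q * (\<tau> * t) ^ n)) sequentially"
    by (rule error_on_E[OF \<tau>(1,2) q(1) q1 t(5) qt])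
  obtain C2 where C2: "C2 > 0" and ev2: "eventually (\<lambda>n. \<forall>P Q. pade n m P Q \<longrightarrow> nrm Q \<le> C2) sequentially"
    by (rule pade_nrm_bounded)
  obtain C3 where C3: "C3 > 0" "\<And>n z. z \<in> Dcl r \<Longrightarrow> norm (poly (p n) z) \<le> C3 * s ^ n"
    using p_upper[OF r(1) s(1)] by metis
  have cQm: "continuous_on E (poly Qm)" by (intro continuous_intros)
  obtain C4' where "\<And>z. z \<in> E \<Longrightarrow> norm (poly Qm z) \<le> C4'"
    using compact_imp_bounded[OF compact_continuous_image[OF cQm compact_E]] by (fastforce simp: bounded_iff)
  then have C4: "norm (poly Qm z) \<le> \<bar>C4'\<bar> + 1" if "z \<in> E" for z using that by fastforce
  define C4 where "C4 = \<bar>C4'\<bar> + 1"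
  have C4p: "C4 > 0" by (simp add: C4_def)
  obtain C5 where C5: "C5 > 0" "\<And>T j. degree T \<le> m \<Longrightarrow> norm (ip (\<lambda>z. A z * poly T z) j) \<le> C5 * nrm T * \<tau> ^ j"
  proof -
    obtain D1 where D1: "D1 > 0" "\<And>T w. degree T \<le> m \<Longrightarrow> r0 \<le> norm w \<Longrightarrow> norm w \<le> R \<Longrightarrow> norm (pQ T w) \<le> D1 * nrm T"
      using pQ_bound by metis
    obtain D2 where D2: "D2 > 0" "\<And>n w. w \<in> ann R R \<Longrightarrow> norm (sig n w) \<le> D2 * \<tau> ^ n"
      using sig_upper[OF params(4) \<tau>(1)] by metis
    have DR: "Dcl R \<subseteq> Dop \<rho>0" using bR by (intro Dcl_Dop) simp
    have o: "open (Dop \<rho>0)" using params bR by (intro open_Dop) simp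
    have sub: "sphere 0 R \<subseteq> {w::complex. 1 < norm w}" using params by auto
    have im: "Psi ` sphere 0 R \<subseteq> Dop \<rho>0" using DR Psi_in_Dcl[of _ R] params by auto
    have cA: "continuous_on (sphere 0 R) (\<lambda>w. A (Psi w) * deriv Psi w)"
      by (intro continuous_intros holomorphic_on_imp_continuous_on[OF Psi_comp_hol[OF A_hol sub im]]
         continuous_on_subset[OF holomorphic_on_imp_continuous_on[OF Psi_deriv_hol] sub])
    obtain D3 where D3: "\<And>w. w \<in> sphere 0 R \<Longrightarrow> norm (A (Psi w) * deriv Psi w) \<le> D3"
      using compact_imp_bounded[OF compact_continuous_image[OF cA compact_sphere]] by (fastforce simp: bounded_iff)
    show ?thesis
    proof (rule that[of "R * ((\<bar>D3\<bar> + 1) * D1 * D2)"])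
      show "0 < R * ((\<bar>D3\<bar> + 1) * D1 * D2)" using D1 D2 params by (intro mult_pos_pos) auto
      fix T :: "complex poly" and j assume T: "degree T \<le> m"
      have "ip (\<lambda>z. A z * poly T z) j = cint R (\<lambda>w. (A (Psi w) * poly T (Psi w)) * deriv Psi w * sig j w)"
        by (rule ip_eq_cint[OF _ o DR params(4)]) (intro holomorphic_intros A_hol poly_hol)
      also have "\<dots> = cint R (\<lambda>w. (A (Psi w) * deriv Psi w) * pQ T w * sig j w)"
        by (simp add: pQ_def mult_ac)
      also have "norm \<dots> \<le> R * ((\<bar>D3\<bar> + 1) * (D1 * nrm T) * (D2 * \<tau> ^ j))"
      proof (rule norm_cint_le[OF params(8)])
        show "continuous_on (sphere 0 R) (\<lambda>w. (A (Psi w) * deriv Psi w) * pQ T w * sig j w)"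
          by (intro continuous_on_mult cA sig_cont params
            continuous_on_subset[OF holomorphic_on_imp_continuous_on[OF pQ_hol] sub])
        fix w :: complex assume w: "norm w = R"
        have "norm (A (Psi w) * deriv Psi w) \<le> \<bar>D3\<bar> + 1" using D3[of w] w by simp
        moreover have "norm (pQ T w) \<le> D1 * nrm T" using D1(2)[OF T] w params by simp
        moreover have "norm (sig j w) \<le> D2 * \<tau> ^ j" using D2(2)[of w j] w by (simp add: ann_def)
        ultimately show "norm ((A (Psi w) * deriv Psi w) * pQ T w * sig j w) \<le> (\<bar>D3\<bar> + 1) * (D1 * nrm T) * (D2 * \<tau> ^ j)"
          unfolding norm_mult[of "_ * _" "sig j w"] norm_mult[of "_ * _" "pQ T w"]
          using D1 D2 coeff_norm_nonneg[of m T] \<tau> by (intro mult_mono mult_nonneg_nonneg) auto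
      qed
      finally show "norm (ip (\<lambda>z. A z * poly T z) j) \<le> R * ((\<bar>D3\<bar> + 1) * D1 * D2) * nrm T * \<tau> ^ j"
        by (simp add: mult_ac)
    qed
  qed
  define K1 where "K1 = C4 * (C1 * C2) * mass"
  define K2 where "K2 = C5 * C2"
  have K: "K1 > 0" "K2 > 0" using C1 C2 C4p C5 mass_pos by (auto simp: K1_def K2_def)
  define C where "C = C3 * (K1 * (s ^ (m + 1) / (s - 1)) + K2 / (1 - \<tau> * s))"
  have Cp: "C > 0" unfolding C_def using C3 K s \<tau>s by (intro mult_pos_pos add_pos_pos divide_pos_pos) auto
  show ?thesis
  proof (rule that[OF Cp])
    show "eventually (\<lambda>n. \<forall>P Q. pade n m P Q \<longrightarrow>
     (\<forall>z\<in>Dcl r. norm (A z * poly Q z - poly Qm z * poly P z) \<le> C * \<theta> ^ n)) sequentially"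
      using ev1 ev2
    proof eventually_elim
      case (elim n)
      show ?case
      proof (intro allI impI ballI)
        fix P Q z assume PQ: "pade n m P Q" and z: "z \<in> Dcl r"
        have dQ: "degree Q \<le> m" and dP: "degree P \<le> n" using PQ by (auto simp: pade_ip)
        have nQ: "nrm Q \<le> C2" using elim(2) PQ by blast
        let ?H = "\<lambda>z. A z * poly Q z - poly Qm z * poly P z"
        have hol: "?H holomorphic_on Dop \<rho>0" by (intro holomorphic_intros A_hol poly_hol)
        have cH: "continuous_on E ?H"
          by (rule continuous_on_subset[OF holomorphic_on_imp_continuous_on[OF hol] Dcl_Dop(3)])
        have cA: "continuous_on E (\<lambda>z. A z * poly Q z)"
          by (intro continuous_intros continuous_on_subset[OF holomorphic_on_imp_continuous_on[OF A_hol] Dcl_Dop(3)])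
        have lo: "norm (ip ?H j) \<le> K1 * (\<tau> * t) ^ n" for j
        proof -
          have "norm (ip ?H j) \<le> (C4 * (C1 * C2 * (\<tau> * t) ^ n)) * mass"
          proof (rule norm_ip_le[OF cH])
            fix \<zeta> assume \<zeta>: "\<zeta> \<in> E"
            have "?H \<zeta> = poly Qm \<zeta> * (poly Q \<zeta> * F \<zeta> - poly P \<zeta>)"
              using F_Qm[OF \<zeta>] Qm_nz[OF \<zeta>] by (simp add: algebra_simps)
            moreover have "norm (poly Q \<zeta> * F \<zeta> - poly P \<zeta>) \<le> C1 * C2 * (\<tau> * t) ^ n"
            proof -
              have "norm (poly Q \<zeta> * F \<zeta> - poly P \<zeta>) \<le> C1 * nrm Q * (\<tau> * t) ^ n" using elim(1) PQ \<zeta> by blast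
              also have "\<dots> \<le> C1 * C2 * (\<tau> * t) ^ n"
                using C1 nQ \<tau> t by (intro mult_right_mono mult_left_mono) auto
              finally show ?thesis .
            qed
            ultimately show "norm (?H \<zeta>) \<le> C4 * (C1 * C2 * (\<tau> * t) ^ n)"
              using C4[OF \<zeta>] C4p unfolding C4_def by (simp add: norm_mult mult_mono)
          qed
          then show ?thesis by (simp add: K1_def mult_ac)
        qed
        have hi: "norm (ip ?H j) \<le> K2 * \<tau> ^ j" if j: "j > n + m" for j
        proof -
          have "degree (Qm * P) < j" using degree_mult_le[of Qm P] dP degree_Qm j by simp
          then have "ip (poly (Qm * P)) j = 0" by (rule ip_poly_high)
          then have "ip (\<lambda>z. poly Qm z * poly P z) j = 0" by (simp add: poly_mult[abs_def])
          then have "ip ?H j = ip (\<lambda>z. A z * poly Q z) j"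
            by (subst ip_diff[OF cA]) (auto intro!: continuous_intros)
          also have "norm \<dots> \<le> C5 * nrm Q * \<tau> ^ j" by (rule C5(2)[OF dQ])
          also have "\<dots> \<le> K2 * \<tau> ^ j" unfolding K2_def using C5 nQ \<tau> by (intro mult_right_mono mult_left_mono) auto
          finally show ?thesis .
        qed
        \<comment> \<open>From this index on every \<open>p j\<close> is orthogonal to
          \<open>Qm * P\<close>, whose degree is at most n + m.\<close>
        define N where "N = n + m + 1"
        let ?g = "\<lambda>j. ip ?H j * poly (p j) z"
        have oD: "open (Dop \<rho>0)" using params bR by (intro open_Dop) simp
        have S: "?g sums ?H z"
          using bR by (intro orthonormal_expansion[OF hol oD _ r z] Dcl_Dop) simp
        have split: "?H z = (\<Sum>i. ?g (i + N)) + sum ?g {..<N}"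
          using suminf_split_initial_segment[OF sums_summable[OF S], of N] sums_unique[OF S] by simp
        have head: "norm (sum ?g {..<N}) \<le> C3 * (K1 * (s ^ (m + 1) / (s - 1))) * \<theta> ^ n"
        proof -
          have "norm (sum ?g {..<N}) \<le> (\<Sum>j<N. K1 * (\<tau> * t) ^ n * (C3 * s ^ j))"
            unfolding norm_mult using lo C3(2)[OF z] K \<tau> t
            by (intro sum_norm_le) (auto simp: norm_mult intro!: mult_mono)
          also have "\<dots> = K1 * (\<tau> * t) ^ n * C3 * (\<Sum>j<N. s ^ j)" by (simp only: sum_distrib_left mult.assoc)
          also have "(\<Sum>j<N. s ^ j) = (s ^ N - 1) / (s - 1)" using s by (intro geometric_sum) auto
          also have "K1 * (\<tau> * t) ^ n * C3 * ((s ^ N - 1) / (s - 1)) \<le> K1 * (\<tau> * t) ^ n * C3 * (s ^ N / (s - 1))"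
            using s K C3 \<tau> t by (intro mult_left_mono divide_right_mono) auto
          also have "\<dots> = C3 * (K1 * (s ^ (m + 1) / (s - 1))) * (\<tau> * t * s) ^ n"
            by (simp add: N_def power_add power_mult_distrib)
          also have "\<dots> \<le> C3 * (K1 * (s ^ (m + 1) / (s - 1))) * \<theta> ^ n"
            using s K C3 \<tau> t \<theta>eq by (intro mult_left_mono power_mono) auto
          finally show ?thesis .
        qed
        have tail: "norm (\<Sum>i. ?g (i + N)) \<le> C3 * (K2 / (1 - \<tau> * s)) * \<theta> ^ n"
        proof -
          have bd: "norm (?g (i + N)) \<le> (C3 * K2 * (\<tau> * s) ^ N) * (\<tau> * s) ^ i" for i
          proof -
            have "norm (?g (i + N)) \<le> (K2 * \<tau> ^ (i + N)) * (C3 * s ^ (i + N))"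
              unfolding norm_mult using hi[of "i + N"] C3(2)[OF z, of "i + N"] K \<tau> by (intro mult_mono) (auto simp: N_def)
            also have "\<dots> = (C3 * K2 * (\<tau> * s) ^ N) * (\<tau> * s) ^ i"
              by (simp add: power_add power_mult_distrib mult_ac)
            finally show ?thesis .
          qed
          have g: "(\<lambda>i. (C3 * K2 * (\<tau> * s) ^ N) * (\<tau> * s) ^ i) sums ((C3 * K2 * (\<tau> * s) ^ N) * (1 / (1 - \<tau> * s)))"
            using \<tau> s \<tau>s by (intro sums_mult geometric_sums) auto
          have "norm (\<Sum>i. ?g (i + N)) \<le> (C3 * K2 * (\<tau> * s) ^ N) * (1 / (1 - \<tau> * s))"
            using norm_suminf_le[OF bd sums_summable[OF g]] sums_unique[OF g] by simp
          also have "\<dots> = C3 * (K2 / (1 - \<tau> * s)) * (\<tau> * s) ^ N" by simp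
          also have "\<dots> \<le> C3 * (K2 / (1 - \<tau> * s)) * \<theta> ^ n"
          proof (rule mult_left_mono)
            have "(\<tau> * s) ^ N \<le> (\<tau> * s) ^ n" using \<tau> s \<tau>s by (intro power_decreasing) (auto simp: N_def)
            also have "\<dots> \<le> (\<tau> * t * s) ^ n"
            proof (rule power_mono)
              have "\<tau> * s * 1 \<le> \<tau> * s * t" using \<tau> s t by (intro mult_left_mono) auto
              then show "\<tau> * s \<le> \<tau> * t * s" by (simp add: mult_ac)
            qed (use \<tau> s in auto)
            also have "\<dots> \<le> \<theta> ^ n" using \<tau> s t \<theta>eq by (intro power_mono) auto
            finally show "(\<tau> * s) ^ N \<le> \<theta> ^ n" .
            show "0 \<le> C3 * (K2 / (1 - \<tau> * s))" using C3 K \<tau>s by simp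
          qed
          finally show ?thesis .
        qed
        have "norm (?H z) \<le> C3 * (K2 / (1 - \<tau> * s)) * \<theta> ^ n + C3 * (K1 * (s ^ (m + 1) / (s - 1))) * \<theta> ^ n"
          unfolding split by (intro norm_triangle_mono head tail)
        also have "\<dots> = C * \<theta> ^ n" by (simp add: C_def distrib_left distrib_right add.commute)
        finally show "norm (?H z) \<le> C * \<theta> ^ n" .
      qed
    qed
  qed
qed

text \<open>Division by \<open>Qm * Q\<close>: on K the first factor is at least c, and the second
  is at least c/2 for large n, since the denominators converge to \<open>Qm\<close>.\<close>

theorem approximant_error:
  assumes r: "1 < r" "r < R" and \<theta>: "r / R < \<theta>" and K: "compact K" "K \<subseteq> Dcl r - lam ` {1..m}"
  obtains C where "C > 0" "eventually (\<lambda>n. \<forall>P Q. pade n m P Q \<longrightarrow>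
     (\<forall>z\<in>K. norm (A z / poly Qm z - poly P z / poly Q z) \<le> C * \<theta> ^ n)) sequentially"
proof -
  obtain C1 where C1: "C1 > 0" and ev1: "eventually (\<lambda>n. \<forall>P Q. pade n m P Q \<longrightarrow>
     (\<forall>z\<in>Dcl r. norm (A z * poly Q z - poly Qm z * poly P z) \<le> C1 * \<theta> ^ n)) sequentially"
    by (rule error_on_Dcl[OF r \<theta>])
  have nz: "poly Qm z \<noteq> 0" if "z \<in> K" for z using K that by (auto simp: Qm_0_iff)
  obtain c where c: "c > 0" "\<And>z. z \<in> K \<Longrightarrow> c \<le> norm (poly Qm z)"
  proof (cases "K = {}")
    case True
    then show ?thesis using that[of 1] by simp
  next
    case False
    have "continuous_on K (\<lambda>z. norm (poly Qm z))" by (intro continuous_intros)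
    then obtain z0 where z0: "z0 \<in> K" "\<And>z. z \<in> K \<Longrightarrow> norm (poly Qm z0) \<le> norm (poly Qm z)"
      using continuous_attains_inf[OF K(1) False] by metis
    then show ?thesis using that[of "norm (poly Qm z0)"] nz by simp
  qed
  obtain M where M: "M \<ge> 1" "\<And>z. z \<in> K \<Longrightarrow> norm z \<le> M"
  proof -
    obtain M0 where "\<And>z. z \<in> K \<Longrightarrow> norm z \<le> M0" using compact_imp_bounded[OF K(1)] by (auto simp: bounded_iff)
    then show ?thesis using that[of "max 1 M0"] by (simp add: le_max_iff_disj)
  qed
  obtain \<theta>2 where \<theta>2: "r1 / R < \<theta>2" "\<theta>2 < 1" "0 \<le> \<theta>2" by (rule rate_exists)
  obtain C2 where C2: "C2 > 0" and ev2: "eventually (\<lambda>n. \<forall>Q. orthQ n Q \<longrightarrow> coeff Q m = 1 \<longrightarrow> nrm (Q - Qm) \<le> C2 * \<theta>2 ^ n) sequentially"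
    by (rule monic_close[OF \<theta>2(1)])
  have c2: "0 < c / 2" using c by simp
  show ?thesis
  proof (rule that[of "2 * C1 / c\<^sup>2"])
    show "0 < 2 * C1 / c\<^sup>2" using C1 c by simp
    show "eventually (\<lambda>n. \<forall>P Q. pade n m P Q \<longrightarrow>
     (\<forall>z\<in>K. norm (A z / poly Qm z - poly P z / poly Q z) \<le> 2 * C1 / c\<^sup>2 * \<theta> ^ n)) sequentially"
      using ev1 ev2 pade_monic eventually_power_small[OF \<theta>2(3,2) c2, of "(real m + 1) * M ^ m * C2"]
    proof eventually_elim
      case (elim n)
      show ?case
      proof (intro allI impI ballI)
        fix P Q z assume PQ: "pade n m P Q" and z: "z \<in> K"
        have dd: "degree (Q - Qm) \<le> m" using PQ degree_Qm by (intro degree_diff_le) (auto simp: pade_ip)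
        have "nrm (Q - Qm) \<le> C2 * \<theta>2 ^ n" using elim(2,3) PQ by blast
        then have le: "(real m + 1) * M ^ m * nrm (Q - Qm) \<le> (real m + 1) * M ^ m * (C2 * \<theta>2 ^ n)"
          using M by (intro mult_left_mono) auto
        have "norm (poly (Q - Qm) z) \<le> (real m + 1) * M ^ m * nrm (Q - Qm)"
          by (rule norm_poly_le_coeff_norm[OF dd M(2)[OF z] M(1)])
        also note le
        also have "(real m + 1) * M ^ m * (C2 * \<theta>2 ^ n) = (real m + 1) * M ^ m * C2 * \<theta>2 ^ n" by (simp only: mult.assoc)
        also note elim(4)
        finally have "norm (poly Q z - poly Qm z) < c / 2" by simp
        moreover have "norm (poly Qm z) \<le> norm (poly Q z) + norm (poly Q z - poly Qm z)"
          by (metis norm_minus_commute norm_triangle_sub)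
        ultimately have cQ: "c / 2 \<le> norm (poly Q z)" using c(2)[OF z] by linarith
        then have Q0: "poly Q z \<noteq> 0" using c by auto
        have "A z / poly Qm z - poly P z / poly Q z = (A z * poly Q z - poly Qm z * poly P z) / (poly Qm z * poly Q z)"
          using nz[OF z] Q0 by (simp add: field_simps)
        also have "norm \<dots> = norm (A z * poly Q z - poly Qm z * poly P z) / (norm (poly Qm z) * norm (poly Q z))"
          by (simp add: norm_divide norm_mult)
        also have "\<dots> \<le> (C1 * \<theta> ^ n) / (c * (c / 2))"
        proof (rule frac_le)
          show "norm (A z * poly Q z - poly Qm z * poly P z) \<le> C1 * \<theta> ^ n" using elim(1) PQ z K by blast
          then show "0 \<le> C1 * \<theta> ^ n" by (rule order_trans[OF norm_ge_zero])
          show "0 < c * (c / 2)" using c by simp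
          show "c * (c / 2) \<le> norm (poly Qm z) * norm (poly Q z)" using c cQ z by (intro mult_mono) auto
        qed
        also have "\<dots> = 2 * C1 / c\<^sup>2 * \<theta> ^ n" by (simp add: power2_eq_square)
        finally show "norm (A z / poly Qm z - poly P z / poly Q z) \<le> 2 * C1 / c\<^sup>2 * \<theta> ^ n" .
      qed
    qed
  qed
qed

end

section \<open>Rates of convergence\<close>

lemma limsup_root_le:
  fixes x :: "nat \<Rightarrow> real"
  assumes C: "C > 0" and \<theta>: "\<theta> > 0" and ev: "eventually (\<lambda>n. x n \<le> C * \<theta> ^ n) sequentially"
  shows "limsup (\<lambda>n. ereal (root n (x n))) \<le> ereal \<theta>"
proof -
  have "eventually (\<lambda>n. ereal (root n (x n)) \<le> ereal (root n C * \<theta>)) sequentially"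
    using ev eventually_gt_at_top[of 0]
  proof eventually_elim
    case (elim n)
    then have "root n (x n) \<le> root n (C * \<theta> ^ n)" by simp
    also have "\<dots> = root n C * \<theta>" using elim \<theta> by (simp add: real_root_mult real_root_power_cancel)
    finally show ?case by simp
  qed
  then have "limsup (\<lambda>n. ereal (root n (x n))) \<le> limsup (\<lambda>n. ereal (root n C * \<theta>))"
    by (rule Limsup_mono)
  also have "\<dots> = ereal (1 * \<theta>)"
    by (intro lim_imp_Limsup tendsto_intros LIMSEQ_root_const C) auto
  finally show ?thesis by simp
qed

text \<open>Reduces the limsup bounds to positive real rates, including the bound 0 that arises for
  \<rho> = \<infinity>.\<close>

lemma le_ereal_approx:
  fixes y L :: ereal
  assumes "0 \<le> y" "\<And>\<theta>::real. \<theta> > 0 \<Longrightarrow> y < ereal \<theta> \<Longrightarrow> L \<le> ereal \<theta>"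
  shows "L \<le> y"
proof (rule ccontr)
  assume "\<not> L \<le> y"
  then have "y < L" by simp
  then obtain \<theta> :: real where \<theta>: "y < ereal \<theta>" "ereal \<theta> < L" using ereal_dense2 by blast
  have "0 < ereal \<theta>" by (rule le_less_trans[OF assms(1) \<theta>(1)])
  then have "L \<le> ereal \<theta>" using assms(2) \<theta>(1) by simp
  then show False using \<theta>(2) by simp
qed

text \<open>Replaces the possibly infinite index by a finite R without spoiling the rate; for \<rho>
  = \<infinity> the quotient is 0 and every large R will do.\<close>

lemma radius_choice:
  fixes \<rho> :: ereal and x l \<theta> :: real
  assumes "ereal l < \<rho>" "0 \<le> x" "0 < \<theta>" "ereal x / \<rho> < ereal \<theta>" "0 < l"
  obtains R where "l < R" "ereal R < \<rho>" "x / R < \<theta>"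
proof -
  have "ereal (x / \<theta>) < \<rho>"
  proof (cases \<rho>)
    case (real r)
    then have "0 < r" using assms by simp
    then show ?thesis using assms real by (simp add: field_simps)
  qed (use assms in auto)
  then have "ereal (max l (x / \<theta>)) < \<rho>" using assms(1) by (simp add: max_def)
  then obtain R where R: "ereal (max l (x / \<theta>)) < ereal R" "ereal R < \<rho>" using ereal_dense2 by blast
  then have "l < R" "x / \<theta> < R" by auto
  then have "x / R < \<theta>" using assms by (simp add: field_simps)
  then show ?thesis using that \<open>l < R\<close> R by blast
qed

text \<open>The product of the linear factors makes the poles of G removable, and since the orders
  agree exactly, the new values there are nonzero.\<close>

lemma meromorphic_numerator:
  fixes G :: "complex \<Rightarrow> complex" and lam :: "nat \<Rightarrow> complex"
  assumes D: "open D" and G: "G nicely_meromorphic_on D" and lam: "\<And>k. k \<in> {1..m} \<Longrightarrow> lam k \<in> D"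
    and mult: "\<And>z. z \<in> D \<Longrightarrow> pole_order G z = card {k \<in> {1..m}. lam k = z}"
  obtains A where "A holomorphic_on D" "\<And>k. k \<in> {1..m} \<Longrightarrow> A (lam k) \<noteq> 0"
    "\<And>z. z \<in> D - lam ` {1..m} \<Longrightarrow> G z = A z / (\<Prod>k\<in>{1..m}. z - lam k)"
proof -
  define \<Lambda> where "\<Lambda> = lam ` {1..m}"
  define q where "q z = (\<Prod>k\<in>{1..m}. z - lam k)" for z
  define q' where "q' z w = (\<Prod>k\<in>{k\<in>{1..m}. lam k \<noteq> z}. w - lam k)" for z w
  \<comment> \<open>At a pole the vanishing linear factors cancel the negative power of the local
    factorization, which leaves \<open>zor_poly\<close> times the remaining factors.\<close>
  define A where "A z = (if z \<in> \<Lambda> then zor_poly G z z * q' z z else G z * q z)" for z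
  have fin: "finite \<Lambda>" by (simp add: \<Lambda>_def)
  have mer: "G meromorphic_on D" using G by (simp add: nicely_meromorphic_on_def)
  have pole_iff: "is_pole G z \<longleftrightarrow> z \<in> \<Lambda>" if z: "z \<in> D" for z
  proof
    assume p: "is_pole G z"
    have "G meromorphic_on {z}" using mer z by (intro meromorphic_on_subset[OF mer]) auto
    then have "isolated_singularity_at G z" by (rule meromorphic_on_isolated_singularity)
    then have "zorder G z < 0" using p by (rule isolated_pole_imp_neg_zorder)
    then have "pole_order G z > 0" using p by (simp add: pole_order_def)
    then have "{k \<in> {1..m}. lam k = z} \<noteq> {}" using mult[OF z] by (metis card.empty less_irrefl)
    then show "z \<in> \<Lambda>" by (auto simp: \<Lambda>_def)
  next
    assume "z \<in> \<Lambda>"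
    then have "{k \<in> {1..m}. lam k = z} \<noteq> {}" by (auto simp: \<Lambda>_def)
    then have "pole_order G z \<noteq> 0" unfolding mult[OF z] by simp
    then show "is_pole G z" by (auto simp: pole_order_def split: if_splits)
  qed
  have Ghol: "G holomorphic_on D - \<Lambda>"
  proof (rule analytic_imp_holomorphic)
    show "G analytic_on D - \<Lambda>"
      using nicely_meromorphic_on_imp_analytic_at[OF G] pole_iff
      by (subst analytic_on_analytic_at) auto
  qed
  have loc: "zor_poly G z z \<noteq> 0 \<and> ((\<lambda>w. G w * q w) \<longlongrightarrow> zor_poly G z z * q' z z) (at z)" if z: "z \<in> \<Lambda>" for z
  proof -
    have zD: "z \<in> D" using z lam by (auto simp: \<Lambda>_def)
    define S where "S = D - (\<Lambda> - {z})"
    have "open S" unfolding S_def using D fin by (intro open_Diff finite_imp_closed) auto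
    moreover have "G holomorphic_on S - {z}" by (rule holomorphic_on_subset[OF Ghol]) (auto simp: S_def)
    moreover have "z \<in> S" "is_pole G z" using zD pole_iff z by (auto simp: S_def)
    ultimately obtain r where r: "zor_poly G z z \<noteq> 0" "r > 0" "zor_poly G z holomorphic_on cball z r"
      "\<And>w. w \<in> cball z r - {z} \<Longrightarrow> G w = zor_poly G z w / (w - z) ^ nat (- zorder G z)"
      using zorder_exist_pole[of G S z] by blast
    define c where "c = card {k \<in> {1..m}. lam k = z}"
    have c: "nat (- zorder G z) = c"
      using mult[OF zD] pole_iff[OF zD] z by (simp add: pole_order_def c_def)
    have qq: "q w = (w - z) ^ c * q' z w" for w
    proof -
      have "q w = (\<Prod>k\<in>{k\<in>{1..m}. lam k = z} \<union> {k\<in>{1..m}. lam k \<noteq> z}. w - lam k)"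
        unfolding q_def by (intro prod.cong) auto
      also have "\<dots> = (\<Prod>k\<in>{k\<in>{1..m}. lam k = z}. w - lam k) * q' z w"
        unfolding q'_def by (intro prod.union_disjoint) auto
      also have "(\<Prod>k\<in>{k\<in>{1..m}. lam k = z}. w - lam k) = (w - z) ^ c"
        unfolding c_def by (subst prod_constant[symmetric]) (intro prod.cong, auto)
      finally show ?thesis .
    qed
    have "isCont (zor_poly G z) z"
      using r(2,3) by (intro continuous_on_interior[OF holomorphic_on_imp_continuous_on]) auto
    moreover have "isCont (q' z) z" unfolding q'_def by (intro continuous_intros)
    ultimately have "((\<lambda>w. zor_poly G z w * q' z w) \<longlongrightarrow> zor_poly G z z * q' z z) (at z)"
      by (intro tendsto_mult) (auto simp: isCont_def)
    moreover have "eventually (\<lambda>w. zor_poly G z w * q' z w = G w * q w) (at z)"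
      unfolding eventually_at using r(2)
    proof (intro exI[of _ r] conjI ballI impI)
      fix w assume w: "w \<noteq> z \<and> dist w z < r"
      then have "w \<in> cball z r - {z}" by (auto simp: dist_commute)
      then show "zor_poly G z w * q' z w = G w * q w" using r(4) w by (simp add: c qq)
    qed
    ultimately have "((\<lambda>w. G w * q w) \<longlongrightarrow> zor_poly G z z * q' z z) (at z)"
      by (rule Lim_transform_eventually)
    with r(1) show ?thesis by blast
  qed
  show ?thesis
  proof (rule that[of A])
    show "A holomorphic_on D"
    proof (rule no_isolated_singularity'[of \<Lambda>])
      fix z assume z: "z \<in> \<Lambda>"
      have "open (- (\<Lambda> - {z}))" "z \<in> - (\<Lambda> - {z})"
        using fin by (intro open_Compl finite_imp_closed finite_Diff) simp_all
      from eventually_at_in_open'[OF this] have "eventually (\<lambda>w. w \<notin> \<Lambda> - {z}) (at z)"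
        by (rule eventually_mono) auto
      moreover have "eventually (\<lambda>w. w \<noteq> z) (at z)" by (rule eventually_neq_at_within)
      ultimately have "eventually (\<lambda>w. G w * q w = A w) (at z)"
        by eventually_elim (auto simp: A_def)
      moreover have "((\<lambda>w. G w * q w) \<longlongrightarrow> A z) (at z)" using loc[OF z] z by (simp add: A_def)
      ultimately have "(A \<longlongrightarrow> A z) (at z)" by (rule Lim_transform_eventually[rotated])
      then show "(A \<longlongrightarrow> A z) (at z within D)" by (rule tendsto_within_subset) auto
    next
      have "(\<lambda>z. G z * q z) holomorphic_on D - \<Lambda>"
        unfolding q_def by (intro holomorphic_intros Ghol)
      then show "A holomorphic_on D - \<Lambda>"
        by (rule holomorphic_transform) (auto simp: A_def)
    qed (use D fin in auto)
    show "A (lam k) \<noteq> 0" if "k \<in> {1..m}" for k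
      using loc[of "lam k"] that by (auto simp: A_def \<Lambda>_def q'_def)
    show "G z = A z / (\<Prod>k\<in>{1..m}. z - lam k)" if "z \<in> D - lam ` {1..m}" for z
      using that by (auto simp: A_def \<Lambda>_def q_def)
  qed
qed

text \<open>If K is not contained in E, the points of K where |Phi| is at least its value at one
  chosen point form a compact set away from E. So the supremum is attained, and the strict
  inequality with \<rho> survives.\<close>

lemma (in exterior) max_Phi_bounds:
  fixes \<rho> :: ereal
  assumes K: "compact K" and \<rho>: "1 < \<rho>" and lt: "\<And>z. z \<in> K \<Longrightarrow> z \<notin> E \<Longrightarrow> ereal (norm (Phi z)) < \<rho>"
  shows "1 \<le> max_Phi E Phi K" "ereal (max_Phi E Phi K) < \<rho>" "K \<subseteq> Dcl (max_Phi E Phi K)"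
proof -
  have "1 \<le> max_Phi E Phi K \<and> ereal (max_Phi E Phi K) < \<rho> \<and> K \<subseteq> Dcl (max_Phi E Phi K)"
  proof (cases "K \<subseteq> E")
    case True
    then show ?thesis using \<rho> by (auto simp: max_Phi_def Dcl_def one_ereal_def)
  next
    case False
    then obtain z1 where z1: "z1 \<in> K" "z1 \<notin> E" by auto
    define c where "c = norm (Phi z1)"
    have c: "1 < c" using norm_Phi[OF z1(2)] by (simp add: c_def)
    define S where "S = K \<inter> Psi ` {w. c \<le> norm w}"
    have S: "compact S" unfolding S_def by (intro compact_Int_closed K closed_image_exterior c)
    have mem: "z \<in> S \<longleftrightarrow> z \<in> K \<and> z \<notin> E \<and> c \<le> norm (Phi z)" for z
      using Dop_eq[OF c] by (auto simp: S_def Dop_def)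
    then have "z1 \<in> S" using z1 by (simp add: c_def)
    moreover have "continuous_on S (\<lambda>z. norm (Phi z))"
      using mem by (intro continuous_intros continuous_on_subset[OF holomorphic_on_imp_continuous_on[OF Phi_hol]]) auto
    ultimately obtain z2 where z2: "z2 \<in> S" "\<And>z. z \<in> S \<Longrightarrow> norm (Phi z) \<le> norm (Phi z2)"
      using continuous_attains_sup[OF S] by blast
    have max: "norm (Phi z) \<le> norm (Phi z2)" if "z \<in> K" "z \<notin> E" for z
    proof (cases "c \<le> norm (Phi z)")
      case True
      then show ?thesis using z2(2) that mem by blast
    next
      case False
      then show ?thesis using z2(2)[OF \<open>z1 \<in> S\<close>] by (simp add: c_def)
    qed
    have "max_Phi E Phi K = (SUP z\<in>K - E. norm (Phi z))" using False by (simp add: max_Phi_def)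
    also have "\<dots> = norm (Phi z2)"
      using z2(1) mem max by (intro cSup_eq_maximum) auto
    finally have eq: "max_Phi E Phi K = norm (Phi z2)" .
    show ?thesis unfolding eq using z2(1) mem lt norm_Phi[of z2] max by (auto simp: Dcl_def)
  qed
  then show "1 \<le> max_Phi E Phi K" "ereal (max_Phi E Phi K) < \<rho>" "K \<subseteq> Dcl (max_Phi E Phi K)" by auto
qed

theorem theorem1:
  fixes E :: "complex set" and \<Phi> F G :: "complex \<Rightarrow> complex" and \<mu> :: "complex measure"
    and p :: "nat \<Rightarrow> complex poly" and m :: nat and \<rho> :: ereal and D :: "complex set"
    and lam :: "nat \<Rightarrow> complex"
  assumes E: "admissible E"
    and \<Phi>: "exterior_map E \<Phi>"
    and \<mu>: "\<mu> \<in> class_R E"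
    and p: "orthonormal_polys \<mu> p"
    and m: "m \<ge> 1"
    and F: "F analytic_on E"
    and \<rho>: "\<rho> = rho_index E \<Phi> m F"
    and D: "D = canonical_domain E \<Phi> \<rho>"
    and G: "meromorphic_extension E F D G"
    and poles_in: "\<forall>k\<in>{1..m}. lam k \<in> D"
    and poles_mult: "\<forall>z\<in>D. pole_order G z = card {k \<in> {1..m}. lam k = z}"
  shows "(\<forall>\<^sub>F n in sequentially. \<exists>!R. pade_approximant \<mu> p F n m R) \<and>
    (\<forall>P Q. (\<forall>\<^sub>F n in sequentially. pade_orthogonal \<mu> p F n m (P n) (Q n)) \<longrightarrow>
       (\<forall>K. compact K \<and> K \<subseteq> D - lam ` {1..m} \<longrightarrow>
          uniform_limit K (\<lambda>n z. poly (P n) z / poly (Q n) z) G sequentially \<and>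
          limsup (\<lambda>n. ereal (root n (sup_norm_on K (\<lambda>z. G z - poly (P n) z / poly (Q n) z))))
            \<le> ereal (max_Phi E \<Phi> K) / \<rho>) \<and>
       limsup (\<lambda>n. ereal (root n (coeff_norm m (Q n - (\<Prod>k\<in>{1..m}. [:- lam k, 1:])))))
         \<le> ereal (Max ((\<lambda>j. norm (\<Phi> (lam j))) ` {1..m})) / \<rho>) \<and>
    ereal (Max ((\<lambda>j. norm (\<Phi> (lam j))) ` {1..m})) / \<rho> < 1"
proof -
  have "\<mu> \<in> class_M E" using \<mu> by (simp add: class_R_def)
  interpret ratio_orthonormal E \<Phi> \<mu> p
  proof
    show "compact E" "E \<noteq> {}" using E by (auto simp: admissible_def)
    show "uniform_limit K (\<lambda>n z. poly (p n) z / poly (p (Suc n)) z) (\<lambda>z. 1 / \<Phi> z) sequentially"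
      if "closed K" "K \<subseteq> - E" for K using \<mu> \<Phi> p that by (auto simp: class_R_def)
  qed fact+
  have lam1: "lam 1 \<in> D" using poles_in m by simp
  have \<rho>1: "1 < \<rho>"
  proof (cases "\<exists>x. x > 1 \<and> (\<exists>G. meromorphic_extension E F (canonical_domain E \<Phi> x) G \<and>
                          at_most_poles m G (canonical_domain E \<Phi> x))")
    case True
    then obtain x where x: "x > 1" "x \<le> \<rho>" unfolding \<rho> rho_index_def by (blast intro: Sup_upper)
    then show ?thesis by simp
  next
    case False
    then have "{x. x > 1 \<and> (\<exists>G. meromorphic_extension E F (canonical_domain E \<Phi> x) G \<and>
                          at_most_poles m G (canonical_domain E \<Phi> x))} = {}" by blast
    \<comment> \<open>The supremum of the empty set is - \<infinity>, which
      \<open>real_of_ereal\<close> sends to 0; the level curve of index 0 is empty, so D would be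
      empty, although it contains a pole.\<close>
    then have "\<rho> = - \<infinity>" unfolding \<rho> rho_index_def by (simp only: Sup_empty bot_ereal_def)
    moreover have "level_curve E \<Phi> 0 = {}" using norm_Phi by (force simp: level_curve_def)
    ultimately have "D = {}" unfolding D canonical_domain_def by simp
    then show ?thesis using lam1 by simp
  qed
  have D_eq: "D = (if \<rho> = \<infinity> then UNIV else Dop (real_of_ereal \<rho>))"
    using \<rho>1 unfolding D canonical_domain_def by (cases \<rho>) (auto simp: inside_level_curve one_ereal_def)
  have openD: "open D" using \<rho>1 unfolding D_eq by (cases \<rho>) (auto simp: open_Dop one_ereal_def)
  have D_sub: "Dop r \<subseteq> D" if "ereal r \<le> \<rho>" for r
    using that \<rho>1 unfolding D_eq by (cases \<rho>) (auto intro: Dcl_Dop(5)[THEN subsetD])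
  have D_lt: "ereal (norm (\<Phi> z)) < \<rho>" if "z \<in> D" "z \<notin> E" for z
    using that \<rho>1 unfolding D_eq by (cases \<rho>) (auto simp: Dop_def)
  have nice: "G nicely_meromorphic_on D" and GF: "\<And>z. z \<in> E \<Longrightarrow> eventually (\<lambda>w. G w = F w) (nhds z)"
    using G by (auto simp: meromorphic_extension_def)
  obtain A where A: "A holomorphic_on D" "\<And>k. k \<in> {1..m} \<Longrightarrow> A (lam k) \<noteq> 0"
    "\<And>z. z \<in> D - lam ` {1..m} \<Longrightarrow> G z = A z / (\<Prod>k\<in>{1..m}. z - lam k)"
  proof (rule meromorphic_numerator[OF openD nice, of m lam])
    show "lam k \<in> D" if "k \<in> {1..m}" for k using poles_in that by blast
    show "pole_order G z = card {k \<in> {1..m}. lam k = z}" if "z \<in> D" for z using poles_mult that by blast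
  qed blast
  \<comment> \<open>F is analytic on E and G agrees with it near each point of E, so G has no pole
    there.\<close>
  have lamE: "lam k \<notin> E" if k: "k \<in> {1..m}" for k
  proof
    assume e: "lam k \<in> E"
    have "{j \<in> {1..m}. lam j = lam k} \<noteq> {}" using k by auto
    then have "pole_order G (lam k) \<noteq> 0" using poles_mult poles_in k by simp
    then have pole: "is_pole G (lam k)" by (auto simp: pole_order_def split: if_splits)
    have "F analytic_on {lam k}" using F e by (auto intro: analytic_on_subset)
    then have "F \<midarrow>lam k\<rightarrow> F (lam k)" by (simp add: analytic_at_imp_isCont isContD)
    moreover have "eventually (\<lambda>w. F w = G w) (at (lam k))"
      using GF[OF e] by (auto simp: eventually_at_filter elim: eventually_mono)
    ultimately have "G \<midarrow>lam k\<rightarrow> F (lam k)" by (rule Lim_transform_eventually)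
    then show False using pole unfolding is_pole_def
      by (intro not_tendsto_and_filterlim_at_infinity[of "at (lam k)" G]) auto
  qed
  have FA: "F z = A z / (\<Prod>k\<in>{1..m}. z - lam k)" if z: "z \<in> E" for z
  proof -
    have "z \<in> D" using z unfolding D_eq by (auto simp: Dop_def)
    moreover have "z \<notin> lam ` {1..m}" using z lamE by auto
    moreover have "G z = F z" using GF[OF z] by (rule eventually_nhds_x_imp_x)
    ultimately show ?thesis using A(3) by simp
  qed
  define mx mn where "mx = Max ((\<lambda>j. norm (\<Phi> (lam j))) ` {1..m})"
    and "mn = Min ((\<lambda>j. norm (\<Phi> (lam j))) ` {1..m})"
  have mx: "norm (\<Phi> (lam k)) \<le> mx" and mn: "mn \<le> norm (\<Phi> (lam k))" if "k \<in> {1..m}" for k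
    unfolding mx_def mn_def using that by (auto intro: Max_ge Min_le)
  have mx1: "ereal mx < \<rho>" and mn1: "1 < mn"
  proof -
    have ne: "(\<lambda>j. norm (\<Phi> (lam j))) ` {1..m} \<noteq> {}" using m by auto
    have "mx \<in> (\<lambda>j. norm (\<Phi> (lam j))) ` {1..m}" "mn \<in> (\<lambda>j. norm (\<Phi> (lam j))) ` {1..m}"
      unfolding mx_def mn_def using ne by (intro Max_in Min_in; simp)+
    then show "ereal mx < \<rho>" "1 < mn" using D_lt poles_in lamE norm_Phi by auto
  qed
  have mx0: "0 < mx" using mx[of 1] mn[of 1] mn1 m by simp
  \<comment> \<open>The radii r1 and R stay free, to be adapted to the desired rate; r0 and a are
    fixed between 1 and the smallest |\<Phi>(lam k)|.\<close>
  have instance_exists: "\<exists>a r0 b xs \<rho>0. montessus E \<Phi> \<mu> p a r0 r1 b xs m lam A F R \<rho>0"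
    if r: "mx < r1" "r1 < R" "ereal R < \<rho>" for r1 R
  proof -
    obtain \<rho>0 where \<rho>0: "ereal R < ereal \<rho>0" "ereal \<rho>0 < \<rho>" using ereal_dense2[OF r(3)] by blast
    define xs where "xs = map (\<lambda>k. \<Phi> (lam k)) [1..<Suc m]"
    have set_xs: "set xs = (\<lambda>k. \<Phi> (lam k)) ` {1..m}"
      unfolding xs_def by (simp only: set_map set_upt atLeastLessThanSuc_atLeastAtMost)
    have "mn \<le> mx" using mx[of 1] mn[of 1] m by simp
    have "montessus E \<Phi> \<mu> p ((1 + (1 + mn) / 2) / 2) ((1 + mn) / 2) r1 ((r1 + R) / 2) xs m lam A F R \<rho>0"
    proof (unfold_locales, goal_cases)
      case (5 x)
      then obtain k where "k \<in> {1..m}" "x = \<Phi> (lam k)" by (auto simp: set_xs)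
      then show ?case using mx[of k] mn[of k] mn1 r by simp
    next
      case 11
      then show ?case using D_sub[of \<rho>0] \<rho>0 by (intro holomorphic_on_subset[OF A(1)]) simp
    qed (use mn1 r \<rho>0 \<open>mn \<le> mx\<close> m lamE A FA in \<open>auto simp: xs_def field_simps\<close>)
    then show ?thesis by blast
  qed
  have uniq: "\<forall>\<^sub>F n in sequentially. \<exists>!R. pade_approximant \<mu> p F n m R"
  proof -
    obtain R where R: "ereal mx < ereal R" "ereal R < \<rho>" using ereal_dense2[OF mx1] by blast
    obtain r1 where r1: "mx < r1" "r1 < R" using R(1) dense by auto
    obtain a r0 b xs \<rho>0 where "montessus E \<Phi> \<mu> p a r0 r1 b xs m lam A F R \<rho>0"
      using instance_exists[OF r1 R(2)] by blast
    then show ?thesis by (rule montessus.pade_unique)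
  qed
  have Q_rate: "\<exists>C>0. \<forall>\<^sub>F n in sequentially. coeff_norm m (Q n - (\<Prod>k\<in>{1..m}. [:- lam k, 1:])) \<le> C * \<theta> ^ n"
    if PQ: "\<forall>\<^sub>F n in sequentially. pade_orthogonal \<mu> p F n m (P n) (Q n)"
      and \<theta>: "0 < \<theta>" "ereal mx / \<rho> < ereal \<theta>" for P Q \<theta>
  proof -
    obtain R where R: "mx < R" "ereal R < \<rho>" "mx / R < \<theta>"
      using radius_choice[OF mx1 less_imp_le[OF mx0] \<theta> mx0] by blast
    \<comment> \<open>r1 must exceed every |\<Phi>(lam k)| and still satisfy r1/R <
      \<theta>.\<close>
    have "mx < min R (R * \<theta>)" using R mx0 by (simp add: field_simps)
    then obtain r1 where "mx < r1" "r1 < min R (R * \<theta>)" using dense by blast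
    then have r1: "mx < r1" "r1 < R" "r1 / R < \<theta>" using mx0 R by (auto simp: field_simps)
    obtain a r0 b xs \<rho>0 where "montessus E \<Phi> \<mu> p a r0 r1 b xs m lam A F R \<rho>0"
      using instance_exists[OF r1(1,2) R(2)] by blast
    then interpret MM: montessus E \<Phi> \<mu> p a r0 r1 b xs m lam A F R \<rho>0 .
    obtain C where C: "C > 0" and ev: "eventually (\<lambda>n. \<forall>Q. MM.orthQ n Q \<longrightarrow> coeff Q m = 1 \<longrightarrow>
        coeff_norm m (Q - MM.Qm) \<le> C * \<theta> ^ n) sequentially"
      by (rule MM.monic_close[OF r1(3)])
    have "\<forall>\<^sub>F n in sequentially. coeff_norm m (Q n - (\<Prod>k\<in>{1..m}. [:- lam k, 1:])) \<le> C * \<theta> ^ n"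
      using ev MM.pade_monic PQ by eventually_elim (simp add: MM.Qm_def)
    with C show ?thesis by blast
  qed
  have K_rate: "\<exists>C>0. \<forall>\<^sub>F n in sequentially. \<forall>z\<in>K. norm (G z - poly (P n) z / poly (Q n) z) \<le> C * \<theta> ^ n"
    if PQ: "\<forall>\<^sub>F n in sequentially. pade_orthogonal \<mu> p F n m (P n) (Q n)"
      and K: "compact K" "K \<subseteq> D - lam ` {1..m}"
      and \<theta>: "0 < \<theta>" "ereal (max_Phi E \<Phi> K) / \<rho> < ereal \<theta>" for P Q K \<theta>
  proof -
    define x where "x = max_Phi E \<Phi> K"
    have x: "1 \<le> x" "ereal x < \<rho>" "K \<subseteq> Dcl x"
      unfolding x_def using K D_lt by (intro max_Phi_bounds[OF K(1) \<rho>1]; auto)+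
    \<comment> \<open>R has to lie beyond the poles and beyond K, while the rate \<theta> concerns K
      alone.\<close>
    have "ereal (max mx x) < \<rho>" using mx1 x(2) by (simp add: max_def)
    moreover have "0 \<le> x" "0 < max mx x" "ereal x / \<rho> < ereal \<theta>" using x(1) mx0 \<theta> by (auto simp: x_def)
    ultimately obtain R where R: "max mx x < R" "ereal R < \<rho>" "x / R < \<theta>"
      using radius_choice \<theta>(1) by blast
    obtain r1 where r1: "mx < r1" "r1 < R" using R(1) dense[of mx R] by auto
    have "x < min R (R * \<theta>)" using R x by (simp add: field_simps)
    then obtain r where "x < r" "r < min R (R * \<theta>)" using dense by blast
    then have r: "1 < r" "r < R" "r / R < \<theta>" "x < r" using x R by (auto simp: field_simps)
    obtain a r0 b xs \<rho>0 where "montessus E \<Phi> \<mu> p a r0 r1 b xs m lam A F R \<rho>0"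
      using instance_exists[OF r1 R(2)] by blast
    then interpret MM: montessus E \<Phi> \<mu> p a r0 r1 b xs m lam A F R \<rho>0 .
    have "K \<subseteq> Dcl r - lam ` {1..m}" using K x(3) Dcl_Dop(4)[of x r] r(4) by auto
    then obtain C where C: "C > 0" and ev: "eventually (\<lambda>n. \<forall>P Q. pade_orthogonal \<mu> p F n m P Q \<longrightarrow>
        (\<forall>z\<in>K. norm (A z / poly MM.Qm z - poly P z / poly Q z) \<le> C * \<theta> ^ n)) sequentially"
      by (rule MM.approximant_error[OF r(1,2,3) K(1)])
    have GA: "G z = A z / poly MM.Qm z" if "z \<in> K" for z
      using A(3)[of z] that K by (auto simp: MM.poly_Qm)
    have "\<forall>\<^sub>F n in sequentially. \<forall>z\<in>K. norm (G z - poly (P n) z / poly (Q n) z) \<le> C * \<theta> ^ n"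
      using ev PQ by eventually_elim (simp add: GA)
    with C show ?thesis by blast
  qed
  have quot_lt_1: "ereal y / \<rho> < 1" if "ereal y < \<rho>" "0 < y" for y
    using that \<rho>1 by (cases \<rho>) (auto simp: one_ereal_def)
  have quot_nonneg: "0 \<le> ereal y / \<rho>" if "0 < y" for y
    using that \<rho>1 by (cases \<rho>) (auto simp: one_ereal_def)
  have conv: "uniform_limit K (\<lambda>n z. poly (P n) z / poly (Q n) z) G sequentially \<and>
      limsup (\<lambda>n. ereal (root n (sup_norm_on K (\<lambda>z. G z - poly (P n) z / poly (Q n) z))))
            \<le> ereal (max_Phi E \<Phi> K) / \<rho>"
    if PQ: "\<forall>\<^sub>F n in sequentially. pade_orthogonal \<mu> p F n m (P n) (Q n)"
      and K: "compact K" "K \<subseteq> D - lam ` {1..m}" for P Q K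
  proof
    have x: "1 \<le> max_Phi E \<Phi> K" "ereal (max_Phi E \<Phi> K) < \<rho>"
      using K D_lt by (intro max_Phi_bounds[OF K(1) \<rho>1]; auto)+
    show "uniform_limit K (\<lambda>n z. poly (P n) z / poly (Q n) z) G sequentially"
    proof (rule uniform_limitI)
      fix e :: real assume e: "e > 0"
      have "ereal (max_Phi E \<Phi> K) / \<rho> < ereal 1" using quot_lt_1[OF x(2)] x(1) by (simp add: one_ereal_def)
      then obtain \<theta> where \<theta>: "ereal (max_Phi E \<Phi> K) / \<rho> < ereal \<theta>" "ereal \<theta> < ereal 1"
        using ereal_dense2 by blast
      have "0 \<le> ereal (max_Phi E \<Phi> K) / \<rho>" using x(1) by (intro quot_nonneg) simp
      then have "0 < ereal \<theta>" using \<theta>(1) by (rule le_less_trans)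
      then have \<theta>0: "0 < \<theta>" by simp
      obtain C where C: "C > 0" "\<forall>\<^sub>F n in sequentially. \<forall>z\<in>K. norm (G z - poly (P n) z / poly (Q n) z) \<le> C * \<theta> ^ n"
        using K_rate[OF PQ K \<theta>0 \<theta>(1)] by blast
      have "(\<lambda>n. C * \<theta> ^ n) \<longlonglongrightarrow> C * 0"
        using \<theta> \<theta>0 by (intro tendsto_intros LIMSEQ_power_zero) auto
      then have "eventually (\<lambda>n. C * \<theta> ^ n < e) sequentially" using e by (auto elim: order_tendstoD)
      with C(2) show "\<forall>\<^sub>F n in sequentially. \<forall>z\<in>K. dist (poly (P n) z / poly (Q n) z) (G z) < e"
        by eventually_elim (auto simp: dist_norm norm_minus_commute intro: le_less_trans)
    qed
    show "limsup (\<lambda>n. ereal (root n (sup_norm_on K (\<lambda>z. G z - poly (P n) z / poly (Q n) z))))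
            \<le> ereal (max_Phi E \<Phi> K) / \<rho>"
    proof (rule le_ereal_approx)
      show "0 \<le> ereal (max_Phi E \<Phi> K) / \<rho>" using x(1) by (intro quot_nonneg) simp
      fix \<theta> :: real assume \<theta>: "0 < \<theta>" "ereal (max_Phi E \<Phi> K) / \<rho> < ereal \<theta>"
      obtain C where C: "C > 0" "\<forall>\<^sub>F n in sequentially. \<forall>z\<in>K. norm (G z - poly (P n) z / poly (Q n) z) \<le> C * \<theta> ^ n"
        using K_rate[OF PQ K \<theta>] by blast
      have "\<forall>\<^sub>F n in sequentially. sup_norm_on K (\<lambda>z. G z - poly (P n) z / poly (Q n) z) \<le> C * \<theta> ^ n"
        using C(2)
      proof eventually_elim
        case (elim n)
        then show ?case unfolding sup_norm_on_def using C(1) \<theta>(1) by (intro cSup_least) auto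
      qed
      then show "limsup (\<lambda>n. ereal (root n (sup_norm_on K (\<lambda>z. G z - poly (P n) z / poly (Q n) z)))) \<le> ereal \<theta>"
        by (rule limsup_root_le[OF C(1) \<theta>(1)])
    qed
  qed
  have denom: "limsup (\<lambda>n. ereal (root n (coeff_norm m (Q n - (\<Prod>k\<in>{1..m}. [:- lam k, 1:]))))) \<le> ereal mx / \<rho>"
    if PQ: "\<forall>\<^sub>F n in sequentially. pade_orthogonal \<mu> p F n m (P n) (Q n)" for P Q
  proof (rule le_ereal_approx)
    show "0 \<le> ereal mx / \<rho>" by (rule quot_nonneg[OF mx0])
    fix \<theta> :: real assume \<theta>: "0 < \<theta>" "ereal mx / \<rho> < ereal \<theta>"
    obtain C where C: "C > 0" "\<forall>\<^sub>F n in sequentially. coeff_norm m (Q n - (\<Prod>k\<in>{1..m}. [:- lam k, 1:])) \<le> C * \<theta> ^ n"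
      using Q_rate[OF PQ \<theta>] by blast
    then show "limsup (\<lambda>n. ereal (root n (coeff_norm m (Q n - (\<Prod>k\<in>{1..m}. [:- lam k, 1:]))))) \<le> ereal \<theta>"
      using \<theta>(1) by (intro limsup_root_le)
  qed
  show ?thesis
    using uniq conv denom quot_lt_1[OF mx1 mx0] unfolding mx_def[symmetric] by blast
qed

end
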